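(* Let $\kappa\in\mathbb{R}$ and let $(X,d)$ be an Alexandrov space with curvature $\ge\kappa$. Suppose that there exist two geodesics $\gamma:[0,l_1]\to X$ and $\eta:[0,l_2]\to X$ emanating from the same point $o:=\gamma(0)=\eta(0)$ of $X$, with $\mathrm{peri}(o,\gamma(l_1),\eta(l_2))<2\pi/\sqrt\kappa$ if $\kappa>0$, such that $$\angle(\gamma,\eta)=\tilde\angle_\kappa(o;\gamma(l_1),\eta(l_2)).$$ In addition, assume that there is a point $p\in(\gamma(l_1'),\eta(l_2'))$ for some $l_i'\in(0,l_i)$, $i=1,2$. Then the triangle with vertices $o,\gamma(l_1),\eta(l_2)$ spans the unique closed triangular region $D\subset X$ which contains $p$ and is isometric to the triangular region in $M^2_\kappa$ whose vertices are the points $\tilde o,\widetilde{\gamma(l_1)},\widetilde{\eta(l_2)}$ corresponding to $o,\gamma(l_1),\eta(l_2)$.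
   Context: Comparison angle: $\mathrm{peri}(x,y,z):=d(x,y)+d(y,z)+d(z,x)$. For $\kappa>0$ let $S_\kappa(r)=\sin(\sqrt\kappa r)/\sqrt\kappa$, for $\kappa<0$ let $S_\kappa(r)=\sinh(\sqrt{-\kappa}r)/\sqrt{-\kappa}$, and $C_\kappa:=S_\kappa'$. For points $x,y,z$ of a metric space (with $x\ne y$, $x\neq z$, and $\mathrm{peri}(x,y,z)<2\pi/\sqrt\kappa$ if $\kappa>0$), $\tilde\angle_\kappa(x;y,z)\in[0,\pi]$ is defined by $\cos\tilde\angle_\kappa(x;y,z)=\frac{d(x,y)^2+d(x,z)^2-d(y,z)^2}{2d(x,y)d(x,z)}$ if $\kappa=0$, and $\cos\tilde\angle_\kappa(x;y,z)=\frac{C_\kappa(d(y,z))-C_\kappa(d(x,y))C_\kappa(d(x,z))}{\kappa S_\kappa(d(x,y))S_\kappa(d(x,z))}$ if $\kappa\ne0$. A quadruple consists of four distinct points; its size is the maximum of the perimeters of all triangles formed by the four points. A metric space has curvature $\ge\kappa$ if $\tilde\angle_\kappa(x;y,z)+\tilde\angle_\kappa(x;z,w)+\tilde\angle_\kappa(x;w,y)\le2\pi$ for every quadruple $(x;y,z,w)$, of size less than $2\pi/\sqrt\kappa$ if $\kappa>0$. An Alexandrov space with curvature $\ge\kappa$ is a complete length space (distance = infimum of lengths of connecting curves; not necessarily geodesic, locally compact or finite dimensional) with curvature $\ge\kappa$. A geodesic is a constant speed (usually unit speed) curve $[0,l]\to X$ whose length equals the distance between its end points. The angle between geodesics $\gamma,\eta$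 emanating from the same point $o$ is $\angle(\gamma,\eta):=\lim_{s,t\to0+}\tilde\angle_\kappa(o;\gamma(s),\eta(t))$, which always exists here. For points $a,b$ of a metric space, $[a,b]:=\{u: d(a,b)=d(a,u)+d(u,b)\}$ and $(a,b):=[a,b]\setminus\{a,b\}$. $M^2_\kappa$ is the simply connected complete surface of constant curvature $\kappa$; a tilde indicates the image under an isometric embedding of the three point set $\{o,\gamma(l_1),\eta(l_2)\}$ into $M^2_\kappa$. The triangular region with given vertices in $M^2_\kappa$ is the closed region bounded by the geodesic triangle with these vertices. The region $D$ spanned by the triangle has $o,\gamma(l_1),\eta(l_2)$ as its vertices, i.e. they correspond to $\tilde o,\widetilde{\gamma(l_1)},\widetilde{\eta(l_2)}$ under the isometry; subsets of metric spaces carry the restricted metric. *)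

theory Defs
  imports "HOL-Analysis.Analysis"
begin

subsection \<open>Comparison angles\<close>

definition peri :: "'a::metric_space \<Rightarrow> 'a \<Rightarrow> 'a \<Rightarrow> real" where
  "peri x y z = dist x y + dist y z + dist z x"

definition S_fun :: "real \<Rightarrow> real \<Rightarrow> real" where
  "S_fun \<kappa> r =
     (if \<kappa> > 0 then sin (sqrt \<kappa> * r) / sqrt \<kappa>
      else if \<kappa> < 0 then sinh (sqrt (- \<kappa>) * r) / sqrt (- \<kappa>)
      else r)"

definition C_fun :: "real \<Rightarrow> real \<Rightarrow> real" where
  "C_fun \<kappa> = deriv (S_fun \<kappa>)"

lemma C_fun_eq:
  "C_fun \<kappa> r =
     (if \<kappa> > 0 then cos (sqrt \<kappa> * r)
      else if \<kappa> < 0 then cosh (sqrt (- \<kappa>) * r)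
      else 1)"
proof -
  have "(S_fun \<kappa> has_field_derivative
     (if \<kappa> > 0 then cos (sqrt \<kappa> * r)
      else if \<kappa> < 0 then cosh (sqrt (- \<kappa>) * r)
      else 1)) (at r)"
    unfolding S_fun_def [abs_def]
    by (cases "\<kappa> > 0"; cases "\<kappa> < 0")
      (auto intro!: derivative_eq_intros simp: mult.assoc)
  then show ?thesis
    unfolding C_fun_def by (rule DERIV_imp_deriv)
qed

text \<open>
  Meaningful only for \<open>x \<noteq> y\<close>, \<open>x \<noteq> z\<close> and, if \<open>\<kappa> > 0\<close>, \<open>peri x y z < 2 * pi / sqrt \<kappa>\<close>; in that
  case the argument of \<^const>\<open>arccos\<close> lies in \<open>[-1, 1]\<close>.
\<close>

definition comp_angle :: "real \<Rightarrow> 'a::metric_space \<Rightarrow> 'a \<Rightarrow> 'a \<Rightarrow> real" where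
  "comp_angle \<kappa> x y z = arccos
     (if \<kappa> = 0
      then ((dist x y)\<^sup>2 + (dist x z)\<^sup>2 - (dist y z)\<^sup>2) / (2 * dist x y * dist x z)
      else (C_fun \<kappa> (dist y z) - C_fun \<kappa> (dist x y) * C_fun \<kappa> (dist x z)) /
           (\<kappa> * S_fun \<kappa> (dist x y) * S_fun \<kappa> (dist x z)))"


subsection \<open>Alexandrov spaces\<close>

definition quad_size :: "'a::metric_space \<Rightarrow> 'a \<Rightarrow> 'a \<Rightarrow> 'a \<Rightarrow> real" where
  "quad_size x y z w = Max {peri x y z, peri x y w, peri x z w, peri y z w}"

definition curvature_ge :: "real \<Rightarrow> 'a::metric_space itself \<Rightarrow> bool" where
  "curvature_ge \<kappa> (_ :: 'a itself) \<longleftrightarrow>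
     (\<forall>x y z w :: 'a. distinct [x, y, z, w] \<longrightarrow>
        (\<kappa> > 0 \<longrightarrow> quad_size x y z w < 2 * pi / sqrt \<kappa>) \<longrightarrow>
        comp_angle \<kappa> x y z + comp_angle \<kappa> x z w + comp_angle \<kappa> x w y \<le> 2 * pi)"

text \<open>The length of \<open>g\<close> restricted to \<open>[a, b]\<close>, possibly infinite.\<close>

definition curve_length :: "(real \<Rightarrow> 'a::metric_space) \<Rightarrow> real \<Rightarrow> real \<Rightarrow> ereal" where
  "curve_length g a b =
     (SUP (n, t) \<in> {(n :: nat, t :: nat \<Rightarrow> real). mono_on {..n} t \<and> t 0 = a \<and> t n = b}.
        ereal (\<Sum>i<n. dist (g (t i)) (g (t (Suc i)))))"

text \<open>
  The infimum over the empty set is \<open>\<infinity>\<close> in \<^typ>\<open>ereal\<close>, so any two points of a length space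
  are joined by a rectifiable curve.
\<close>

definition length_space :: "'a::metric_space itself \<Rightarrow> bool" where
  "length_space (_ :: 'a itself) \<longleftrightarrow>
     (\<forall>x y :: 'a. ereal (dist x y) =
        (INF g \<in> {g. path g \<and> pathstart g = x \<and> pathfinish g = y}. curve_length g 0 1))"

definition alexandrov_space :: "real \<Rightarrow> 'a::metric_space itself \<Rightarrow> bool" where
  "alexandrov_space \<kappa> (T :: 'a itself) \<longleftrightarrow>
     complete (UNIV :: 'a set) \<and> length_space T \<and> curvature_ge \<kappa> T"


subsection \<open>Geodesics, angles, betweenness\<close>

definition geodesic :: "real \<Rightarrow> (real \<Rightarrow> 'a::metric_space) \<Rightarrow> bool" where
  "geodesic l \<gamma> \<longleftrightarrow>
     0 \<le> l \<and> continuous_on {0..l} \<gamma> \<and>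
     (\<exists>v\<ge>0. \<forall>s t. 0 \<le> s \<and> s \<le> t \<and> t \<le> l \<longrightarrow> curve_length \<gamma> s t = ereal (v * (t - s))) \<and>
     curve_length \<gamma> 0 l = ereal (dist (\<gamma> 0) (\<gamma> l))"

text \<open>Only used for curves with \<open>\<gamma> 0 = \<eta> 0\<close>.\<close>

definition angle :: "real \<Rightarrow> (real \<Rightarrow> 'a::metric_space) \<Rightarrow> (real \<Rightarrow> 'a) \<Rightarrow> real" where
  "angle \<kappa> \<gamma> \<eta> =
     Lim (at_right 0 \<times>\<^sub>F at_right 0) (\<lambda>(s, t). comp_angle \<kappa> (\<gamma> 0) (\<gamma> s) (\<eta> t))"

definition between_set :: "'a set \<Rightarrow> ('a \<Rightarrow> 'a \<Rightarrow> real) \<Rightarrow> 'a \<Rightarrow> 'a \<Rightarrow> 'a set" where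
  "between_set M d a b = {u \<in> M. d a b = d a u + d u b}"

definition open_between_set :: "'a set \<Rightarrow> ('a \<Rightarrow> 'a \<Rightarrow> real) \<Rightarrow> 'a \<Rightarrow> 'a \<Rightarrow> 'a set" where
  "open_between_set M d a b = between_set M d a b - {a, b}"


subsection \<open>The model surfaces\<close>

text \<open>
  \<open>M\<^sup>2\<^sub>\<kappa>\<close> is the sphere of radius \<open>1 / sqrt \<kappa>\<close> with its angular metric for \<open>\<kappa> > 0\<close>, a Euclidean
  plane for \<open>\<kappa> = 0\<close>, and the upper sheet of the hyperboloid \<open>\<langle>x, x\<rangle> = 1 / \<kappa>\<close> for the Minkowski
  form \<open>\<langle>x, y\<rangle> = x\<^sub>1 y\<^sub>1 + x\<^sub>2 y\<^sub>2 - x\<^sub>3 y\<^sub>3\<close> for \<open>\<kappa> < 0\<close>. In all three cases the metric induces the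
  subspace topology of \<open>\<real>\<^sup>3\<close>.
\<close>

definition minkowski :: "real^3 \<Rightarrow> real^3 \<Rightarrow> real" where
  "minkowski x y = x$1 * y$1 + x$2 * y$2 - x$3 * y$3"

definition model_space :: "real \<Rightarrow> (real^3) set" where
  "model_space \<kappa> =
     (if \<kappa> > 0 then sphere 0 (1 / sqrt \<kappa>)
      else if \<kappa> < 0 then {x. minkowski x x = 1 / \<kappa> \<and> x$3 > 0}
      else {x. x$3 = 0})"

definition model_dist :: "real \<Rightarrow> real^3 \<Rightarrow> real^3 \<Rightarrow> real" where
  "model_dist \<kappa> x y =
     (if \<kappa> > 0 then arccos (\<kappa> * (x \<bullet> y)) / sqrt \<kappa>
      else if \<kappa> < 0 then arcosh (\<kappa> * minkowski x y) / sqrt (- \<kappa>)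
      else dist x y)"

definition model_triangle :: "real \<Rightarrow> real^3 \<Rightarrow> real^3 \<Rightarrow> real^3 \<Rightarrow> (real^3) set" where
  "model_triangle \<kappa> a b c =
     between_set (model_space \<kappa>) (model_dist \<kappa>) a b \<union>
     between_set (model_space \<kappa>) (model_dist \<kappa>) b c \<union>
     between_set (model_space \<kappa>) (model_dist \<kappa>) c a"

text \<open>
  The triangle together with the components of its complement that it bounds. For \<open>\<kappa> \<le> 0\<close> these
  are the bounded components. On the sphere every component is bounded; for a triangle of
  perimeter less than \<open>2 * pi / sqrt \<kappa>\<close> the inner one is the one contained in an open hemisphere,
  i.e. in an open ball of radius \<open>pi / (2 * sqrt \<kappa>)\<close>. A degenerate triangle bounds no component,
  so its region is the triangle itself.
\<close>

definition model_region :: "real \<Rightarrow> real^3 \<Rightarrow> real^3 \<Rightarrow> real^3 \<Rightarrow> (real^3) set" where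
  "model_region \<kappa> a b c =
     model_triangle \<kappa> a b c \<union>
     {x \<in> model_space \<kappa> - model_triangle \<kappa> a b c.
        \<exists>z \<in> model_space \<kappa>. \<exists>r. (\<kappa> > 0 \<longrightarrow> r \<le> pi / (2 * sqrt \<kappa>)) \<and>
          connected_component_set (model_space \<kappa> - model_triangle \<kappa> a b c) x
            \<subseteq> {y \<in> model_space \<kappa>. model_dist \<kappa> z y < r}}"

definition comp_triangle ::
    "real \<Rightarrow> 'a::metric_space \<Rightarrow> 'a \<Rightarrow> 'a \<Rightarrow> real^3 \<Rightarrow> real^3 \<Rightarrow> real^3 \<Rightarrow> bool" where
  "comp_triangle \<kappa> x y z x' y' z' \<longleftrightarrow>
     x' \<in> model_space \<kappa> \<and> y' \<in> model_space \<kappa> \<and> z' \<in> model_space \<kappa> \<and>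
     model_dist \<kappa> x' y' = dist x y \<and>
     model_dist \<kappa> y' z' = dist y z \<and>
     model_dist \<kappa> z' x' = dist z x"

text \<open>
  \<open>D\<close> is isometric to the region with vertices \<open>x', y', z'\<close>, with \<open>x, y, z\<close> corresponding to
  \<open>x', y', z'\<close>.
\<close>

definition triangular_region ::
    "real \<Rightarrow> real^3 \<Rightarrow> real^3 \<Rightarrow> real^3 \<Rightarrow> 'a::metric_space \<Rightarrow> 'a \<Rightarrow> 'a \<Rightarrow> 'a set \<Rightarrow> bool" where
  "triangular_region \<kappa> x' y' z' x y z D \<longleftrightarrow>
     (\<exists>f. f ` model_region \<kappa> x' y' z' = D \<and>
        (\<forall>u \<in> model_region \<kappa> x' y' z'. \<forall>v \<in> model_region \<kappa> x' y' z'.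
           dist (f u) (f v) = model_dist \<kappa> u v) \<and>
        f x' = x \<and> f y' = y \<and> f z' = z)"


subsection \<open>Existence of comparison triangles\<close>

lemma model_hinge_pos:
  fixes \<kappa> a b c :: real
  assumes \<kappa>: "\<kappa> > 0" and pos: "a > 0" "b > 0"
    and tri: "\<bar>a - b\<bar> \<le> c" "c \<le> a + b"
    and per: "a + b + c < 2 * pi / sqrt \<kappa>"
  shows "\<exists>x y z. x \<in> model_space \<kappa> \<and> y \<in> model_space \<kappa> \<and> z \<in> model_space \<kappa> \<and>
    model_dist \<kappa> x y = a \<and> model_dist \<kappa> y z = c \<and> model_dist \<kappa> z x = b"
proof -
  define k where "k = sqrt \<kappa>"
  have k: "k > 0" "k * k = \<kappa>" using \<kappa> by (auto simp: k_def)
  define A B C where "A = k * a" and "B = k * b" and "C = k * c"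
  have per': "A + B + C < 2 * pi"
    using per k by (simp add: A_def B_def C_def k_def [symmetric] field_simps)
  have AB: "0 < A" "0 < B" using pos k by (auto simp: A_def B_def)
  have t2: "C \<le> A + B" using mult_left_mono [OF tri(2), of k] k
    by (simp add: A_def B_def C_def algebra_simps)
  have "k * \<bar>a - b\<bar> \<le> C" using mult_left_mono [OF tri(1), of k] k by (simp add: C_def)
  then have t1: "\<bar>A - B\<bar> \<le> C" using k
    by (simp add: A_def B_def C_def abs_mult flip: right_diff_distrib)
  have le_pi: "A < pi" "B < pi" "C < pi" "0 \<le> C" using per' t1 t2 AB by linarith+
  have sA: "sin A > 0" and sB: "sin B > 0" using AB le_pi by (auto intro: sin_gt_zero)
  define q where "q = (cos C - cos A * cos B) / (sin A * sin B)"
  have "cos C \<le> cos \<bar>A - B\<bar>"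
    by (rule cos_monotone_0_pi_le) (use t1 le_pi AB in auto)
  then have u: "cos C \<le> cos A * cos B + sin A * sin B" by (simp add: cos_diff)
  have "cos C \<ge> cos (A + B)"
  proof (cases "A + B \<le> pi")
    case True
    then show ?thesis using t2 le_pi by (intro cos_monotone_0_pi_le) auto
  next
    case False
    have "cos (2 * pi - (A + B)) \<le> cos C"
      using False per' le_pi by (intro cos_monotone_0_pi_le) auto
    then show ?thesis by (simp add: cos_diff)
  qed
  then have l: "cos A * cos B - sin A * sin B \<le> cos C" by (simp add: cos_add)
  have q: "-1 \<le> q" "q \<le> 1"
    unfolding q_def using u l sA sB by (auto simp: field_simps)
  define s where "s = sqrt (1 - q\<^sup>2)"
  have s: "q\<^sup>2 + s\<^sup>2 = 1" unfolding s_def using q by (simp add: abs_square_le_1 abs_le_iff)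
  have qq: "sin A * (sin B * q) + cos A * cos B = cos C"
    unfolding q_def using sA sB by (simp add: field_simps)
  define x y z :: "real^3" where "x = vector [0, 0, 1 / k]"
    and "y = vector [sin A / k, 0, cos A / k]"
    and "z = vector [sin B * q / k, sin B * s / k, cos B / k]"
  have inn: "v \<bullet> w = v$1 * w$1 + v$2 * w$2 + v$3 * w$3" for v w :: "real^3"
    by (simp add: inner_vec_def sum_3)
  have mem: "v \<in> model_space \<kappa> \<longleftrightarrow> \<kappa> * (v \<bullet> v) = 1" for v
  proof -
    have "v \<in> model_space \<kappa> \<longleftrightarrow> norm v = 1 / k" using \<kappa> by (simp add: model_space_def k_def)
    also have "\<dots> \<longleftrightarrow> (norm v)\<^sup>2 = (1 / k)\<^sup>2" using k by (simp add: power2_eq_iff_nonneg)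
    also have "\<dots> \<longleftrightarrow> \<kappa> * (v \<bullet> v) = 1"
      using k \<kappa> by (simp add: dot_square_norm power_divide power2_eq_square field_simps)
    finally show ?thesis .
  qed
  have "(sin B * q)\<^sup>2 + (sin B * s)\<^sup>2 + (cos B)\<^sup>2 = (sin B)\<^sup>2 * (q\<^sup>2 + s\<^sup>2) + (cos B)\<^sup>2"
    by (simp add: algebra_simps power_mult_distrib)
  then have B1: "(sin B * q)\<^sup>2 + (sin B * s)\<^sup>2 + (cos B)\<^sup>2 = 1" using s by simp
  have ip: "\<kappa> * (vector [p1 / k, p2 / k, p3 / k] \<bullet> (vector [q1 / k, q2 / k, q3 / k] :: real^3))
      = p1 * q1 + p2 * q2 + p3 * q3" for p1 p2 p3 q1 q2 q3
    using k by (simp add: inn k(2) [symmetric] field_simps)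
  have xx: "\<kappa> * (x \<bullet> x) = 1" "\<kappa> * (y \<bullet> y) = 1" "\<kappa> * (z \<bullet> z) = 1"
    "\<kappa> * (x \<bullet> y) = cos A" "\<kappa> * (y \<bullet> z) = cos C" "\<kappa> * (z \<bullet> x) = cos B"
    using ip [of 0 0 1 0 0 1] ip [of "sin A" 0 "cos A" "sin A" 0 "cos A"]
      ip [of "sin B * q" "sin B * s" "cos B" "sin B * q" "sin B * s" "cos B"]
      ip [of 0 0 1 "sin A" 0 "cos A"]
      ip [of "sin A" 0 "cos A" "sin B * q" "sin B * s" "cos B"]
      ip [of "sin B * q" "sin B * s" "cos B" 0 0 1] B1 qq sin_cos_squared_add [of A]
    unfolding x_def y_def z_def by (simp_all add: power2_eq_square)
  have "model_dist \<kappa> x y = a" "model_dist \<kappa> y z = c" "model_dist \<kappa> z x = b"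
    unfolding model_dist_def xx using \<kappa> k AB le_pi
    by (simp_all add: arccos_cos k_def [symmetric] A_def B_def C_def)
  then show ?thesis using mem xx by blast
qed

lemma model_hinge_neg:
  fixes \<kappa> a b c :: real
  assumes \<kappa>: "\<kappa> < 0" and pos: "a > 0" "b > 0"
    and tri: "\<bar>a - b\<bar> \<le> c" "c \<le> a + b"
  shows "\<exists>x y z. x \<in> model_space \<kappa> \<and> y \<in> model_space \<kappa> \<and> z \<in> model_space \<kappa> \<and>
    model_dist \<kappa> x y = a \<and> model_dist \<kappa> y z = c \<and> model_dist \<kappa> z x = b"
proof -
  define k where "k = sqrt (- \<kappa>)"
  have k: "k > 0" "k * k = - \<kappa>" using \<kappa> by (auto simp: k_def)
  define A B C where "A = k * a" and "B = k * b" and "C = k * c"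
  have AB: "0 < A" "0 < B" using pos k by (auto simp: A_def B_def)
  have t2: "C \<le> A + B" using mult_left_mono [OF tri(2), of k] k
    by (simp add: A_def B_def C_def algebra_simps)
  have "k * \<bar>a - b\<bar> \<le> C" using mult_left_mono [OF tri(1), of k] k by (simp add: C_def)
  then have t1: "\<bar>A - B\<bar> \<le> C" using k
    by (simp add: A_def B_def C_def abs_mult flip: right_diff_distrib)
  have C0: "0 \<le> C" using t1 by linarith
  have sA: "sinh A > 0" and sB: "sinh B > 0" using AB by auto
  define q where "q = (cosh A * cosh B - cosh C) / (sinh A * sinh B)"
  have "cosh \<bar>A - B\<bar> \<le> cosh C"
    by (subst cosh_real_nonneg_le_iff) (use t1 C0 in auto)
  moreover have "cosh \<bar>A - B\<bar> = cosh (A - B)" by simp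
  ultimately have u: "cosh A * cosh B - sinh A * sinh B \<le> cosh C" by (simp add: cosh_diff)
  have "cosh C \<le> cosh (A + B)"
    by (subst cosh_real_nonneg_le_iff) (use t2 C0 AB in auto)
  then have l: "cosh C \<le> cosh A * cosh B + sinh A * sinh B" by (simp add: cosh_add)
  have q: "-1 \<le> q" "q \<le> 1"
    unfolding q_def using u l sA sB by (auto simp: field_simps)
  define s where "s = sqrt (1 - q\<^sup>2)"
  have s: "q\<^sup>2 + s\<^sup>2 = 1" unfolding s_def using q by (simp add: abs_square_le_1 abs_le_iff)
  have qq: "cosh A * cosh B - sinh A * (sinh B * q) = cosh C"
    unfolding q_def using sA sB by (simp add: field_simps)
  define x y z :: "real^3" where "x = vector [0, 0, 1 / k]"
    and "y = vector [sinh A / k, 0, cosh A / k]"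
    and "z = vector [sinh B * q / k, sinh B * s / k, cosh B / k]"
  have mem: "v \<in> model_space \<kappa> \<longleftrightarrow> \<kappa> * minkowski v v = 1 \<and> v$3 > 0" for v
    using \<kappa> by (auto simp: model_space_def field_simps)
  have "(sinh B * q)\<^sup>2 + (sinh B * s)\<^sup>2 = (sinh B)\<^sup>2 * (q\<^sup>2 + s\<^sup>2)"
    by (simp add: algebra_simps power_mult_distrib)
  then have B1: "(cosh B)\<^sup>2 - (sinh B * q)\<^sup>2 - (sinh B * s)\<^sup>2 = 1"
    using s cosh_square_eq [of B] by simp
  have ip: "\<kappa> * minkowski (vector [p1 / k, p2 / k, p3 / k]) (vector [q1 / k, q2 / k, q3 / k])
      = p3 * q3 - p1 * q1 - p2 * q2" for p1 p2 p3 q1 q2 q3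
  proof -
    have \<kappa>k: "\<kappa> = - (k * k)" using k by simp
    show ?thesis unfolding \<kappa>k using k(1) by (simp add: minkowski_def field_simps)
  qed
  have xx: "\<kappa> * minkowski x x = 1" "\<kappa> * minkowski y y = 1" "\<kappa> * minkowski z z = 1"
    "\<kappa> * minkowski x y = cosh A" "\<kappa> * minkowski y z = cosh C" "\<kappa> * minkowski z x = cosh B"
    using ip [of 0 0 1 0 0 1] ip [of "sinh A" 0 "cosh A" "sinh A" 0 "cosh A"]
      ip [of "sinh B * q" "sinh B * s" "cosh B" "sinh B * q" "sinh B * s" "cosh B"]
      ip [of 0 0 1 "sinh A" 0 "cosh A"]
      ip [of "sinh A" 0 "cosh A" "sinh B * q" "sinh B * s" "cosh B"]
      ip [of "sinh B * q" "sinh B * s" "cosh B" 0 0 1] B1 qq cosh_square_eq [of A]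
    unfolding x_def y_def z_def by (simp_all add: power2_eq_square)
  have "x$3 > 0" "y$3 > 0" "z$3 > 0" using k by (simp_all add: x_def y_def z_def)
  moreover have "model_dist \<kappa> x y = a" "model_dist \<kappa> y z = c" "model_dist \<kappa> z x = b"
    unfolding model_dist_def xx using \<kappa> k AB C0
    by (simp_all add: arcosh_cosh_real k_def [symmetric] A_def B_def C_def)
  ultimately show ?thesis using mem xx by blast
qed

lemma model_hinge_zero:
  fixes a b c :: real
  assumes pos: "a > 0" "b > 0" and tri: "\<bar>a - b\<bar> \<le> c" "c \<le> a + b"
  shows "\<exists>x y z. x \<in> model_space 0 \<and> y \<in> model_space 0 \<and> z \<in> model_space 0 \<and>
    model_dist 0 x y = a \<and> model_dist 0 y z = c \<and> model_dist 0 z x = b"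
proof -
  define q where "q = (a\<^sup>2 + b\<^sup>2 - c\<^sup>2) / (2 * a * b)"
  have C0: "0 \<le> c" using tri by linarith
  have "\<bar>a - b\<bar>\<^sup>2 \<le> c\<^sup>2" "c\<^sup>2 \<le> (a + b)\<^sup>2"
    using power_mono [OF tri(1), of 2] power_mono [OF tri(2) C0, of 2] by auto
  then have q: "-1 \<le> q" "q \<le> 1"
    unfolding q_def using pos by (auto simp: field_simps power2_eq_square)
  define s where "s = sqrt (1 - q\<^sup>2)"
  have s: "q\<^sup>2 + s\<^sup>2 = 1" unfolding s_def using q by (simp add: abs_square_le_1 abs_le_iff)
  have qq: "2 * a * b * q = a\<^sup>2 + b\<^sup>2 - c\<^sup>2" unfolding q_def using pos by simp
  define x y z :: "real^3" where "x = vector [0, 0, 0]"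
    and "y = vector [a, 0, 0]" and "z = vector [b * q, b * s, 0]"
  have d: "dist v w = sqrt ((v$1 - w$1)\<^sup>2 + (v$2 - w$2)\<^sup>2 + (v$3 - w$3)\<^sup>2)" for v w :: "real^3"
    by (simp add: dist_norm norm_vec_def L2_set_def sum_3)
  have e1: "(b * q)\<^sup>2 + (b * s)\<^sup>2 = b\<^sup>2 * (q\<^sup>2 + s\<^sup>2)"
    by (simp add: algebra_simps power_mult_distrib)
  have "(a - b * q)\<^sup>2 + (b * s)\<^sup>2 = a\<^sup>2 + ((b * q)\<^sup>2 + (b * s)\<^sup>2) - 2 * a * b * q"
    by (simp add: power2_eq_square algebra_simps)
  then have e2: "(a - b * q)\<^sup>2 + (b * s)\<^sup>2 = c\<^sup>2" using e1 s qq by simp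
  have "model_dist 0 x y = a" "model_dist 0 y z = c" "model_dist 0 z x = b"
    using e1 e2 s pos C0 by (simp_all add: model_dist_def d x_def y_def z_def)
  moreover have "x \<in> model_space 0" "y \<in> model_space 0" "z \<in> model_space 0"
    by (simp_all add: model_space_def x_def y_def z_def)
  ultimately show ?thesis by blast
qed

lemma comp_triangle_exists:
  fixes x y z :: "'a::metric_space"
  assumes "x \<noteq> y" "x \<noteq> z" and "\<kappa> > 0 \<Longrightarrow> peri x y z < 2 * pi / sqrt \<kappa>"
  shows "\<exists>x' y' z'. comp_triangle \<kappa> x y z x' y' z'"
proof -
  have "\<bar>dist x y - dist z x\<bar> \<le> dist y z" "dist y z \<le> dist x y + dist z x"
    "dist x y > 0" "dist z x > 0"
    using assms dist_triangle [of x y z] dist_triangle [of x z y] dist_triangle [of y z x]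
    by (auto simp: dist_commute)
  then show ?thesis
    using assms(3) model_hinge_pos [of \<kappa> "dist x y" "dist z x" "dist y z"]
      model_hinge_neg [of \<kappa> "dist x y" "dist z x" "dist y z"]
      model_hinge_zero [of "dist x y" "dist z x" "dist y z"]
    unfolding comp_triangle_def peri_def
    by (cases "\<kappa> > 0"; cases "\<kappa> < 0") (auto simp: algebra_simps)
qed

end

theory Submission
  imports Defs
begin

text \<open>
  By monotonicity of comparison angles, equality of the angle with the comparison angle forces
  \<open>d(\<gamma>(s), \<eta>(t))\<close> to be the distance of the corresponding points in the model triangle, for all \<open>s\<close>
  and \<open>t\<close>. Stewart's theorem becomes an inequality in the space: distances to a point on a chord are at
  least those in the model (lower bound), and equality at one inner point of a chord propagates to its
  end points (upper bound). Hence \<open>p\<close>, too, has the distances of its model point to both sides. Starting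
  from the two sides and \<open>p\<close>, take a maximal distance preserving relation between the model region and
  the space. If it contains the ends and one inner point of a chord, then it contains the whole chord,
  because prolongable geodesics exist in a complete length space of curvature bounded below. As every
  point inside the model triangle is on a cevian crossing a cevian through \<open>p\<close>, the relation is total
  on the region. For uniqueness, a second filling is compared with the first along the segments from \<open>p\<close>:
  prolonged backwards to a side, they are geodesics, and geodesics do not branch.
\<close>

section \<open>Generalised trigonometric functions\<close>

text \<open>The space is not assumed to be geodesic, so a chord between two known points need not be
  realised by a curve. What can be realised is a segment that goes on beyond its end; this is why a
  chord is always filled starting from a known inner point. A pair that keeps the distances to all
  points already present belongs to the maximal relation, so no formula for the map is needed.
  Points of the third side are reached only as ends of segments from \<open>o'\<close>; completeness
  supplies them as limits. In the model, points are described by nonnegative weights of the lifted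
  vertices, which turns segments, cevians, hemispheres and complementary components into linear
  algebra. For positive curvature the four-point condition concerns only small quadruples, and
  \<open>md\<close> increases only up to \<open>pi / sqrt K\<close>. Hence the perimeter bounds in
  almost every lemma; for the region they come from an open hemisphere containing the vertices. That
  a second filling takes the value \<open>p\<close> at the same model point follows because the
  distances to the vertices determine a point of the region.\<close>

abbreviation sn :: "real \<Rightarrow> real \<Rightarrow> real" where
  "sn \<equiv> S_fun"

text \<open>The modified distance \<open>(1 - C) / K\<close>, continued to \<open>K = 0\<close>. In terms of \<open>sn\<close> and \<open>md\<close> the law
  of cosines and Stewart's theorem are the same polynomial identities for every curvature.\<close>

definition md :: "real \<Rightarrow> real \<Rightarrow> real" where
  "md K r = (if K = 0 then r\<^sup>2 / 2 else (1 - C_fun K r) / K)"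

text \<open>Applied to distances and to half perimeters.\<close>

definition short :: "real \<Rightarrow> real \<Rightarrow> bool" where
  "short K r \<longleftrightarrow> (K > 0 \<longrightarrow> r < pi / sqrt K)"

lemma short_mono: "short K s \<Longrightarrow> r \<le> s \<Longrightarrow> short K r"
  by (auto simp: short_def)

lemma C_fun_md: "C_fun K r = 1 - K * md K r"
  by (simp add: md_def C_fun_eq)

lemma sn_0 [simp]: "sn K 0 = 0"
  by (simp add: S_fun_def)

lemma md_0 [simp]: "md K 0 = 0"
  by (simp add: md_def C_fun_eq)

lemma sn_minus [simp]: "sn K (- r) = - sn K r"
  by (simp add: S_fun_def)

lemma md_minus [simp]: "md K (- r) = md K r"
  by (simp add: md_def C_fun_eq)

lemma sn_add:
  "sn K (a + b) = sn K a * (1 - K * md K b) + (1 - K * md K a) * sn K b"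
  unfolding C_fun_md [symmetric]
  by (simp add: S_fun_def C_fun_eq sin_add sinh_add distrib_left add_divide_distrib)

lemma sn_square: "(sn K r)\<^sup>2 = 2 * md K r - K * (md K r)\<^sup>2"
proof (cases "K = 0")
  case True
  then show ?thesis by (simp add: S_fun_def md_def)
next
  case False
  have *: "K * (sn K r)\<^sup>2 = 1 - (C_fun K r)\<^sup>2"
    by (simp add: S_fun_def C_fun_eq power_divide sin_squared_eq sinh_square_eq False)
  have "K * (sn K r)\<^sup>2 = K * (2 * md K r - K * (md K r)\<^sup>2)"
    unfolding * C_fun_md by (simp add: power2_eq_square algebra_simps)
  with False show ?thesis by simp
qed

lemma md_add:
  "md K (a + b) = md K a + md K b - K * md K a * md K b + sn K a * sn K b"
proof (cases "K = 0")
  case True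
  then show ?thesis by (simp add: S_fun_def md_def power2_eq_square algebra_simps add_divide_distrib)
next
  case False
  have "C_fun K (a + b) = C_fun K a * C_fun K b - K * (sn K a * sn K b)"
    using False by (simp add: S_fun_def C_fun_eq cos_add cosh_add distrib_left)
  then have "K * md K (a + b) = K * (md K a + md K b - K * md K a * md K b + sn K a * sn K b)"
    unfolding C_fun_md by (simp add: algebra_simps)
  with False show ?thesis by simp
qed

lemma sn_pos: "0 < r \<Longrightarrow> short K r \<Longrightarrow> 0 < sn K r"
  by (auto simp: S_fun_def short_def field_simps intro!: sin_gt_zero)

lemma sn_nonneg: "0 \<le> r \<Longrightarrow> short K r \<Longrightarrow> 0 \<le> sn K r"
  using sn_pos [of r K] by (cases "r = 0") auto

lemma md_strict_mono:
  assumes "0 \<le> a" "a < b" "K > 0 \<Longrightarrow> b \<le> pi / sqrt K"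
  shows "md K a < md K b"
proof -
  consider "K = 0" | "K > 0" | "K < 0" by linarith
  then show ?thesis
  proof cases
    case 1
    then show ?thesis using assms by (simp add: md_def power_strict_mono)
  next
    case 2
    have "cos (sqrt K * b) < cos (sqrt K * a)"
      using 2 assms by (intro cos_monotone_0_pi) (auto simp: field_simps)
    then show ?thesis using 2 by (simp add: md_def C_fun_eq divide_strict_right_mono)
  next
    case 3
    have "cosh (sqrt (- K) * a) < cosh (sqrt (- K) * b)"
      using 3 assms by (subst cosh_real_nonneg_less_iff) auto
    then show ?thesis using 3 by (simp add: md_def C_fun_eq divide_strict_right_mono_neg)
  qed
qed

lemma md_mono:
  assumes "0 \<le> a" "a \<le> b" "K > 0 \<Longrightarrow> b \<le> pi / sqrt K"
  shows "md K a \<le> md K b"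
  using md_strict_mono [of a b K] assms by (cases "a = b") auto

lemma md_le_iff:
  assumes "0 \<le> a" "0 \<le> b" "K > 0 \<Longrightarrow> a \<le> pi / sqrt K" "K > 0 \<Longrightarrow> b \<le> pi / sqrt K"
  shows "md K a \<le> md K b \<longleftrightarrow> a \<le> b"
  using md_strict_mono [of b a K] md_mono [of a b K] assms by (meson linorder_not_le)

lemma md_eq_iff:
  assumes "0 \<le> a" "0 \<le> b" "K > 0 \<Longrightarrow> a \<le> pi / sqrt K" "K > 0 \<Longrightarrow> b \<le> pi / sqrt K"
  shows "md K a = md K b \<longleftrightarrow> a = b"
  using md_le_iff [OF assms] md_le_iff [OF assms(2,1,4,3)] by (auto simp: order_eq_iff)

text \<open>Used where two sides add up to more than \<open>pi / sqrt K\<close>, outside the range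
  on which \<open>md K\<close> increases.\<close>

lemma md_reflect:
  assumes "K > 0" shows "md K (2 * pi / sqrt K - r) = md K r"
  using assms by (simp add: md_def C_fun_eq right_diff_distrib cos_diff)

lemma continuous_on_C_fun [continuous_intros]:
  fixes A :: "'b::t2_space set"
  assumes "continuous_on A f" shows "continuous_on A (\<lambda>x. C_fun K (f x))"
proof -
  have "continuous_on A (\<lambda>x. sqrt c * f x)" for c
    by (intro continuous_intros assms)
  from continuous_on_cos [OF this [of K]] continuous_on_cosh [OF this [of "- K"]]
  show ?thesis unfolding C_fun_eq by (cases "K > 0"; cases "K < 0") auto
qed

lemma continuous_on_md [continuous_intros]:
  fixes A :: "'b::t2_space set"
  shows "continuous_on A f \<Longrightarrow> continuous_on A (\<lambda>x. md K (f x))"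
  unfolding md_def by (cases "K = 0") (auto intro!: continuous_intros)

lemma continuous_on_sn [continuous_intros]:
  fixes A :: "'b::t2_space set"
  assumes "continuous_on A f" shows "continuous_on A (\<lambda>x. sn K (f x))"
proof -
  have "continuous_on A (\<lambda>x. sqrt c * f x)" for c
    by (intro continuous_intros assms)
  from continuous_on_sin [OF this [of K]] continuous_on_sinh [OF this [of "- K"]]
  show ?thesis unfolding S_fun_def
    by (cases "K > 0"; cases "K < 0") (auto intro!: assms continuous_on_divide continuous_on_const)
qed

lemma tendsto_md [tendsto_intros]: "(f \<longlongrightarrow> l) F \<Longrightarrow> ((\<lambda>x. md K (f x)) \<longlongrightarrow> md K l) F"
  using continuous_on_md [OF continuous_on_id, of UNIV K]
  by (auto simp: continuous_on_eq_continuous_at isCont_def intro: isCont_tendsto_compose)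

lemma tendsto_sn [tendsto_intros]: "(f \<longlongrightarrow> l) F \<Longrightarrow> ((\<lambda>x. sn K (f x)) \<longlongrightarrow> sn K l) F"
  using continuous_on_sn [OF continuous_on_id, of UNIV K]
  by (auto simp: continuous_on_eq_continuous_at isCont_def intro: isCont_tendsto_compose)

text \<open>Stewart's identity for a point that is itself an end of the segment, with distances 0,
  \<open>r\<close> and \<open>r + t\<close>. It locates points on a segment and settles degenerate
  quadruples.\<close>

lemma stewart_self:
  "sn K r * md K (r + t) =
   sn K (r + t) * md K r + sn K t * md K r + sn K r * md K t"
  using sn_square [of K r] unfolding sn_add md_add by algebra

text \<open>Both brackets are the law of cosines at one vertex, for arms \<open>r\<close> and
  \<open>r + t\<close> along the same ray: \<open>e\<close> is \<open>md\<close> of the other arm,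
  \<open>q\<close> its \<open>sn\<close> times the cosine of the angle. Hence distances given by the
  law of cosines with a fixed angle obey Stewart's identity.\<close>

lemma stewart_hinge:
  "sn K (r + t) * (md K r + e - K * md K r * e - sn K r * q) =
   sn K t * e + sn K r * (md K (r + t) + e - K * md K (r + t) * e - sn K (r + t) * q)
     - (sn K t * md K r + sn K r * md K t)"
  using sn_square [of K r] unfolding sn_add md_add by algebra

section \<open>The model surfaces\<close>

abbreviation msp :: "real \<Rightarrow> (real^3) set" where
  "msp \<equiv> model_space"

abbreviation mdist :: "real \<Rightarrow> real^3 \<Rightarrow> real^3 \<Rightarrow> real" where
  "mdist \<equiv> model_dist"

definition bform :: "real \<Rightarrow> real^3 \<Rightarrow> real^3 \<Rightarrow> real" where
  "bform K x y = x$1 * y$1 + x$2 * y$2 + (if K < 0 then - 1 else 1) * x$3 * y$3"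

text \<open>Half the squared chord in the ambient form. On the surface it is \<open>md K\<close> of
  the intrinsic distance (\<open>md_mdist\<close>), so Stewart's theorem can be proved by expanding
  a quadratic form.\<close>

definition Q_form :: "real \<Rightarrow> real^3 \<Rightarrow> real^3 \<Rightarrow> real" where
  "Q_form K x y = bform K (x - y) (x - y) / 2"

lemma bform_linear [simp]:
  "bform K (x + y) z = bform K x z + bform K y z"
  "bform K z (x + y) = bform K z x + bform K z y"
  "bform K (x - y) z = bform K x z - bform K y z"
  "bform K z (x - y) = bform K z x - bform K z y"
  "bform K (c *\<^sub>R x) z = c * bform K x z"
  "bform K z (c *\<^sub>R x) = c * bform K z x"
  "bform K (- x) z = - bform K x z"
  "bform K z (- x) = - bform K z x"
  by (simp_all add: bform_def algebra_simps)

lemma bform_zero [simp]: "bform K 0 x = 0" "bform K x 0 = 0"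
  by (simp_all add: bform_def)

lemma bform_commute: "bform K x y = bform K y x"
  by (simp add: bform_def algebra_simps)

lemma bform_nonneg_curv: "K \<ge> 0 \<Longrightarrow> bform K x y = x \<bullet> y"
  by (simp add: bform_def inner_vec_def sum_3)

lemma bform_neg_curv: "K < 0 \<Longrightarrow> bform K x y = minkowski x y"
  by (simp add: bform_def minkowski_def)

lemma msp_iff:
  "x \<in> msp K \<longleftrightarrow>
     (if K = 0 then x$3 = 0 else K * bform K x x = 1 \<and> (K < 0 \<longrightarrow> x$3 > 0))"
proof -
  consider "K = 0" | "K > 0" | "K < 0" by linarith
  then show ?thesis
  proof cases
    case 2
    have "x \<in> msp K \<longleftrightarrow> norm x = 1 / sqrt K" using 2 by (simp add: model_space_def)
    also have "\<dots> \<longleftrightarrow> (norm x)\<^sup>2 = (1 / sqrt K)\<^sup>2" using 2 by (simp add: power2_eq_iff_nonneg)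
    also have "\<dots> \<longleftrightarrow> K * (x \<bullet> x) = 1"
      using 2 by (simp add: dot_square_norm power_divide field_simps)
    finally show ?thesis using 2 by (simp add: bform_nonneg_curv)
  qed (auto simp: model_space_def bform_neg_curv field_simps)
qed

lemma bform_self: "K \<noteq> 0 \<Longrightarrow> x \<in> msp K \<Longrightarrow> K * bform K x x = 1"
  by (simp add: msp_iff)

section \<open>The metrics of the sphere and the hyperboloid\<close>

lemma timelike_bform_less:
  assumes "K < 0" "u$3 > 0" "v$3 > 0" "bform K u u < 0" "bform K v v < 0"
  shows "bform K u v < 0"
proof -
  have u: "(u$1)\<^sup>2 + (u$2)\<^sup>2 < (u$3)\<^sup>2" and v: "(v$1)\<^sup>2 + (v$2)\<^sup>2 < (v$3)\<^sup>2"
    using assms by (auto simp: bform_def power2_eq_square)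
  have "(u$1 * v$1 + u$2 * v$2)\<^sup>2 \<le> ((u$1)\<^sup>2 + (u$2)\<^sup>2) * ((v$1)\<^sup>2 + (v$2)\<^sup>2)"
    using zero_le_power2 [of "u$1 * v$2 - u$2 * v$1"] by (simp add: power2_eq_square algebra_simps)
  also have "\<dots> < (u$3)\<^sup>2 * (v$3)\<^sup>2"
    using u v assms(2,3) by (intro mult_strict_mono') auto
  finally have "(u$1 * v$1 + u$2 * v$2)\<^sup>2 < (u$3 * v$3)\<^sup>2" by (simp add: power_mult_distrib)
  then have "u$1 * v$1 + u$2 * v$2 < u$3 * v$3"
    using assms(2,3) by (auto dest: power2_less_imp_less)
  then show ?thesis using assms(1) by (simp add: bform_def)
qed

text \<open>Once the equation of the hyperboloid is used for the third coordinates,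
  \<open>(x$3 * y$3)\<^sup>2\<close> exceeds \<open>c\<^sup>2\<close> by a sum of squares. The
  squares give the bound and, when they vanish, the equality of the points.\<close>

lemma hyperboloid_bform:
  assumes K: "K < 0" and x: "x \<in> msp K" and y: "y \<in> msp K"
  shows "1 \<le> K * bform K x y" and "K * bform K x y = 1 \<Longrightarrow> x = y"
proof -
  define k where "k = sqrt (- 1 / K)"
  have k: "k > 0" "k\<^sup>2 = - 1 / K" using K by (auto simp: k_def field_simps)
  have pos: "x$3 > 0" "y$3 > 0" using x y K by (auto simp: msp_iff)
  have "K * ((x$3)\<^sup>2 - (x$1)\<^sup>2 - (x$2)\<^sup>2) = - 1" "K * ((y$3)\<^sup>2 - (y$1)\<^sup>2 - (y$2)\<^sup>2) = - 1"
    using x y K by (auto simp: msp_iff bform_def power2_eq_square algebra_simps)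
  moreover have "K * k\<^sup>2 = - 1" using k K by simp
  ultimately have "K * ((x$3)\<^sup>2 - (x$1)\<^sup>2 - (x$2)\<^sup>2) = K * k\<^sup>2" "K * ((y$3)\<^sup>2 - (y$1)\<^sup>2 - (y$2)\<^sup>2) = K * k\<^sup>2"
    by simp_all
  then have x2: "(x$3)\<^sup>2 = k\<^sup>2 + (x$1)\<^sup>2 + (x$2)\<^sup>2" and y2: "(y$3)\<^sup>2 = k\<^sup>2 + (y$1)\<^sup>2 + (y$2)\<^sup>2"
    using K by auto
  define c where "c = k\<^sup>2 + x$1 * y$1 + x$2 * y$2"
  have eq: "(x$3 * y$3)\<^sup>2 = c\<^sup>2 + k\<^sup>2 * ((x$1 - y$1)\<^sup>2 + (x$2 - y$2)\<^sup>2) + (x$1 * y$2 - x$2 * y$1)\<^sup>2"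
    unfolding power_mult_distrib x2 y2 c_def by (simp add: power2_eq_square algebra_simps)
  have "0 \<le> k\<^sup>2 * ((x$1 - y$1)\<^sup>2 + (x$2 - y$2)\<^sup>2)" "0 \<le> (x$1 * y$2 - x$2 * y$1)\<^sup>2"
    by (intro mult_nonneg_nonneg add_nonneg_nonneg zero_le_power2)+
  then have "c\<^sup>2 \<le> (x$3 * y$3)\<^sup>2" unfolding eq by linarith
  then have le: "c \<le> x$3 * y$3" using pos power2_le_imp_le [of c "x$3 * y$3"] \<open>c\<^sup>2 \<le> _\<close> by simp
  have B: "K * bform K x y = 1 + K * (c - x$3 * y$3)"
  proof -
    have "K * bform K x y = - (K * k\<^sup>2) + K * (c - x$3 * y$3)"
      using K by (simp add: bform_def c_def algebra_simps)
    then show ?thesis using k K by simp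
  qed
  show "1 \<le> K * bform K x y" unfolding B using le K by (simp add: mult_nonpos_nonpos)
  assume "K * bform K x y = 1"
  then have "c = x$3 * y$3" unfolding B using K by simp
  with eq have "k\<^sup>2 * ((x$1 - y$1)\<^sup>2 + (x$2 - y$2)\<^sup>2) + (x$1 * y$2 - x$2 * y$1)\<^sup>2 = 0" by simp
  then have "k\<^sup>2 * ((x$1 - y$1)\<^sup>2 + (x$2 - y$2)\<^sup>2) = 0"
    by (smt (verit) mult_nonneg_nonneg zero_le_power2)
  then have "(x$1 - y$1)\<^sup>2 + (x$2 - y$2)\<^sup>2 = 0" using k(1) by auto
  then have e: "x$1 = y$1" "x$2 = y$2" by (auto simp: sum_power2_eq_zero_iff)
  then have "(x$3)\<^sup>2 = (y$3)\<^sup>2" using x2 y2 by simp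
  then have "x$3 = y$3" using pos by simp
  with e show "x = y" by (simp add: vec_eq_iff forall_3)
qed

lemma sphere_bform:
  assumes "K > 0" "x \<in> msp K" "y \<in> msp K"
  shows "\<bar>K * (x \<bullet> y)\<bar> \<le> 1"
proof -
  have n: "norm x = 1 / sqrt K" "norm y = 1 / sqrt K" using assms by (auto simp: model_space_def)
  have "K * \<bar>x \<bullet> y\<bar> \<le> K * (norm x * norm y)"
    using Cauchy_Schwarz_ineq2 [of x y] assms(1) by simp
  also have "\<dots> = 1" using assms(1) by (simp add: n)
  finally show ?thesis using assms(1) by (simp add: abs_mult)
qed

lemma Q_form_bform:
  assumes "K \<noteq> 0" "x \<in> msp K" "y \<in> msp K"
  shows "Q_form K x y = (1 - K * bform K x y) / K"
proof -
  have "2 * (K * Q_form K x y) = K * bform K x x + K * bform K y y - 2 * (K * bform K x y)"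
    by (simp add: Q_form_def bform_commute [of K y x] right_diff_distrib distrib_left)
  then have "K * Q_form K x y = 1 - K * bform K x y"
    unfolding bform_self [OF assms(1,2)] bform_self [OF assms(1,3)] by simp
  then show ?thesis using assms(1) by (simp add: field_simps)
qed

lemma mdist_nonneg [simp]:
  assumes "x \<in> msp K" "y \<in> msp K"
  shows "0 \<le> mdist K x y"
  using assms sphere_bform [of K x y] hyperboloid_bform(1) [of K x y]
  by (auto simp: model_dist_def bform_neg_curv abs_le_iff intro!: arccos_lbound divide_nonneg_nonneg)

lemma mdist_le:
  assumes "x \<in> msp K" "y \<in> msp K" "K > 0"
  shows "mdist K x y \<le> pi / sqrt K"
  using assms sphere_bform [of K x y]
  by (auto simp: model_dist_def abs_le_iff intro!: arccos_ubound divide_right_mono)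

lemma mdist_commute: "mdist K x y = mdist K y x"
  by (simp add: model_dist_def inner_commute dist_commute minkowski_def mult.commute)

lemma md_mdist:
  assumes "x \<in> msp K" "y \<in> msp K"
  shows "md K (mdist K x y) = Q_form K x y"
proof -
  consider "K = 0" | "K > 0" | "K < 0" by linarith
  then show ?thesis
  proof cases
    case 1
    then show ?thesis
      by (simp add: md_def model_dist_def Q_form_def bform_nonneg_curv dist_norm dot_square_norm
          del: bform_linear)
  next
    case 2
    then show ?thesis using assms sphere_bform [OF 2 assms]
      by (simp add: md_def C_fun_eq model_dist_def Q_form_bform bform_nonneg_curv cos_arccos abs_le_iff)
  next
    case 3
    then show ?thesis using assms hyperboloid_bform(1) [OF 3 assms]
      by (simp add: md_def C_fun_eq model_dist_def Q_form_bform bform_neg_curv)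
  qed
qed

lemma Q_form_eq_0:
  assumes "x \<in> msp K" "y \<in> msp K" "Q_form K x y = 0"
  shows "x = y"
proof (cases "K < 0")
  case True
  then show ?thesis using assms hyperboloid_bform(2) [of K x y] by (simp add: Q_form_bform)
next
  case False
  then show ?thesis using assms(3) by (simp add: Q_form_def bform_nonneg_curv del: bform_linear)
qed

lemma mdist_self [simp]: "x \<in> msp K \<Longrightarrow> mdist K x x = 0"
  using md_mdist [of x K x] md_eq_iff [of "mdist K x x" 0 K] mdist_le [of x K x]
  by (simp add: Q_form_def)

lemma mdist_eq_0:
  assumes "x \<in> msp K" "y \<in> msp K"
  shows "mdist K x y = 0 \<longleftrightarrow> x = y"
  using assms md_mdist [OF assms] Q_form_eq_0 [OF assms] by auto

lemma mdist_pos: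
  assumes "x \<in> msp K" "y \<in> msp K" "x \<noteq> y"
  shows "0 < mdist K x y"
  using mdist_nonneg [OF assms(1,2)] mdist_eq_0 [OF assms(1,2)] assms(3) by simp

text \<open>The point at distance \<open>r\<close> from \<open>a\<close> on the ray from \<open>a\<close> through \<open>b\<close>; \<open>r\<close> may exceed the distance
  of \<open>a\<close> and \<open>b\<close>.\<close>

definition seg :: "real \<Rightarrow> real^3 \<Rightarrow> real^3 \<Rightarrow> real \<Rightarrow> real^3" where
  "seg K a b r =
     (sn K (mdist K a b - r) / sn K (mdist K a b)) *\<^sub>R a +
     (sn K r / sn K (mdist K a b)) *\<^sub>R b"

section \<open>Segments of the model and Stewart's theorem\<close>

lemma seg_commute: "seg K a b r = seg K b a (mdist K a b - r)"
  by (simp add: seg_def mdist_commute [of K b a])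

lemma seg_scaled:
  assumes "sn K (mdist K a b) \<noteq> 0"
  shows "sn K (mdist K a b) *\<^sub>R seg K a b r =
    sn K (mdist K a b - r) *\<^sub>R a + sn K r *\<^sub>R b"
  using assms by (simp add: seg_def scaleR_right_distrib)

lemma sn_flat: "sn 0 r = r"
  by (simp add: S_fun_def)

lemma md_flat: "md 0 r = r\<^sup>2 / 2"
  by (simp add: md_def)

lemma seg_in_model:
  assumes a: "a \<in> msp K" and b: "b \<in> msp K"
    and S: "sn K (mdist K a b) \<noteq> 0"
  shows "seg K a b r \<in> msp K"
proof (cases "K = 0")
  case True
  then show ?thesis using a b by (simp add: msp_iff seg_def)
next
  case False
  define l where "l = mdist K a b"
  define u where "u = seg K a b r"
  define t where "t = l - r"
  have l: "l = r + t" by (simp add: t_def)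
  note aa = bform_self [OF False a] and bb = bform_self [OF False b]
  have ab: "K * bform K a b = 1 - K * md K l"
    unfolding l_def md_mdist [OF a b] using Q_form_bform [OF False a b] False by simp
  have ba: "bform K b a = bform K a b" by (rule bform_commute)
  have Su: "sn K l *\<^sub>R u = sn K t *\<^sub>R a + sn K r *\<^sub>R b"
    unfolding u_def l_def t_def by (rule seg_scaled [OF S])
  have "bform K (sn K l *\<^sub>R u) (sn K l *\<^sub>R u) =
      (sn K t)\<^sup>2 * bform K a a + (sn K r)\<^sup>2 * bform K b b + 2 * sn K t * sn K r * bform K a b"
    unfolding Su by (simp add: ba power2_eq_square algebra_simps)
  then have "(sn K l)\<^sup>2 * (K * bform K u u) =
      (sn K t)\<^sup>2 * (K * bform K a a) + (sn K r)\<^sup>2 * (K * bform K b b)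
        + 2 * sn K t * sn K r * (K * bform K a b)"
    by (simp add: power2_eq_square algebra_simps)
  also have "\<dots> = (sn K t)\<^sup>2 + (sn K r)\<^sup>2 + 2 * sn K t * sn K r * (1 - K * md K l)"
    unfolding aa bb ab by simp
  also have "\<dots> = (sn K l)\<^sup>2"
    using sn_square [of K r] sn_square [of K t] unfolding l sn_add md_add by algebra
  finally have uu: "K * bform K u u = 1" using S by (simp add: l_def)
  \<comment> \<open>The quadric has a second sheet. If \<open>u\<close> were on it,
    \<open>- u\<close> would be in the model and \<open>K * bform K (- u) a\<close> at least 1; but
    \<open>K * bform K u a\<close> is a hyperbolic cosine, hence positive.\<close>
  have "u$3 > 0" if neg: "K < 0"
  proof (rule ccontr)
    assume n: "\<not> u$3 > 0"
    have "bform K (sn K l *\<^sub>R u) a = sn K t * bform K a a + sn K r * bform K a b"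
      unfolding Su by (simp add: ba)
    then have "sn K l * (K * bform K u a) = sn K t * (K * bform K a a) + sn K r * (K * bform K a b)"
      by (simp add: algebra_simps)
    also have "\<dots> = sn K l * (1 - K * md K r)"
      unfolding aa ab using sn_square [of K r] unfolding l sn_add md_add by algebra
    finally have "K * bform K u a = C_fun K r" using S by (simp add: l_def C_fun_md)
    moreover have "C_fun K r > 0" using neg by (simp add: C_fun_eq)
    ultimately have pos: "K * bform K u a > 0" by simp
    have "u$3 \<noteq> 0"
    proof
      assume "u$3 = 0"
      then have "bform K u u \<ge> 0" by (simp add: bform_def)
      then have "K * bform K u u \<le> 0" using neg by (simp add: mult_nonpos_nonneg)
      with uu show False by simp
    qed
    with n have "- u \<in> msp K" using neg uu by (simp add: msp_iff)
    from hyperboloid_bform(1) [OF neg this a] pos show False by simp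
  qed
  with uu False show ?thesis by (simp add: msp_iff u_def)
qed

text \<open>Stewart's theorem. For \<open>K \<noteq> 0\<close>, \<open>Q_form K y\<close> is on the
  surface an affine function of the linear map \<open>bform K y\<close>, so the weights of
  \<open>seg\<close> can be read off; for \<open>K = 0\<close> the squared lengths of the vectors
  from \<open>y\<close> are expanded instead.\<close>

lemma Q_form_seg:
  assumes a: "a \<in> msp K" and b: "b \<in> msp K" and y: "y \<in> msp K"
    and S: "sn K (mdist K a b) \<noteq> 0" and l: "r + t = mdist K a b"
  shows "sn K (r + t) * Q_form K y (seg K a b r) =
    sn K t * Q_form K y a + sn K r * Q_form K y b
      - (sn K t * md K r + sn K r * md K t)"
proof (cases "K = 0")
  case True
  have rt: "r + t \<noteq> 0" using S l by (simp add: True sn_flat)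
  have ab: "Q_form 0 a b = (r + t)\<^sup>2 / 2"
    using md_mdist [OF a b] l by (simp add: True md_flat)
  define u where "u = a - y" define v where "v = b - y"
  define w where "w = seg 0 a b r - y"
  have W: "(r + t) *\<^sub>R w = t *\<^sub>R u + r *\<^sub>R v"
    using seg_scaled [OF S, of r] unfolding True sn_flat l [unfolded True, symmetric]
    by (simp add: u_def v_def w_def algebra_simps)
  have "(r + t)\<^sup>2 * bform 0 w w = bform 0 ((r + t) *\<^sub>R w) ((r + t) *\<^sub>R w)"
    by (simp add: power2_eq_square)
  also have "\<dots> = t\<^sup>2 * bform 0 u u + r\<^sup>2 * bform 0 v v + 2 * r * t * bform 0 u v"
    unfolding W by (simp add: bform_commute [of 0 v u] power2_eq_square algebra_simps)
  finally have "(r + t)\<^sup>2 * bform 0 w w = t\<^sup>2 * bform 0 u u + r\<^sup>2 * bform 0 v v + 2 * r * t * bform 0 u v" .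
  moreover have "(r + t)\<^sup>2 = bform 0 u u + bform 0 v v - 2 * bform 0 u v"
  proof -
    have "a - b = u - v" by (simp add: u_def v_def)
    then show ?thesis using ab unfolding Q_form_def by (simp add: bform_commute [of 0 v u])
  qed
  ultimately have "(r + t)\<^sup>2 * bform 0 w w =
     (r + t) * (t * bform 0 u u + r * bform 0 v v - r * t * (r + t))"
    by algebra
  then have "(r + t) * Q_form 0 (seg 0 a b r) y = t * bform 0 u u / 2 + r * bform 0 v v / 2 - r * t * (r + t) / 2"
    using rt unfolding Q_form_def w_def [symmetric] by (simp add: power2_eq_square)
  moreover have "Q_form 0 y x = Q_form 0 x y" for x
    by (simp add: Q_form_def bform_commute [of 0 y x])
  then have "Q_form 0 y a = bform 0 u u / 2" "Q_form 0 y b = bform 0 v v / 2"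
      "Q_form 0 y (seg 0 a b r) = Q_form 0 (seg 0 a b r) y"
    by (simp_all only: Q_form_def u_def v_def)
  ultimately show ?thesis
    unfolding True sn_flat md_flat by (simp add: power2_eq_square field_simps)
next
  case False
  note u = seg_in_model [OF a b S, of r]
  have "K * bform K y (sn K (mdist K a b) *\<^sub>R seg K a b r) =
      sn K t * (K * bform K y a) + sn K r * (K * bform K y b)"
    unfolding seg_scaled [OF S] using l [symmetric] by (simp add: algebra_simps)
  moreover have Q: "K * bform K y x = 1 - K * Q_form K y x" if "x \<in> msp K" for x
    using Q_form_bform [OF False y that] False by simp
  ultimately have "sn K (r + t) * (1 - K * Q_form K y (seg K a b r)) =
     sn K t * (1 - K * Q_form K y a) + sn K r * (1 - K * Q_form K y b)"
    unfolding Q [OF a, symmetric] Q [OF b, symmetric] Q [OF u, symmetric] l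
    by (simp add: mult.left_commute [of K])
  then have "K * (sn K (r + t) * Q_form K y (seg K a b r)) =
    K * (sn K t * Q_form K y a + sn K r * Q_form K y b
      - (sn K t * md K r + sn K r * md K t))"
    using sn_add [of K r t] by algebra
  then show ?thesis using False by simp
qed

lemma model_stewart:
  assumes "a \<in> msp K" "b \<in> msp K" "y \<in> msp K"
    and "sn K (mdist K a b) \<noteq> 0" and "r + t = mdist K a b"
  shows "sn K (r + t) * md K (mdist K y (seg K a b r)) =
    sn K t * md K (mdist K y a) + sn K r * md K (mdist K y b)
      - (sn K t * md K r + sn K r * md K t)"
  unfolding md_mdist [OF assms(3,1)] md_mdist [OF assms(3,2)]
    md_mdist [OF assms(3) seg_in_model [OF assms(1,2,4)]]
  by (rule Q_form_seg [OF assms])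

lemma short_S_nonzero:
  assumes "a \<in> msp K" "b \<in> msp K" "a \<noteq> b" "short K (mdist K a b)"
  shows "sn K (mdist K a b) \<noteq> 0"
  using sn_pos [OF mdist_pos [OF assms(1-3)] assms(4)] by simp

text \<open>Stewart's theorem with third point \<open>a\<close>, compared with
  \<open>stewart_self\<close>. Parameters beyond \<open>b\<close> are allowed because for
  \<open>K \<le> 0\<close> rays leaving the region are followed to arbitrary distance.\<close>

lemma mdist_seg:
  assumes a: "a \<in> msp K" and b: "b \<in> msp K"
    and S: "sn K (mdist K a b) \<noteq> 0"
    and r: "0 \<le> r" "K > 0 \<Longrightarrow> r \<le> pi / sqrt K"
  shows "mdist K a (seg K a b r) = r"
proof -
  define t where "t = mdist K a b - r"
  have l: "r + t = mdist K a b" by (simp add: t_def)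
  have "sn K (r + t) * md K (mdist K a (seg K a b r)) = sn K (r + t) * md K r"
    unfolding model_stewart [OF a b a S l] using stewart_self [of K r t] l a by simp
  then have "md K (mdist K a (seg K a b r)) = md K r" using S l by simp
  then show ?thesis
    using md_eq_iff [of "mdist K a (seg K a b r)" r K] r mdist_le [OF a seg_in_model [OF a b S, of r]]
      mdist_nonneg [OF a seg_in_model [OF a b S, of r]] by blast
qed

lemma mdist_seg_end:
  assumes a: "a \<in> msp K" and b: "b \<in> msp K"
    and S: "sn K (mdist K a b) \<noteq> 0" and r: "0 \<le> r" "r \<le> mdist K a b"
  shows "mdist K (seg K a b r) b = mdist K a b - r"
proof -
  have "mdist K b (seg K b a (mdist K a b - r)) = mdist K a b - r"
    using S r mdist_le [OF a b]
    by (intro mdist_seg [OF b a]) (auto simp: mdist_commute [of K b a])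
  then show ?thesis by (simp add: seg_commute [of K a b] mdist_commute [of K _ b])
qed

lemma seg_start [simp]: "sn K (mdist K a b) \<noteq> 0 \<Longrightarrow> seg K a b 0 = a"
  by (simp add: seg_def)

lemma seg_end: "sn K (mdist K a b) \<noteq> 0 \<Longrightarrow> seg K a b (mdist K a b) = b"
  by (simp add: seg_def)

text \<open>Both the triangle inequality and the description of its equality case come from Stewart's
  theorem applied at \<open>y\<close>.\<close>

lemma model_between:
  assumes a: "a \<in> msp K" and b: "b \<in> msp K" and y: "y \<in> msp K"
    and ne: "a \<noteq> b" and l: "short K (mdist K a b)"
    and le: "mdist K a y + mdist K y b \<le> mdist K a b"
  shows "y = seg K a b (mdist K a y)"
    and "mdist K a y + mdist K y b = mdist K a b"
proof -
  note S = short_S_nonzero [OF a b ne l]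
  define r where "r = mdist K a y"
  define t where "t = mdist K a b - r"
  have rt: "r + t = mdist K a b" by (simp add: t_def)
  have r: "0 \<le> r" using a y by (simp add: r_def)
  have t: "mdist K y b \<le> t" using le by (simp add: t_def r_def)
  have y0: "0 \<le> mdist K y b" using y b by simp
  have u: "seg K a b r \<in> msp K" by (rule seg_in_model [OF a b S])
  have pos: "sn K (r + t) > 0" using sn_pos [OF mdist_pos [OF a b ne] l] rt by simp
  have Sr: "0 \<le> sn K r"
    using r t y0 rt l by (intro sn_nonneg short_mono [OF l]) auto
  have "md K (mdist K y b) \<le> md K t"
    using t y0 r rt mdist_le [OF a b] by (intro md_mono) auto
  then have "sn K r * md K (mdist K y b) \<le> sn K r * md K t"
    using Sr by (rule mult_left_mono)
  \<comment> \<open>\<open>y\<close> is as far from \<open>a\<close> as the point at parameter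
    \<open>r\<close>, and no farther from \<open>b\<close>; so the right-hand side of Stewart's
    identity is at most its value for that point itself, which is 0.\<close>
  then have "sn K (r + t) * md K (mdist K y (seg K a b r)) \<le> 0"
    unfolding model_stewart [OF a b y S rt] by (simp add: mdist_commute [of K y a] r_def)
  then have "md K (mdist K y (seg K a b r)) \<le> 0"
    using pos by (simp add: mult_le_0_iff)
  then have "mdist K y (seg K a b r) \<le> 0"
    using md_le_iff [of "mdist K y (seg K a b r)" 0 K] mdist_le [OF y u] mdist_nonneg [OF y u]
    by simp
  then have y_eq: "y = seg K a b r"
    using mdist_nonneg [OF y u] mdist_eq_0 [OF y u] by simp
  then show "y = seg K a b (mdist K a y)" unfolding r_def .
  have "mdist K y b = mdist K a b - r"
    using t y0 rt by (subst y_eq) (intro mdist_seg_end [OF a b S r], simp)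
  then show "mdist K a y + mdist K y b = mdist K a b"
    by (simp add: r_def)
qed

lemma model_triangle_ineq:
  assumes a: "a \<in> msp K" and b: "b \<in> msp K" and y: "y \<in> msp K"
    and l: "short K (mdist K a b)"
  shows "mdist K a b \<le> mdist K a y + mdist K y b"
proof (cases "a = b")
  case True
  then show ?thesis using assms by simp
next
  case False
  show ?thesis using model_between(2) [OF a b y False l] by linarith
qed

text \<open>For \<open>K = 0\<close> the plane is lifted to height \<open>1\<close>. Then, for every \<open>K\<close>, the geodesic segment between
  two points consists of the points of the surface in the cone over them.\<close>

definition hom :: "real \<Rightarrow> real^3 \<Rightarrow> real^3" where
  "hom K x = (if K = 0 then x + axis 3 1 else x)"

lemma hom_inj [simp]: "hom K x = hom K y \<longleftrightarrow> x = y"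
  by (simp add: hom_def)

lemma hom_seg:
  assumes S: "sn K (mdist K a b) \<noteq> 0"
  shows "sn K (mdist K a b) *\<^sub>R hom K (seg K a b r) =
    sn K (mdist K a b - r) *\<^sub>R hom K a + sn K r *\<^sub>R hom K b"
proof (cases "K = 0")
  case True
  then show ?thesis using seg_scaled [OF S, of r]
    by (simp add: hom_def sn_flat algebra_simps)
next
  case False
  then show ?thesis using seg_scaled [OF S, of r] by (simp add: hom_def)
qed

lemma hom_nth3: "K = 0 \<Longrightarrow> x \<in> msp K \<Longrightarrow> hom K x $ 3 = 1"
  by (simp add: hom_def msp_iff)

lemma hom_nth3_pos: "K \<le> 0 \<Longrightarrow> x \<in> msp K \<Longrightarrow> hom K x $ 3 > 0"
  by (auto simp: hom_def msp_iff)

lemma hom_nonzero: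
  assumes "x \<in> msp K" shows "hom K x \<noteq> 0"
proof
  assume 0: "hom K x = 0"
  show False
  proof (cases "K = 0")
    case True
    with 0 hom_nth3 [OF True assms] show False by simp
  next
    case False
    with 0 bform_self [OF False assms] show False by (simp add: hom_def)
  qed
qed

text \<open>The height 1 for \<open>K = 0\<close>, and the equation of the quadric otherwise, fix
  the scale.\<close>

lemma hom_ray_unique:
  assumes u: "u \<in> msp K" and v: "v \<in> msp K" and c: "c > 0" "hom K u = c *\<^sub>R hom K v"
  shows "u = v"
proof (cases "K = 0")
  case True
  have "hom K u $ 3 = c * hom K v $ 3" using c by simp
  then have "c = 1" using hom_nth3 [OF True u] hom_nth3 [OF True v] by simp
  then show ?thesis using c by simp
next
  case False
  then have uv: "u = c *\<^sub>R v" using c by (simp add: hom_def)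
  have "K * bform K u u = c\<^sup>2 * (K * bform K v v)" unfolding uv by (simp add: power2_eq_square)
  then have "c\<^sup>2 = 1" using bform_self [OF False u] bform_self [OF False v] by simp
  then have "c = 1" using c by (simp add: power2_eq_1_iff)
  then show ?thesis using uv by simp
qed

text \<open>The union of the open rays through the points \<open>hom K x\<close>.\<close>

definition visible :: "real \<Rightarrow> (real^3) set" where
  "visible K = {v. if K > 0 then v \<noteq> 0 else v$3 > 0 \<and> (K < 0 \<longrightarrow> bform K v v < 0)}"

lemma visible_ray:
  assumes "v \<in> visible K"
  obtains c x where "c > 0" "x \<in> msp K" "v = c *\<^sub>R hom K x"
proof -
  consider "K = 0" | "K > 0" | "K < 0" by linarith
  then show ?thesis
  proof cases
    case 1
    then have v: "v$3 > 0" using assms by (simp add: visible_def)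
    define x where "x = (1 / v$3) *\<^sub>R v - axis 3 1"
    have "x \<in> msp K" using v 1 by (simp add: x_def msp_iff axis_def)
    moreover have "v = v$3 *\<^sub>R hom K x" using v 1 by (simp add: hom_def x_def)
    ultimately show ?thesis using that v by blast
  next
    case 2
    then have v: "v \<noteq> 0" using assms by (simp add: visible_def)
    define c where "c = sqrt K * norm v"
    have c: "c > 0" using v 2 by (simp add: c_def)
    define x where "x = (1 / c) *\<^sub>R v"
    have "x \<in> msp K" using v 2 by (simp add: x_def model_space_def c_def field_simps)
    moreover have "v = c *\<^sub>R hom K x" using c 2 by (simp add: hom_def x_def)
    ultimately show ?thesis using that c by blast
  next
    case 3
    then have v: "v$3 > 0" "bform K v v < 0" using assms by (auto simp: visible_def)
    define c where "c = sqrt (K * bform K v v)"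
    have k: "K * bform K v v > 0" using v 3 by (simp add: mult_neg_neg)
    then have c: "c > 0" "c\<^sup>2 = K * bform K v v" by (auto simp: c_def)
    define x where "x = (1 / c) *\<^sub>R v"
    have "K * bform K x x = (K * bform K v v) / c\<^sup>2" by (simp add: x_def power2_eq_square)
    then have "K * bform K x x = 1" using k unfolding c(2) by (metis divide_self less_irrefl)
    then have "x \<in> msp K" using v 3 c by (simp add: msp_iff x_def)
    moreover have "v = c *\<^sub>R hom K x" using c 3 by (simp add: hom_def x_def)
    ultimately show ?thesis using that c by blast
  qed
qed

lemma visible_hom:
  assumes x: "x \<in> msp K" shows "hom K x \<in> visible K"
proof (cases "K < 0")
  case True
  then have "K * bform K x x > 0" using bform_self [of K x] x by simp
  then have "bform K x x < 0" using True by (simp add: zero_less_mult_iff)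
  then show ?thesis using True hom_nth3_pos [of K x] x by (simp add: visible_def hom_def)
next
  case False
  then show ?thesis using hom_nth3_pos [of K x] hom_nonzero [OF x] x by (auto simp: visible_def)
qed

lemma visible_scale: "v \<in> visible K \<Longrightarrow> c > 0 \<Longrightarrow> c *\<^sub>R v \<in> visible K"
  by (auto simp: visible_def mult_pos_neg)

lemma visible_add: "K \<le> 0 \<Longrightarrow> u \<in> visible K \<Longrightarrow> v \<in> visible K \<Longrightarrow> u + v \<in> visible K"
  using timelike_bform_less [of K u v]
  by (auto simp: visible_def bform_commute [of K v u])

lemma scaleR_cancel_ratio:
  fixes x y :: "'b::real_vector"
  assumes "p *\<^sub>R x = q *\<^sub>R y" "p \<noteq> 0" shows "x = (q / p) *\<^sub>R y"
proof -
  have "x = (1 / p) *\<^sub>R (p *\<^sub>R x)" using assms(2) by simp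
  then show ?thesis unfolding assms(1) by simp
qed

lemma scaleR_combination:
  fixes x y z w :: "'b::real_vector"
  assumes "c \<noteq> 0"
  shows "c *\<^sub>R z = p *\<^sub>R x + q *\<^sub>R y \<Longrightarrow> z = (p / c) *\<^sub>R x + (q / c) *\<^sub>R y"
    and "c *\<^sub>R z = p *\<^sub>R x + q *\<^sub>R y + r *\<^sub>R w \<Longrightarrow> z = (p / c) *\<^sub>R x + (q / c) *\<^sub>R y + (r / c) *\<^sub>R w"
  using scaleR_cancel_ratio [of c z 1, OF _ assms] by (auto simp: scaleR_right_distrib)

text \<open>By the intermediate value theorem some \<open>r\<close> gives \<open>seg\<close> weights
  in the ratio of \<alpha> to \<beta>; both points are then on one ray. The strict bounds on
  \<open>r\<close> serve to recognise inner points of a chord by their positive weights.\<close>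

lemma seg_of_cone:
  assumes a: "a \<in> msp K" and b: "b \<in> msp K" and u: "u \<in> msp K"
    and ne: "a \<noteq> b" and l: "short K (mdist K a b)"
    and coef: "0 \<le> \<alpha>" "0 \<le> \<beta>" and hu: "hom K u = \<alpha> *\<^sub>R hom K a + \<beta> *\<^sub>R hom K b"
  obtains r where "0 \<le> r" "r \<le> mdist K a b" "u = seg K a b r"
    "0 < \<alpha> \<Longrightarrow> r < mdist K a b" "0 < \<beta> \<Longrightarrow> 0 < r"
proof -
  define l where "l = mdist K a b"
  note S = short_S_nonzero [OF a b ne assms(5)]
  have lpos: "0 < l" using mdist_pos [OF a b ne] by (simp add: l_def)
  have Sl: "0 < sn K l" using sn_pos lpos assms(5) by (simp add: l_def)
  have nz: "0 < \<alpha> \<or> 0 < \<beta>" using hu hom_nonzero [OF u] coef by auto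
  have "continuous_on {0..l} (\<lambda>r. sn K r * \<alpha> - sn K (l - r) * \<beta>)"
    by (intro continuous_intros)
  then obtain r where r: "0 \<le> r" "r \<le> l" and eq: "sn K r * \<alpha> - sn K (l - r) * \<beta> = 0"
    using IVT' [of "\<lambda>r. sn K r * \<alpha> - sn K (l - r) * \<beta>" 0 0 l] lpos Sl coef by auto
  have Sr: "0 < sn K r" if "0 < r"
    using that r assms(5) by (auto intro!: sn_pos short_mono [OF assms(5)] simp: l_def)
  have St: "0 < sn K (l - r)" if "r < l"
    using that r assms(5) by (auto intro!: sn_pos short_mono [OF assms(5)] simp: l_def)
  have rl: "r < l" if "0 < \<alpha>"
  proof (rule ccontr)
    assume "\<not> r < l"
    with r have "r = l" by simp
    with eq Sl that show False by simp
  qed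
  have r0: "0 < r" if "0 < \<beta>"
  proof (rule ccontr)
    assume "\<not> 0 < r"
    with r have "r = 0" by simp
    with eq Sl that show False by simp
  qed
  have hs: "sn K l *\<^sub>R hom K (seg K a b r) = sn K (l - r) *\<^sub>R hom K a + sn K r *\<^sub>R hom K b"
    unfolding l_def by (rule hom_seg [OF S])
  have "\<exists>c>0. hom K (seg K a b r) = c *\<^sub>R hom K u"
  proof (cases "0 < \<alpha>")
    case True
    have "(\<alpha> * sn K l) *\<^sub>R hom K (seg K a b r) = \<alpha> *\<^sub>R (sn K l *\<^sub>R hom K (seg K a b r))" by simp
    also have "\<dots> = (sn K (l - r) * \<alpha>) *\<^sub>R hom K a + (sn K r * \<alpha>) *\<^sub>R hom K b"
      unfolding hs by (simp add: algebra_simps)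
    also have "sn K r * \<alpha> = sn K (l - r) * \<beta>" using eq by simp
    also have "(sn K (l - r) * \<alpha>) *\<^sub>R hom K a + (sn K (l - r) * \<beta>) *\<^sub>R hom K b = sn K (l - r) *\<^sub>R hom K u"
      unfolding hu by (simp add: algebra_simps)
    finally have "hom K (seg K a b r) = (sn K (l - r) / (\<alpha> * sn K l)) *\<^sub>R hom K u"
      using True Sl by (intro scaleR_cancel_ratio) auto
    then show ?thesis using True Sl St [OF rl [OF True]] by (meson divide_pos_pos mult_pos_pos)
  next
    case False
    with nz have \<beta>: "0 < \<beta>" by simp
    have "(\<beta> * sn K l) *\<^sub>R hom K (seg K a b r) = \<beta> *\<^sub>R (sn K l *\<^sub>R hom K (seg K a b r))" by simp
    also have "\<dots> = (sn K (l - r) * \<beta>) *\<^sub>R hom K a + (sn K r * \<beta>) *\<^sub>R hom K b"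
      unfolding hs by (simp add: algebra_simps)
    also have "sn K (l - r) * \<beta> = sn K r * \<alpha>" using eq by simp
    also have "(sn K r * \<alpha>) *\<^sub>R hom K a + (sn K r * \<beta>) *\<^sub>R hom K b = sn K r *\<^sub>R hom K u"
      unfolding hu by (simp add: algebra_simps)
    finally have "hom K (seg K a b r) = (sn K r / (\<beta> * sn K l)) *\<^sub>R hom K u"
      using \<beta> Sl by (intro scaleR_cancel_ratio) auto
    then show ?thesis using \<beta> Sl Sr [OF r0 [OF \<beta>]] by (meson divide_pos_pos mult_pos_pos)
  qed
  then have "u = seg K a b r"
    using hom_ray_unique [OF seg_in_model [OF a b S] u] by metis
  then show ?thesis using that r rl r0 by (simp add: l_def)
qed

section \<open>Spaces of curvature bounded below\<close>

lemma short_half_iff: "short K (P / 2) \<longleftrightarrow> (K > 0 \<longrightarrow> P < 2 * pi / sqrt K)"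
  by (auto simp: short_def field_simps)

text \<open>The triangle inequalities and the perimeter bound put the argument of
  \<open>arccos\<close> into [-1, 1], so \<open>cos\<close> undoes it and the law of cosines is
  available in the space.\<close>

lemma comp_angle_cos:
  fixes x y z :: "'a::metric_space"
  assumes "x \<noteq> y" "x \<noteq> z" and sh: "short K (peri x y z / 2)"
  shows "md K (dist y z) = md K (dist x y) + md K (dist x z)
      - K * md K (dist x y) * md K (dist x z)
      - sn K (dist x y) * sn K (dist x z) * cos (comp_angle K x y z)" (is ?eq)
    and "0 \<le> comp_angle K x y z" and "comp_angle K x y z \<le> pi"
proof -
  define a b c where "a = dist x y" and "b = dist x z" and "c = dist y z"
  have pos: "0 < a" "0 < b" "0 \<le> c" using assms by (auto simp: a_def b_def c_def)
  have tri: "c \<le> a + b" "a \<le> b + c" "b \<le> a + c"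
    unfolding a_def b_def c_def by metric+
  have per: "short K ((a + b + c) / 2)"
    using sh by (simp add: peri_def a_def b_def c_def dist_commute algebra_simps)
  have sh': "short K a" "short K b" "short K c" using tri by (auto intro: short_mono [OF per])
  have S: "0 < sn K a" "0 < sn K b" using pos sh' by (auto intro: sn_pos)
  define N where "N = md K a + md K b - K * md K a * md K b - md K c"
  have q: "comp_angle K x y z = arccos (N / (sn K a * sn K b))"
  proof (cases "K = 0")
    case True
    have "(a\<^sup>2 + b\<^sup>2 - c\<^sup>2) / (2 * a * b) = N / (a * b)"
      using pos True by (simp add: N_def md_flat field_simps)
    then show ?thesis using True
      by (simp add: comp_angle_def a_def b_def c_def sn_flat)
  next
    case False
    have "C_fun K c - C_fun K a * C_fun K b = K * N"
      by (simp add: C_fun_md N_def algebra_simps)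
    then show ?thesis using False
      by (simp add: comp_angle_def a_def b_def c_def)
  qed
  have "md K \<bar>a - b\<bar> \<le> md K c"
    using pos tri sh' by (intro md_mono) (auto simp: short_def)
  moreover have "md K \<bar>a - b\<bar> = md K (a + - b)"
    using md_minus [of K "a - b"] by (auto simp: abs_if)
  ultimately have u: "N \<le> sn K a * sn K b"
    unfolding md_add by (simp add: N_def)
  have "md K c \<le> md K (a + b)"
  \<comment> \<open>Past \<open>pi / sqrt K\<close> the function \<open>md K\<close> decreases, but
    \<open>a + b\<close> may be replaced by its complement to \<open>2 * pi / sqrt K\<close>, which
    by the perimeter bound still exceeds \<open>c\<close>.\<close>
  proof (cases "K > 0 \<and> pi / sqrt K < a + b")
    case True
    define w where "w = pi / sqrt K"
    have w: "2 * pi / sqrt K = 2 * w" "w < a + b" "a + b + c < 2 * w"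
      using True per by (auto simp: w_def short_half_iff)
    have "md K c \<le> md K (2 * pi / sqrt K - (a + b))"
      unfolding w(1) using pos w by (intro md_mono) (auto simp: w_def [symmetric])
    then show ?thesis using True by (simp add: md_reflect)
  next
    case False
    then show ?thesis using pos tri by (intro md_mono) auto
  qed
  then have l: "- (sn K a * sn K b) \<le> N"
    unfolding md_add by (simp add: N_def)
  have SS: "0 < sn K a * sn K b" using S by simp
  have r: "-1 \<le> N / (sn K a * sn K b)" "N / (sn K a * sn K b) \<le> 1"
    using u l SS by (simp_all add: le_divide_eq divide_le_eq)
  then show "0 \<le> comp_angle K x y z" "comp_angle K x y z \<le> pi"
    unfolding q by (auto intro: arccos_lbound arccos_ubound)
  have "sn K a * sn K b * cos (comp_angle K x y z) = N"
    unfolding q cos_arccos [OF r] using S by simp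
  then show ?eq by (simp add: N_def a_def b_def c_def)
qed

lemma comp_angle_straight:
  fixes x y z :: "'a::metric_space"
  assumes "x \<noteq> y" "x \<noteq> z" and sh: "short K (dist y z)" and st: "dist y z = dist y x + dist x z"
  shows "comp_angle K x y z = pi"
proof -
  have "peri x y z / 2 = dist y z" using st by (simp add: peri_def dist_commute)
  then have p: "short K (peri x y z / 2)" using sh by simp
  have S: "0 < sn K (dist x y)" "0 < sn K (dist x z)"
    using assms by (auto intro!: sn_pos short_mono [OF sh] simp: dist_commute)
  have "sn K (dist x y) * sn K (dist x z) * cos (comp_angle K x y z) =
     sn K (dist x y) * sn K (dist x z) * (- 1)"
    using comp_angle_cos(1) [OF assms(1,2) p] unfolding st md_add by (simp add: dist_commute)
  then have "cos (comp_angle K x y z) = cos pi"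
    unfolding mult_cancel_left using S by simp
  then show ?thesis
    using comp_angle_cos(2,3) [OF assms(1,2) p] cos_inj_pi [of "comp_angle K x y z" pi] by simp
qed

lemma comp_angle_commute: "comp_angle K x y z = comp_angle K x z y"
  by (simp add: comp_angle_def dist_commute mult.commute mult.left_commute add.commute)

lemma curvature_geD:
  fixes x y z w :: "'a::metric_space"
  assumes "curvature_ge K TYPE('a)" "distinct [x, y, z, w]"
    and "short K (peri x y z / 2)" "short K (peri x y w / 2)" "short K (peri x z w / 2)" "short K (peri y z w / 2)"
  shows "comp_angle K x y z + comp_angle K x z w + comp_angle K x w y \<le> 2 * pi"
proof -
  have "quad_size x y z w < 2 * pi / sqrt K" if "K > 0"
    using assms(3-6) that by (auto simp: quad_size_def short_half_iff)
  then show ?thesis using assms(1,2) unfolding curvature_ge_def by blast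
qed

text \<open>The four-point condition at \<open>p\<close>, where the angle between \<open>x\<close> and \<open>z\<close> is \<open>\<pi>\<close>, with the angles
  eliminated. In the model surface equality holds by Stewart's theorem.\<close>

lemma stewart_ineq:
  fixes x y z p :: "'a::metric_space"
  assumes curv: "curvature_ge K TYPE('a)"
    and st: "dist x z = dist x p + dist p z" and ne: "x \<noteq> p" "z \<noteq> p"
    and sh: "short K (peri x y z / 2)"
  shows "sn K (dist p z) * md K (dist y x) + sn K (dist x p) * md K (dist y z)
    \<le> sn K (dist x z) * md K (dist y p)
      + (sn K (dist p z) * md K (dist x p) + sn K (dist x p) * md K (dist p z))"
proof -
  define r t q where "r = dist x p" and "t = dist p z" and "q = dist y p"
  have rt: "0 < r" "0 < t" "dist x z = r + t" using st ne by (auto simp: r_def t_def)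
  \<comment> \<open>The four-point condition needs distinct points; in the first three cases the
    inequality is an identity.\<close>
  consider "y = x" | "y = z" | "y = p" | "y \<noteq> x" "y \<noteq> z" "y \<noteq> p" by blast
  then show ?thesis
  proof cases
    case 1
    then show ?thesis using stewart_self [of K r t] rt
      by (simp add: r_def [symmetric] t_def [symmetric])
  next
    case 2
    then show ?thesis using stewart_self [of K t r] rt
      by (simp add: r_def [symmetric] t_def [symmetric] dist_commute [of z] add.commute)
  next
    case 3
    then show ?thesis by (simp add: dist_commute)
  next
    case 4
    have "dist x z \<noteq> 0" using rt by simp
    then have d: "distinct [p, x, y, z]" using ne 4 by auto
    have le: "dist y p \<le> dist y x + dist x p" "dist y p \<le> dist y z + dist p z" "dist x z \<le> dist x y + dist y z"
      by metric+
    have sh1: "short K (peri p x y / 2)" "short K (peri p x z / 2)" "short K (peri p y z / 2)"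
      "short K (dist x z)"
      using le st by (auto intro!: short_mono [OF sh] simp: peri_def dist_commute)
    have \<alpha>: "comp_angle K p x y + comp_angle K p y z + comp_angle K p z x \<le> 2 * pi"
      by (rule curvature_geD [OF curv d]) (use sh sh1 in auto)
    have "comp_angle K p x z = pi"
      using ne st sh1(4) by (intro comp_angle_straight) auto
    with \<alpha> have sum: "comp_angle K p x y \<le> pi - comp_angle K p y z"
      by (simp add: comp_angle_commute [of K p z x])
    note L1 = comp_angle_cos [OF ne(1) [symmetric] 4(3) [symmetric] sh1(1)]
    note L2 = comp_angle_cos [OF 4(3) [symmetric] ne(2) [symmetric] sh1(3)]
    have "cos (pi - comp_angle K p y z) \<le> cos (comp_angle K p x y)"
      using sum L1(2,3) L2(2,3) by (intro cos_monotone_0_pi_le) auto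
    then have c: "0 \<le> cos (comp_angle K p x y) + cos (comp_angle K p y z)" by simp
    have "q \<le> peri p x y / 2" using le(1) by (simp add: q_def peri_def dist_commute)
    then have sh2: "short K r" "short K t" "short K q"
      using st by (auto intro: short_mono [OF sh1(4)] short_mono [OF sh1(1)] simp: r_def t_def)
    have S: "0 < sn K r" "0 < sn K t" "0 < sn K q"
      using rt sh2 4 by (auto intro!: sn_pos simp: q_def)
    have "0 \<le> sn K r * sn K t * sn K q * (cos (comp_angle K p x y) + cos (comp_angle K p y z))"
      using S c by (intro mult_nonneg_nonneg) auto
    moreover have "md K (dist y x) = md K r + md K q - K * md K r * md K q
        - sn K r * sn K q * cos (comp_angle K p x y)"
      using L1(1) by (simp add: r_def q_def dist_commute)
    moreover have "md K (dist y z) = md K q + md K t - K * md K q * md K t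
        - sn K q * sn K t * cos (comp_angle K p y z)"
      using L2(1) by (simp add: t_def q_def dist_commute)
    then have "sn K t * md K (dist y x) + sn K r * md K (dist y z) =
      sn K (r + t) * md K q + (sn K t * md K r + sn K r * md K t)
        - sn K r * sn K t * sn K q * (cos (comp_angle K p x y) + cos (comp_angle K p y z))"
      using \<open>md K (dist y x) = _\<close> unfolding sn_add by algebra
    ultimately have "sn K t * md K (dist y x) + sn K r * md K (dist y z)
      \<le> sn K (r + t) * md K q + (sn K t * md K r + sn K r * md K t)"
      by linarith
    then show ?thesis using rt by (simp add: r_def t_def q_def)
  qed
qed

section \<open>Existence of prolongable geodesics\<close>

lemma length_space_point:
  fixes x y :: "'a::metric_space"
  assumes "length_space TYPE('a)" and r: "0 \<le> r" "r \<le> dist x y" and e: "0 < e"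
  shows "\<exists>m. dist x m = r \<and> dist m y < dist x y - r + e"
proof -
  have "(INF g \<in> {g. path g \<and> pathstart g = x \<and> pathfinish g = y}. curve_length g 0 1) < ereal (dist x y + e)"
    using assms(1) e unfolding length_space_def by (metis ereal_less_eq(3) less_add_same_cancel1 less_ereal.simps(1))
  then obtain g where g: "path g" "pathstart g = x" "pathfinish g = y" and len: "curve_length g 0 1 < ereal (dist x y + e)"
    unfolding INF_less_iff by auto
  have g01: "g 0 = x" "g 1 = y" using g by (auto simp: pathstart_def pathfinish_def)
  have "continuous_on {0..1} (\<lambda>s. dist x (g s))"
    using g(1) unfolding path_def by (intro continuous_intros)
  then obtain s where s: "0 \<le> s" "s \<le> 1" "dist x (g s) = r"
    using IVT' [of "\<lambda>s. dist x (g s)" 0 r 1] r g01 by auto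
  \<comment> \<open>The partition 0, \<open>s\<close>, 1 suffices: the length of the curve is at
    least the sum of its two chords.\<close>
  define t :: "nat \<Rightarrow> real" where "t = (\<lambda>i. if i = 0 then 0 else if i = 1 then s else 1)"
  have "mono_on {..2} t" using s by (auto simp: mono_on_def t_def)
  then have "(2, t) \<in> {(n, t). mono_on {..n} t \<and> t 0 = 0 \<and> t n = 1}" by (simp add: t_def)
  from SUP_upper [OF this, of "\<lambda>(n, t). ereal (\<Sum>i<n. dist (g (t i)) (g (t (Suc i))))"]
  have "ereal (\<Sum>i<2. dist (g (t i)) (g (t (Suc i)))) \<le> curve_length g 0 1"
    by (simp add: curve_length_def)
  also note len
  finally have "dist x (g s) + dist (g s) y < dist x y + e"
    by (simp add: numeral_2_eq_2 t_def g01)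
  with s show ?thesis by (intro exI [of _ "g s"]) auto
qed

text \<open>Both angles with \<open>v\<close> are obtuse, so \<open>2 * pi\<close> minus their sum
  lies in [0, pi], where the cosine decreases. The sines are written as roots so that a limit can be
  taken knowing only the limits of the cosines.\<close>

lemma four_point_cos:
  fixes c v x y :: "'a::metric_space"
  assumes curv: "curvature_ge K TYPE('a)" and d: "distinct [c, v, x, y]"
    and sh: "short K (peri c v x / 2)" "short K (peri c v y / 2)" "short K (peri c x y / 2)" "short K (peri v x y / 2)"
    and neg: "cos (comp_angle K c v x) < 0" "cos (comp_angle K c v y) < 0"
  shows "cos (comp_angle K c v x) * cos (comp_angle K c v y)
      - sqrt (1 - (cos (comp_angle K c v x))\<^sup>2) * sqrt (1 - (cos (comp_angle K c v y))\<^sup>2)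
    \<le> cos (comp_angle K c x y)"
proof -
  define \<theta> \<phi> where "\<theta> = comp_angle K c v x" and "\<phi> = comp_angle K c v y"
  have ang: "0 \<le> \<theta>" "\<theta> \<le> pi" "0 \<le> \<phi>" "\<phi> \<le> pi" "0 \<le> comp_angle K c x y" "comp_angle K c x y \<le> pi"
    using comp_angle_cos(2,3) [OF _ _ sh(1)] comp_angle_cos(2,3) [OF _ _ sh(2)] comp_angle_cos(2,3) [OF _ _ sh(3)] d
    by (auto simp: \<theta>_def \<phi>_def)
  have half: "pi / 2 < \<alpha>" if "cos \<alpha> < 0" "0 \<le> \<alpha>" for \<alpha>
    using that cos_ge_zero [of \<alpha>] by force
  have h: "pi / 2 < \<theta>" "pi / 2 < \<phi>" using half neg ang by (auto simp: \<theta>_def \<phi>_def)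
  have "\<theta> + comp_angle K c x y + comp_angle K c y v \<le> 2 * pi"
    unfolding \<theta>_def by (rule curvature_geD [OF curv d sh])
  then have "comp_angle K c x y \<le> 2 * pi - (\<theta> + \<phi>)"
    by (simp add: \<phi>_def comp_angle_commute [of K c y v])
  then have "cos (2 * pi - (\<theta> + \<phi>)) \<le> cos (comp_angle K c x y)"
    using ang h by (intro cos_monotone_0_pi_le) auto
  moreover have "cos (2 * pi - (\<theta> + \<phi>)) = cos \<theta> * cos \<phi> - sin \<theta> * sin \<phi>"
    by (simp add: cos_diff cos_add)
  moreover have "sin \<theta> = sqrt (1 - (cos \<theta>)\<^sup>2)" "sin \<phi> = sqrt (1 - (cos \<phi>)\<^sup>2)"
    using ang by (auto intro!: sin_cos_sqrt sin_ge_zero)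
  ultimately show ?thesis by (simp add: \<theta>_def \<phi>_def)
qed


lemma short_less_ex:
  assumes "short K r" obtains \<delta> where "\<delta> > 0" "short K (r + \<delta>)"
proof (cases "K > 0")
  case True
  define w where "w = pi / sqrt K"
  have "r < w" using assms True by (simp add: short_def w_def)
  then have "0 < (w - r) / 2" "short K (r + (w - r) / 2)" by (simp_all add: short_def w_def [symmetric] field_simps)
  then show ?thesis by (rule that)
next
  case False
  then show ?thesis using that [of 1] by (simp add: short_def)
qed

text \<open>Geodesics that can be prolonged exist, although the space need not be geodesic: the four-point
  condition at \<open>c\<close> forces approximate intermediate points of \<open>u\<close> and \<open>c\<close> to be close to each
  other, since they all lie almost opposite to \<open>v\<close>.\<close>

lemma intermediate_point_exists:
  fixes u c v :: "'a::metric_space"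
  assumes alex: "alexandrov_space K TYPE('a)"
    and st: "dist u v = dist u c + dist c v" and ne: "c \<noteq> v" and sh: "short K (dist u v)"
    and r: "0 < r" "r < dist u c"
  shows "\<exists>x. dist u x = r \<and> dist x c = dist u c - r"
proof -
  have curv: "curvature_ge K TYPE('a)" and len: "length_space TYPE('a)" and comp: "complete (UNIV :: 'a set)"
    using alex by (auto simp: alexandrov_space_def)
  define s t where "s = dist u c - r" and "t = dist c v"
  have pos: "0 < s" "0 < t" using r ne by (auto simp: s_def t_def)
  have uv: "dist u v = r + s + t" using st by (simp add: s_def t_def)
  have "\<exists>m. dist u m = r \<and> dist m c < dist u c - r + inverse (real (Suc n))" for n
    using length_space_point [OF len, of r u c] r by simp
  then obtain m where m: "\<And>n. dist u (m n) = r" "\<And>n. dist (m n) c < s + inverse (real (Suc n))"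
    unfolding s_def by metis
  define a b where "a = (\<lambda>n. dist c (m n))" and "b = (\<lambda>n. dist v (m n))"
  have a: "s \<le> a n" "a n \<le> s + inverse (real (Suc n))" for n
  proof -
    have "dist u c \<le> dist u (m n) + dist (m n) c" by metric
    then show "s \<le> a n" "a n \<le> s + inverse (real (Suc n))"
      using m [of n] by (auto simp: s_def a_def dist_commute)
  qed
  have b: "s + t \<le> b n" "b n \<le> a n + t" for n
  proof -
    have "dist u v \<le> dist u (m n) + dist (m n) v" "dist v (m n) \<le> dist c (m n) + dist c v" by metric+
    then show "s + t \<le> b n" "b n \<le> a n + t"
      using m(1) [of n] uv by (auto simp: a_def b_def t_def dist_commute)
  qed
  have a_lim: "a \<longlonglongrightarrow> s"
  proof (rule real_tendsto_sandwich [where f = "\<lambda>_. s" and h = "\<lambda>n. s + inverse (real (Suc n))"])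
    show "(\<lambda>n. s + inverse (real (Suc n))) \<longlonglongrightarrow> s"
      using tendsto_add [OF tendsto_const LIMSEQ_inverse_real_of_nat] by simp
  qed (use a in auto)
  have b_lim: "b \<longlonglongrightarrow> s + t"
  proof (rule real_tendsto_sandwich [where f = "\<lambda>_. s + t" and h = "\<lambda>n. a n + t"])
    show "(\<lambda>n. a n + t) \<longlonglongrightarrow> s + t" by (intro tendsto_intros a_lim)
  qed (use b in auto)
  have "short K s" "short K t" "short K (s + t)"
    using r pos uv by (auto intro: short_mono [OF sh])
  then have S: "0 < sn K s" "0 < sn K t" using pos by (auto intro: sn_pos)
  \<comment> \<open>The cosine of the comparison angle at \<open>c\<close> between \<open>v\<close>
    and \<open>m n\<close> (see \<open>cq\<close>). In the limit the sides \<open>s\<close>,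
    \<open>t\<close> and \<open>s + t\<close> form a straight triangle, whence -1.\<close>
  define q where "q = (\<lambda>n. (md K t + md K (a n) - K * md K t * md K (a n) - md K (b n))
      / (sn K t * sn K (a n)))"
  have "q \<longlonglongrightarrow> (md K t + md K s - K * md K t * md K s - md K (s + t)) / (sn K t * sn K s)"
    unfolding q_def using S by (intro tendsto_intros a_lim b_lim) auto
  also have "(md K t + md K s - K * md K t * md K s - md K (s + t)) / (sn K t * sn K s) = - 1"
    using S unfolding md_add by (simp add: field_simps)
  finally have q_lim: "q \<longlonglongrightarrow> - 1" .
  obtain \<delta> where \<delta>: "\<delta> > 0" "short K (dist u v + \<delta>)" using short_less_ex [OF sh] by blast
  have "eventually (\<lambda>n. a n < s + \<delta>) sequentially" "eventually (\<lambda>n. q n < 0) sequentially"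
    using order_tendstoD(2) [OF a_lim, of "s + \<delta>"] order_tendstoD(2) [OF q_lim, of 0] \<delta> by auto
  then have "eventually (\<lambda>n. a n < s + \<delta> \<and> q n < 0) sequentially" by (rule eventually_conj)
  then obtain N where N: "\<And>n. n \<ge> N \<Longrightarrow> a n < s + \<delta>" "\<And>n. n \<ge> N \<Longrightarrow> q n < 0"
    unfolding eventually_sequentially by blast
  have nec: "c \<noteq> m n" "v \<noteq> m n" for n using a [of n] b [of n] pos by (auto simp: a_def b_def)
  have mm: "dist (m i) (m j) \<le> 2 * r" for i j
  proof -
    have "dist (m i) (m j) \<le> dist u (m i) + dist u (m j)" by metric
    then show ?thesis using m(1) by simp
  qed
  have p1: "short K (peri c v (m n) / 2)" if "n \<ge> N" for n
    using N(1) [OF that] b [of n] uv r(1)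
    by (intro short_mono [OF \<delta>(2)]) (simp add: peri_def a_def b_def t_def dist_commute)
  have p2: "short K (peri c (m i) (m j) / 2)" if "i \<ge> N" "j \<ge> N" for i j
    using N(1) [OF that(1)] N(1) [OF that(2)] mm [of i j] uv pos
    by (intro short_mono [OF \<delta>(2)]) (simp add: peri_def a_def dist_commute)
  have p3: "short K (peri v (m i) (m j) / 2)" if "i \<ge> N" "j \<ge> N" for i j
    using N(1) [OF that(1)] N(1) [OF that(2)] mm [of i j] uv b [of i] b [of j]
    by (intro short_mono [OF \<delta>(2)]) (simp add: peri_def b_def dist_commute)
  have sh_a: "short K (a n)" if "n \<ge> N" for n
    using N(1) [OF that] uv r(1) pos by (intro short_mono [OF \<delta>(2)]) auto
  have Sa: "0 < sn K (a n)" if "n \<ge> N" for n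
    using sh_a [OF that] a [of n] pos by (intro sn_pos) auto
  have cq: "cos (comp_angle K c v (m n)) = q n" if "n \<ge> N" for n
    using comp_angle_cos(1) [OF ne nec(1) p1 [OF that]] S(2) Sa [OF that]
    by (simp add: q_def a_def b_def t_def field_simps)
  \<comment> \<open>The law of cosines at \<open>c\<close> with the angle replaced by its upper
    bound from \<open>four_point_cos\<close>. As both angles with \<open>v\<close> tend to pi, that
    bound tends to 0 and \<open>G\<close> to its value for coinciding points.\<close>
  define G where "G = (\<lambda>(i, j). md K (a i) + md K (a j) - K * md K (a i) * md K (a j)
      - sn K (a i) * sn K (a j) * (q i * q j - sqrt (1 - (q i)\<^sup>2) * sqrt (1 - (q j)\<^sup>2)))"
  have le_G: "md K (dist (m i) (m j)) \<le> G (i, j)" if ij: "i \<ge> N" "j \<ge> N" "m i \<noteq> m j" for i j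
  proof -
    have "q i * q j - sqrt (1 - (q i)\<^sup>2) * sqrt (1 - (q j)\<^sup>2) \<le> cos (comp_angle K c (m i) (m j))"
      using four_point_cos [OF curv, of c v "m i" "m j"] ij ne nec p1 p2 p3 N(2) cq by simp
    then have "sn K (a i) * sn K (a j) * (q i * q j - sqrt (1 - (q i)\<^sup>2) * sqrt (1 - (q j)\<^sup>2))
       \<le> sn K (a i) * sn K (a j) * cos (comp_angle K c (m i) (m j))"
      using Sa [OF ij(1)] Sa [OF ij(2)] by (intro mult_left_mono) auto
    then show ?thesis
      using comp_angle_cos(1) [OF nec(1) nec(1) p2 [OF ij(1,2)]] by (simp add: G_def a_def)
  qed
  have fs: "((\<lambda>x. f (fst x)) \<longlongrightarrow> l) (sequentially \<times>\<^sub>F sequentially)"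
    and sn: "((\<lambda>x. f (snd x)) \<longlongrightarrow> l) (sequentially \<times>\<^sub>F sequentially)" if "f \<longlonglongrightarrow> l" for f :: "nat \<Rightarrow> real" and l
    using filterlim_compose [OF that filterlim_fst] filterlim_compose [OF that filterlim_snd] by auto
  have "(G \<longlongrightarrow> md K s + md K s - K * md K s * md K s
      - sn K s * sn K s * ((- 1) * (- 1) - sqrt (1 - (- 1)\<^sup>2) * sqrt (1 - (- 1)\<^sup>2)))
      (sequentially \<times>\<^sub>F sequentially)"
    unfolding G_def case_prod_beta
    by (intro tendsto_intros fs sn a_lim q_lim)
  moreover have "md K s + md K s - K * md K s * md K s
      - sn K s * sn K s * ((- 1) * (- 1) - sqrt (1 - (- 1)\<^sup>2) * sqrt (1 - (- 1)\<^sup>2)) = 0"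
    using sn_square [of K s] by (simp add: power2_eq_square)
  ultimately have G_lim: "(G \<longlongrightarrow> 0) (sequentially \<times>\<^sub>F sequentially)" by simp
  have "Cauchy m"
  proof (rule metric_CauchyI)
    fix e :: real assume e: "0 < e"
    \<comment> \<open>Capped at \<open>pi / sqrt K\<close>, so that \<open>md K\<close> is strictly
      increasing up to \<open>e'\<close>.\<close>
    define e' where "e' = (if K > 0 then min e (pi / sqrt K) else e)"
    have e': "0 < e'" "e' \<le> e" "K > 0 \<Longrightarrow> e' \<le> pi / sqrt K" using e by (auto simp: e'_def)
    have "0 < md K e'" using md_strict_mono [of 0 e' K] e' by simp
    with G_lim have "eventually (\<lambda>x. G x < md K e') (sequentially \<times>\<^sub>F sequentially)"
      by (rule order_tendstoD(2))
    then obtain M where M: "\<And>i j. i \<ge> M \<Longrightarrow> j \<ge> M \<Longrightarrow> G (i, j) < md K e'"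
      unfolding eventually_prod_sequentially by blast
    have "dist (m i) (m j) < e" if ij: "i \<ge> max M N" "j \<ge> max M N" for i j
    proof (cases "m i = m j")
      case False
      then have *: "md K (dist (m i) (m j)) < md K e'"
        using le_G [of i j] M [of i j] ij by auto
      have "dist (m i) (m j) \<le> dist c (m i) + dist c (m j)" by metric
      then have "dist (m i) (m j) \<le> peri c (m i) (m j) / 2" by (simp add: peri_def dist_commute)
      then have "short K (dist (m i) (m j))" using short_mono [OF p2 [of i j]] ij by simp
      then have "\<not> e' \<le> dist (m i) (m j)"
        using md_mono [of e' "dist (m i) (m j)" K] e'(1) * by (auto simp: short_def)
      then show ?thesis using e'(2) by simp
    qed (use e in simp)
    then show "\<exists>M. \<forall>i\<ge>M. \<forall>j\<ge>M. dist (m i) (m j) < e" by blast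
  qed
  then obtain x where x: "m \<longlonglongrightarrow> x" using comp unfolding complete_def by auto
  have "(\<lambda>n. dist u (m n)) \<longlonglongrightarrow> dist u x" "a \<longlonglongrightarrow> dist c x"
    unfolding a_def by (intro tendsto_intros x)+
  then have "dist u x = r" "dist c x = s"
    using m(1) LIMSEQ_unique [OF a_lim] by (auto simp: LIMSEQ_const_iff)
  then show ?thesis by (auto simp: s_def dist_commute)
qed

section \<open>Geodesics, angles as limits, monotonicity of comparison angles\<close>

lemma geodesic_dist:
  fixes \<gamma> :: "real \<Rightarrow> 'a::metric_space"
  assumes "geodesic l \<gamma>" "\<gamma> l \<noteq> \<gamma> 0"
  obtains v where "0 < v" "0 < l" "v * l = dist (\<gamma> 0) (\<gamma> l)"
    "\<And>s t. 0 \<le> s \<Longrightarrow> s \<le> t \<Longrightarrow> t \<le> l \<Longrightarrow> dist (\<gamma> s) (\<gamma> t) = v * (t - s)"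
proof -
  have l: "0 < l" using assms by (cases "l = 0") (auto simp: geodesic_def)
  obtain v where v: "v \<ge> 0" "\<And>s t. 0 \<le> s \<Longrightarrow> s \<le> t \<Longrightarrow> t \<le> l \<Longrightarrow> curve_length \<gamma> s t = ereal (v * (t - s))"
    using assms(1) by (auto simp: geodesic_def)
  have vl: "v * l = dist (\<gamma> 0) (\<gamma> l)"
    using assms(1) v(2) [of 0 l] l by (simp add: geodesic_def)
  \<comment> \<open>By the partition into a single interval, a chord is never longer than its
    arc.\<close>
  have le: "dist (\<gamma> s) (\<gamma> t) \<le> v * (t - s)" if "0 \<le> s" "s \<le> t" "t \<le> l" for s t
  proof -
    define p :: "nat \<Rightarrow> real" where "p = (\<lambda>i. if i = 0 then s else t)"
    have "(1, p) \<in> {(n, p). mono_on {..n} p \<and> p 0 = s \<and> p n = t}"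
      using that by (auto simp: p_def mono_on_def)
    from SUP_upper [OF this, of "\<lambda>(n, p). ereal (\<Sum>i<n. dist (\<gamma> (p i)) (\<gamma> (p (Suc i))))"]
    have "ereal (dist (\<gamma> s) (\<gamma> t)) \<le> curve_length \<gamma> s t"
      by (simp add: curve_length_def p_def)
    then show ?thesis unfolding v(2) [OF that] by simp
  qed
  \<comment> \<open>A chord shorter than its arc would bring the ends closer together than
    \<open>v * l\<close>.\<close>
  have "dist (\<gamma> s) (\<gamma> t) = v * (t - s)" if st: "0 \<le> s" "s \<le> t" "t \<le> l" for s t
  proof -
    have "dist (\<gamma> 0) (\<gamma> l) \<le> dist (\<gamma> 0) (\<gamma> s) + dist (\<gamma> s) (\<gamma> t) + dist (\<gamma> t) (\<gamma> l)" by metric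
    also have "\<dots> \<le> v * (s - 0) + dist (\<gamma> s) (\<gamma> t) + v * (l - t)"
      using st le [of 0 s] le [of t l] by (intro add_mono) auto
    finally show ?thesis using le [OF st] vl by (simp add: algebra_simps)
  qed
  moreover have "0 < v" using vl v(1) assms(2) by (cases "v = 0") auto
  ultimately show ?thesis using that l vl by blast
qed

text \<open>A bounded function that grows as either argument decreases tends to its supremum at the
  corner (0, 0). If that is also its value at the opposite corner, where it is smallest, it cannot
  vary. Convergence is proved first because \<open>Lim\<close> is a definite description.\<close>

lemma antimono_Lim_constant:
  fixes f :: "real \<Rightarrow> real \<Rightarrow> real"
  assumes l: "0 < l\<^sub>1" "0 < l\<^sub>2"
    and m1: "\<And>s s' t. 0 < s' \<Longrightarrow> s' \<le> s \<Longrightarrow> s \<le> l\<^sub>1 \<Longrightarrow> 0 < t \<Longrightarrow> t \<le> l\<^sub>2 \<Longrightarrow> f s t \<le> f s' t"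
    and m2: "\<And>s t t'. 0 < s \<Longrightarrow> s \<le> l\<^sub>1 \<Longrightarrow> 0 < t' \<Longrightarrow> t' \<le> t \<Longrightarrow> t \<le> l\<^sub>2 \<Longrightarrow> f s t \<le> f s t'"
    and bd: "\<And>s t. 0 < s \<Longrightarrow> s \<le> l\<^sub>1 \<Longrightarrow> 0 < t \<Longrightarrow> t \<le> l\<^sub>2 \<Longrightarrow> f s t \<le> B"
    and lim: "Lim (at_right 0 \<times>\<^sub>F at_right 0) (\<lambda>(s, t). f s t) = f l\<^sub>1 l\<^sub>2"
    and st: "0 < s" "s \<le> l\<^sub>1" "0 < t" "t \<le> l\<^sub>2"
  shows "f s t = f l\<^sub>1 l\<^sub>2"
proof -
  define I where "I = {0<..l\<^sub>1} \<times> {0<..l\<^sub>2}"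
  define g where "g = (\<lambda>(s, t). f s t)"
  define M where "M = Sup (g ` I)"
  have bdd: "bdd_above (g ` I)" using bd by (auto simp: bdd_above_def I_def g_def intro!: exI [of _ B])
  have up: "g x \<le> M" if "x \<in> I" for x
    unfolding M_def using that bdd by (intro cSUP_upper)
  have ev: "eventually (\<lambda>x. x \<in> {0<..<a} \<times> {0<..<b}) (at_right 0 \<times>\<^sub>F at_right 0)" if "0 < a" "0 < b" for a b :: real
    unfolding eventually_prod_filter
    using that by (intro exI [of _ "\<lambda>x. x \<in> {0<..<a}"] exI [of _ "\<lambda>x. x \<in> {0<..<b}"])
      (auto simp: eventually_at_right_field)
  have "(g \<longlongrightarrow> M) (at_right 0 \<times>\<^sub>F at_right 0)"
  proof (rule order_tendstoI)
    fix y assume "y < M"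
    moreover have "I \<noteq> {}" using l by (auto simp: I_def)
    ultimately obtain a b where ab: "(a, b) \<in> I" "y < g (a, b)"
      unfolding M_def using less_cSUP_iff [OF _ bdd] by auto
    have "y < g x" if "x \<in> {0<..<a} \<times> {0<..<b}" for x
    proof -
      obtain c d where x: "x = (c, d)" by (cases x)
      have "g (a, b) \<le> g (c, b)" "g (c, b) \<le> g (c, d)"
        using ab that x m1 [of c a b] m2 [of c d b] by (auto simp: I_def g_def)
      with ab x show ?thesis by simp
    qed
    then show "eventually (\<lambda>x. y < g x) (at_right 0 \<times>\<^sub>F at_right 0)"
      using ab by (intro eventually_mono [OF ev [of a b]]) (auto simp: I_def)
  next
    fix y assume y: "M < y"
    have "g x < y" if "x \<in> {0<..<l\<^sub>1} \<times> {0<..<l\<^sub>2}" for x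
      using up [of x] that y by (auto simp: I_def)
    then show "eventually (\<lambda>x. g x < y) (at_right 0 \<times>\<^sub>F at_right 0)"
      using l by (intro eventually_mono [OF ev [of l\<^sub>1 l\<^sub>2]])
  qed
  moreover have "at_right (0::real) \<times>\<^sub>F at_right (0::real) \<noteq> bot" by (simp add: prod_filter_eq_bot)
  ultimately have "f l\<^sub>1 l\<^sub>2 = M" using tendsto_Lim lim unfolding g_def by metis
  moreover have "f s t \<le> M" using up [of "(s, t)"] st by (simp add: I_def g_def)
  moreover have "f l\<^sub>1 l\<^sub>2 \<le> f s l\<^sub>2" "f s l\<^sub>2 \<le> f s t" using m1 [of s l\<^sub>1 l\<^sub>2] m2 [of s t l\<^sub>2] st l by auto
  ultimately show ?thesis by linarith
qed

text \<open>Through \<open>stewart_hinge\<close>, the angle formed with \<open>z\<close> predicts a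
  distance from \<open>y\<close> to \<open>p\<close>. By \<open>stewart_ineq\<close> the true
  distance is at least the predicted one, so the angle formed with \<open>p\<close> is at least as
  large.\<close>

lemma comp_angle_antimono:
  fixes x y z p :: "'a::metric_space"
  assumes curv: "curvature_ge K TYPE('a)"
    and st: "dist x z = dist x p + dist p z" and ne: "x \<noteq> p" "y \<noteq> x"
    and sh: "short K (peri x y z / 2)"
  shows "comp_angle K x z y \<le> comp_angle K x p y"
proof (cases "z = p")
  case False
  define r t q where "r = dist x p" and "t = dist p z" and "q = dist x y"
  have rt: "0 < r" "0 < t" "dist x z = r + t" and q: "0 < q"
    using st ne False by (auto simp: r_def t_def q_def)
  have tri: "dist y p \<le> dist y z + dist p z" "dist x z \<le> dist x y + dist y z" "dist x y \<le> dist x z + dist y z" by metric+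
  have "x \<noteq> z" using rt by auto
  have per: "short K (peri x z y / 2)" using sh by (simp add: peri_def dist_commute algebra_simps)
  have per': "short K (peri x p y / 2)"
    using tri st by (intro short_mono [OF sh]) (simp add: peri_def dist_commute)
  have "r + t \<le> peri x y z / 2" "q \<le> peri x y z / 2"
    using tri rt unfolding q_def by (auto simp: peri_def dist_commute)
  then have shs: "short K r" "short K (r + t)" "short K q"
    using rt by (auto intro: short_mono [OF sh])
  have S: "0 < sn K r * sn K (r + t) * sn K q"
    using rt q shs by (intro mult_pos_pos sn_pos) auto
  note L1 = comp_angle_cos [OF \<open>x \<noteq> z\<close> ne(2) [symmetric] per]
  note L2 = comp_angle_cos [OF ne(1) ne(2) [symmetric] per']
  have e1: "md K (dist y z) = md K (r + t) + md K q - K * md K (r + t) * md K q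
      - sn K (r + t) * (sn K q * cos (comp_angle K x z y))"
    using L1(1) rt by (simp add: q_def dist_commute)
  have e2: "md K (dist y p) = md K r + md K q - K * md K r * md K q
      - sn K r * (sn K q * cos (comp_angle K x p y))"
    using L2(1) by (simp add: q_def r_def dist_commute)
  have "sn K t * md K q + sn K r * md K (dist y z)
    \<le> sn K (r + t) * md K (dist y p) + (sn K t * md K r + sn K r * md K t)"
    using stewart_ineq [OF curv st ne(1) False sh] rt by (simp add: r_def t_def q_def dist_commute)
  moreover have "sn K (r + t) * md K (dist y p) = sn K t * md K q + sn K r * md K (dist y z)
     - (sn K t * md K r + sn K r * md K t)
     + sn K r * sn K (r + t) * sn K q * (cos (comp_angle K x z y) - cos (comp_angle K x p y))"
    using stewart_hinge [of K r t "md K q" "sn K q * cos (comp_angle K x z y)"]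
    unfolding e1 e2 by (simp add: algebra_simps)
  ultimately have "0 \<le> sn K r * sn K (r + t) * sn K q * (cos (comp_angle K x z y) - cos (comp_angle K x p y))"
    by linarith
  then have "cos (comp_angle K x p y) \<le> cos (comp_angle K x z y)"
    using S by (simp add: zero_le_mult_iff)
  then show ?thesis using L1(2,3) L2(2,3) by (simp add: cos_mono_le_eq)
qed simp

section \<open>Rigidity of chords\<close>

text \<open>\<open>b < a\<close> would already put \<open>b\<close> below the bound on
  \<open>a\<close>. Thus \<open>b\<close> may be a distance in the space that is not known to be
  short.\<close>

lemma md_le_distD:
  assumes "md K a \<le> md K b" "0 \<le> a" "0 \<le> b" "K > 0 \<Longrightarrow> a \<le> pi / sqrt K"
  shows "a \<le> b"
proof (rule ccontr)
  assume "\<not> a \<le> b"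
  then have "md K b < md K a" using assms by (intro md_strict_mono) auto
  with assms(1) show False by simp
qed

lemma mdist_seg_start:
  assumes "a \<in> msp K" "b \<in> msp K" "sn K (mdist K a b) \<noteq> 0"
    and "0 \<le> r" "r \<le> mdist K a b"
  shows "mdist K a (seg K a b r) = r"
  using mdist_seg [OF assms(1-4)] mdist_le [OF assms(1,2)] assms(5) by fastforce

text \<open>All terms of Stewart's inequality except the distance sought agree with those of the
  identity in the model.\<close>

lemma chord_dist_ge:
  fixes u v x y :: "'a::metric_space"
  assumes curv: "curvature_ge K TYPE('a)"
    and M: "u' \<in> msp K" "v' \<in> msp K" "y' \<in> msp K"
    and ne: "u' \<noteq> v'" and l: "short K (mdist K u' v')"
    and r: "0 \<le> r" "r \<le> mdist K u' v'"
    and d: "dist u v = mdist K u' v'" "dist u x = r" "dist x v = mdist K u' v' - r"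
      "dist y u = mdist K y' u'" "dist y v = mdist K y' v'"
    and per: "short K (peri u y v / 2)"
  shows "mdist K y' (seg K u' v' r) \<le> dist y x"
proof -
  note S = short_S_nonzero [OF M(1,2) ne l]
  consider "r = 0" | "r = mdist K u' v'" | "0 < r" "r < mdist K u' v'" using r by linarith
  then show ?thesis
  proof cases
    case 1
    then show ?thesis using d S by simp
  next
    case 2
    then show ?thesis using d S by (simp add: seg_end)
  next
    case 3
    have st: "dist u v = dist u x + dist x v" "u \<noteq> x" "v \<noteq> x" using 3 d by auto
    have rt: "r + (mdist K u' v' - r) = mdist K u' v'" by simp
    have pos: "sn K (mdist K u' v') > 0" using 3 l by (intro sn_pos) auto
    have "sn K (mdist K u' v') * md K (mdist K y' (seg K u' v' r))
        \<le> sn K (mdist K u' v') * md K (dist y x)"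
      using stewart_ineq [OF curv st per] model_stewart [OF M S rt] by (simp add: d)
    then have le: "md K (mdist K y' (seg K u' v' r)) \<le> md K (dist y x)" using pos by simp
    have z: "seg K u' v' r \<in> msp K" by (rule seg_in_model [OF M(1,2) S])
    show ?thesis
      by (rule md_le_distD [OF le mdist_nonneg [OF M(3) z] zero_le_dist mdist_le [OF M(3) z]])
  qed
qed

text \<open>Equality at the inner point \<open>c\<close> turns Stewart's inequality around: the
  excesses at the two ends, with positive weights, are nonnegative and have a sum of at most 0, so
  both vanish.\<close>

lemma chord_ends_dist_eq:
  fixes u v c y :: "'a::metric_space"
  assumes curv: "curvature_ge K TYPE('a)"
    and M: "u' \<in> msp K" "v' \<in> msp K" "y' \<in> msp K"
    and ne: "u' \<noteq> v'" and l: "short K (mdist K u' v')"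
    and r: "0 < r" "r < mdist K u' v'"
    and d: "dist u v = mdist K u' v'" "dist u c = r" "dist c v = mdist K u' v' - r"
      "dist y c = mdist K y' (seg K u' v' r)"
    and ge: "mdist K y' u' \<le> dist y u" "mdist K y' v' \<le> dist y v"
    and per: "short K (peri u y v / 2)"
  shows "dist y u = mdist K y' u'" "dist y v = mdist K y' v'"
proof -
  note S = short_S_nonzero [OF M(1,2) ne l]
  have st: "dist u v = dist u c + dist c v" "u \<noteq> c" "v \<noteq> c" using r d by auto
  have rt: "r + (mdist K u' v' - r) = mdist K u' v'" by simp
  have pos: "0 < sn K r" "0 < sn K (mdist K u' v' - r)"
    using r by (auto intro!: sn_pos short_mono [OF l])
  have "dist y u \<le> dist y v + dist u v" "dist y v \<le> dist y u + dist u v" by metric+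
  then have "dist y u \<le> peri u y v / 2" "dist y v \<le> peri u y v / 2" by (auto simp: peri_def dist_commute)
  then have sh: "short K (dist y u)" "short K (dist y v)" by (auto intro: short_mono [OF per])
  have E: "md K (mdist K y' u') \<le> md K (dist y u)" "md K (mdist K y' v') \<le> md K (dist y v)"
    using sh ge M by (auto intro!: md_mono simp: short_def)
  define A where "A = sn K (mdist K u' v' - r) * (md K (dist y u) - md K (mdist K y' u'))"
  define B where "B = sn K r * (md K (dist y v) - md K (mdist K y' v'))"
  have "A + B \<le> 0"
    using stewart_ineq [OF curv st per] model_stewart [OF M S rt] by (simp add: d A_def B_def algebra_simps)
  moreover have "0 \<le> A" "0 \<le> B" using E pos by (auto simp: A_def B_def)
  ultimately have "A = 0" "B = 0" by auto
  then have "md K (dist y u) = md K (mdist K y' u')" "md K (dist y v) = md K (mdist K y' v')"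
    using pos by (auto simp: A_def B_def)
  then show "dist y u = mdist K y' u'" "dist y v = mdist K y' v'"
    using md_eq_iff [of "dist y u" "mdist K y' u'" K] md_eq_iff [of "dist y v" "mdist K y' v'" K]
      sh M mdist_le [of y' K u'] mdist_le [of y' K v'] by (auto simp: short_def)
qed

text \<open>A segment is divided into pieces \<open>a\<close>, \<open>b\<close>, \<open>t\<close>;
  this is Stewart's identity for the first division point, relative to the second one.\<close>

lemma stewart_collinear:
  "sn K (a + b + t) * md K b =
   sn K t * md K a + sn K (a + b) * md K (b + t)
     - (sn K t * md K (a + b) + sn K (a + b) * md K t)"
  using sn_square [of K a] sn_square [of K b] sn_square [of K t]
  unfolding sn_add md_add by algebra

lemma mdist_seg_seg:
  assumes M: "u \<in> msp K" "v \<in> msp K" and S: "sn K (mdist K u v) \<noteq> 0"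
    and r: "0 \<le> r'" "r' \<le> r" "r \<le> mdist K u v"
  shows "mdist K (seg K u v r') (seg K u v r) = r - r'"
proof -
  define b t where "b = r - r'" and "t = mdist K u v - r"
  have l: "mdist K u v = r' + b + t" "r = r' + b" by (auto simp: b_def t_def)
  note y = seg_in_model [OF M S]
  have rt: "r + t = mdist K u v" by (simp add: t_def)
  have du: "mdist K (seg K u v r') u = r'"
    using mdist_seg_start [OF M S, of r'] r by (simp add: mdist_commute [of K _ u])
  have dv: "mdist K (seg K u v r') v = b + t"
    using mdist_seg_end [OF M S, of r'] r by (simp add: b_def t_def)
  have "sn K (r + t) * md K (mdist K (seg K u v r') (seg K u v r)) = sn K (r + t) * md K b"
    unfolding model_stewart [OF M y S rt] du dv using stewart_collinear [of K r' b t] l(2) by simp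
  then have "md K (mdist K (seg K u v r') (seg K u v r)) = md K b" using S rt by simp
  then have "mdist K (seg K u v r') (seg K u v r) = b"
    using md_eq_iff [of "mdist K (seg K u v r') (seg K u v r)" b K] mdist_le [OF y y]
      mdist_nonneg [OF y y] mdist_le [OF M] r by (force simp: b_def)
  then show ?thesis by (simp add: b_def)
qed

lemma seg_seg:
  assumes M: "u \<in> msp K" "v \<in> msp K" and ne: "u \<noteq> v" and l: "short K (mdist K u v)"
    and r: "0 \<le> r'" "r' \<le> r" "0 < r" "r \<le> mdist K u v"
  shows "seg K u (seg K u v r) r' = seg K u v r'"
proof -
  note S = short_S_nonzero [OF M ne l]
  note y = seg_in_model [OF M S]
  have du: "mdist K u (seg K u v s) = s" if "0 \<le> s" "s \<le> mdist K u v" for s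
    using mdist_seg_start [OF M S] that by blast
  have "u \<noteq> seg K u v r" using du [of r] r M(1) by auto
  moreover have "mdist K u (seg K u v r') + mdist K (seg K u v r') (seg K u v r) \<le> mdist K u (seg K u v r)"
    using du [of r] du [of r'] mdist_seg_seg [OF M S r(1,2,4)] r by simp
  moreover have "short K (mdist K u (seg K u v r))" using du [of r] r by (auto intro: short_mono [OF l])
  ultimately have "seg K u v r' = seg K u (seg K u v r) (mdist K u (seg K u v r'))"
    by (intro model_between(1) M(1) y)
  then show ?thesis using du [of r'] r by simp
qed

section \<open>Partial isometries\<close>

text \<open>A relation, so that unions of chains and insertion of a pair make sense without values
  outside the domain. Single-valuedness comes for free from preserving the distance 0
  (\<open>F_unique\<close>).\<close>

definition partial_iso :: "real \<Rightarrow> (real^3) set \<Rightarrow> ((real^3) \<times> 'a::metric_space) set \<Rightarrow> bool" where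
  "partial_iso K D F \<longleftrightarrow> F \<subseteq> D \<times> UNIV \<and>
     (\<forall>(x, u) \<in> F. \<forall>(y, v) \<in> F. dist u v = mdist K x y)"

lemma partial_isoD:
  assumes "partial_iso K D F" "(x, u) \<in> F" "(y, v) \<in> F"
  shows "dist u v = mdist K x y" "x \<in> D"
  using assms unfolding partial_iso_def by blast+

lemma partial_iso_insert:
  assumes F: "partial_iso K D F" and D: "D \<subseteq> msp K" "x \<in> D"
    and d: "\<And>y v. (y, v) \<in> F \<Longrightarrow> dist v u = mdist K y x"
  shows "partial_iso K D (insert (x, u) F)"
proof -
  have "dist w v = mdist K z y" if zw: "(z, w) \<in> insert (x, u) F" "(y, v) \<in> insert (x, u) F" for z w y v
  proof -
    consider "(z, w) \<in> F" "(y, v) \<in> F" | "(z, w) \<in> F" "(y, v) = (x, u)" | "(z, w) = (x, u)" "(y, v) \<in> F"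
      | "(z, w) = (x, u)" "(y, v) = (x, u)" using zw unfolding insert_iff by blast
    then show ?thesis
    proof cases
      case 1
      then show ?thesis using partial_isoD(1) [OF F] by blast
    next
      case 2
      then show ?thesis using d [of z w] by simp
    next
      case 3
      then show ?thesis using d [of y v] by (simp add: dist_commute mdist_commute)
    next
      case 4
      then show ?thesis using D by (auto simp: subset_iff)
    qed
  qed
  moreover have "insert (x, u) F \<subseteq> D \<times> UNIV" using F D by (auto simp: partial_iso_def)
  ultimately show ?thesis unfolding partial_iso_def by blast
qed

lemma partial_iso_maximal:
  assumes "partial_iso K D F"
  obtains G where "F \<subseteq> G" "partial_iso K D G"
    "\<forall>x u. partial_iso K D (insert (x, u) G) \<longrightarrow> (x, u) \<in> G"
proof -
  let ?A = "{G. F \<subseteq> G \<and> partial_iso K D G}"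
  have "\<exists>G\<in>?A. \<forall>H\<in>?A. G \<subseteq> H \<longrightarrow> H = G"
  proof (rule subset_Zorn_nonempty)
    show "?A \<noteq> {}" using assms by blast
    fix \<C> assume ne: "\<C> \<noteq> {}" and ch: "subset.chain ?A \<C>"
    have "dist u v = mdist K x y" if xy: "(x, u) \<in> \<Union>\<C>" "(y, v) \<in> \<Union>\<C>" for x u y v
    proof -
      obtain G H where G: "G \<in> \<C>" "(x, u) \<in> G" and H: "H \<in> \<C>" "(y, v) \<in> H" using xy by blast
      have "G \<subseteq> H \<or> H \<subseteq> G" using ch G(1) H(1) unfolding subset.chain_def by blast
      then obtain J where "J \<in> \<C>" "(x, u) \<in> J" "(y, v) \<in> J" using G H by blast
      then show ?thesis using ch partial_isoD(1) [of K D J] by (auto simp: subset.chain_def)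
    qed
    moreover have "\<Union>\<C> \<subseteq> D \<times> UNIV" using ch by (auto simp: subset.chain_def partial_iso_def)
    moreover have "F \<subseteq> \<Union>\<C>" using ch ne unfolding subset.chain_def by blast
    ultimately show "\<Union>\<C> \<in> ?A" unfolding partial_iso_def by blast
  qed
  then obtain G where G: "G \<in> ?A" and max: "\<forall>H\<in>?A. G \<subseteq> H \<longrightarrow> H = G" by (rule bexE)
  show ?thesis
  proof (rule that)
    show "F \<subseteq> G" "partial_iso K D G" using G by auto
    show "\<forall>x u. partial_iso K D (insert (x, u) G) \<longrightarrow> (x, u) \<in> G"
    proof (intro allI impI)
      fix x u assume "partial_iso K D (insert (x, u) G)"
      then have "insert (x, u) G \<in> ?A" using G by blast
      then have "insert (x, u) G = G" using max by blast
      then show "(x, u) \<in> G" by blast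
    qed
  qed
qed

text \<open>All triples count, because a new point is compared with every point already present and
  each comparison uses the four-point condition. Triples with a repeated point bound the diameter
  (\<open>narrow_short\<close>).\<close>

definition narrow :: "real \<Rightarrow> (real^3) set \<Rightarrow> bool" where
  "narrow K D \<longleftrightarrow> D \<subseteq> msp K \<and>
     (\<forall>x\<in>D. \<forall>y\<in>D. \<forall>z\<in>D. short K ((mdist K x y + mdist K y z + mdist K z x) / 2))"

lemma narrow_short:
  assumes "narrow K D" "x \<in> D" "y \<in> D" shows "short K (mdist K x y)"
proof -
  have "short K ((mdist K x y + mdist K y x + mdist K x x) / 2)" "x \<in> msp K"
    using assms unfolding narrow_def by blast+
  then show ?thesis by (simp add: mdist_commute [of K y x])
qed

locale maximal_iso =
  fixes K :: real and D :: "(real^3) set" and F :: "((real^3) \<times> 'a::metric_space) set"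
  assumes alex: "alexandrov_space K TYPE('a)"
    and narrow: "narrow K D"
    and iso: "partial_iso K D F"
    and maximal: "\<And>x u. partial_iso K D (insert (x, u) F) \<Longrightarrow> (x, u) \<in> F"
begin

lemma curv: "curvature_ge K TYPE('a)"
  using alex by (simp add: alexandrov_space_def)

lemma D_model: "x \<in> D \<Longrightarrow> x \<in> msp K"
  using narrow by (auto simp: narrow_def)

lemma F_D: "(x, u) \<in> F \<Longrightarrow> x \<in> D"
  using iso by (auto simp: partial_iso_def)

lemma F_dist: "(x, u) \<in> F \<Longrightarrow> (y, v) \<in> F \<Longrightarrow> dist u v = mdist K x y"
  using partial_isoD(1) [OF iso] .

lemma F_peri: "(x, u) \<in> F \<Longrightarrow> (y, v) \<in> F \<Longrightarrow> (z, w) \<in> F \<Longrightarrow> short K (peri u v w / 2)"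
  using narrow F_D F_dist unfolding narrow_def peri_def by metis

lemma F_unique: "(x, u) \<in> F \<Longrightarrow> (x, v) \<in> F \<Longrightarrow> u = v"
  using F_dist [of x u x v] D_model [OF F_D] by simp

text \<open>\<open>c\<close> is strictly inside the chord, so
  \<open>intermediate_point_exists\<close> yields a point \<open>x\<close> before it. Its distances
  to the points of \<open>F\<close> are bounded below by means of the whole chord, and above by
  means of the part that begins at \<open>x\<close>, in which \<open>c\<close> is an inner point
  with known distances.\<close>

lemma chord_before:
  assumes u: "(u', u) \<in> F" and v: "(v', v) \<in> F" and c: "(seg K u' v' r, c) \<in> F"
    and r: "0 < s" "s < r" "r < mdist K u' v'" and sD: "seg K u' v' s \<in> D"
  shows "\<exists>x. (seg K u' v' s, x) \<in> F"
proof -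
  define l where "l = mdist K u' v'"
  have M: "u' \<in> msp K" "v' \<in> msp K" using u v F_D D_model by blast+
  have ne: "u' \<noteq> v'" using r M by auto
  have l: "short K (mdist K u' v')" using narrow_short [OF narrow F_D [OF u] F_D [OF v]] .
  note S = short_S_nonzero [OF M ne l]
  have du: "mdist K u' (seg K u' v' t) = t" if "0 \<le> t" "t \<le> l" for t
    using mdist_seg_start [OF M S] that by (simp add: l_def)
  have dv: "mdist K (seg K u' v' t) v' = l - t" if "0 \<le> t" "t \<le> l" for t
    using mdist_seg_end [OF M S, of t] that by (auto simp: l_def)
  have d: "dist u v = l" "dist u c = r" "dist c v = l - r"
    using F_dist u v c du [of r] dv [of r] r by (auto simp: l_def)
  have cv: "c \<noteq> v" "dist u v = dist u c + dist c v" using d r by (auto simp: l_def)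
  obtain x where x: "dist u x = s" "dist x c = r - s"
    using intermediate_point_exists [OF alex cv(2,1), of s] d l r by (auto simp: l_def)
  have xv: "dist x v = l - s"
  proof -
    have "dist x v \<le> dist x c + dist c v" "dist u v \<le> dist u x + dist x v" by metric+
    then show ?thesis using x d by simp
  qed
  have "dist y x = mdist K y' (seg K u' v' s)" if y: "(y', y) \<in> F" for y' y
  proof -
    have yM: "y' \<in> msp K" using D_model F_D y by blast
    have per: "short K (peri u y v / 2)" using F_peri [OF u y v] .
    have ge: "mdist K y' (seg K u' v' s) \<le> dist y x"
      by (rule chord_dist_ge [OF curv M yM ne l _ _ _ x(1) _ _ _ per])
        (use r d xv F_dist u v y in \<open>auto simp: l_def\<close>)
    define x' where "x' = seg K u' v' s"
    have x'M: "x' \<in> msp K" using D_model sD by (simp add: x'_def)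
    have x'v: "mdist K x' v' = l - s" using dv [of s] r by (simp add: x'_def l_def)
    have ne': "x' \<noteq> v'" using x'v r M(2) by (auto simp: l_def)
    have l': "short K (mdist K x' v')" using x'v r by (auto intro!: short_mono [OF l] simp: l_def)
    \<comment> \<open>\<open>seg_seg\<close> concerns initial pieces, so the final piece from
      \<open>x'\<close> to \<open>v'\<close> is read backwards from \<open>v'\<close>.\<close>
    have c': "seg K x' v' (r - s) = seg K u' v' r"
    proof -
      have "seg K v' (seg K v' u' (l - s)) (l - r) = seg K v' u' (l - r)"
        by (rule seg_seg) (use M ne l r in \<open>auto simp: l_def mdist_commute [of K v'] seg_commute [of K u']\<close>)
      moreover have "seg K v' u' (l - t) = seg K u' v' t" for t
        by (simp add: seg_commute [of K u' v'] l_def)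
      ultimately have "seg K v' x' (l - r) = seg K u' v' r" by (simp add: x'_def)
      then show ?thesis using x'v by (simp add: seg_commute [of K x' v'])
    qed
    have "peri x y v \<le> peri u y v"
    proof -
      have "dist y x \<le> dist y u + dist u x" by metric
      then show ?thesis using d x xv by (simp add: peri_def dist_commute)
    qed
    then have per': "short K (peri x y v / 2)" by (intro short_mono [OF per]) simp
    have "dist y x = mdist K y' x'"
      by (rule chord_ends_dist_eq(1) [OF curv x'M M(2) yM ne' l', where r = "r - s" and c = c and v = v])
        (use r x'v xv x d c' F_dist [OF y c] F_dist [OF y v] ge per' in \<open>auto simp: l_def x'_def\<close>)
    then show ?thesis by (simp add: x'_def)
  qed
  then have "partial_iso K D (insert (seg K u' v' s, x) F)"
    using iso sD D_model by (intro partial_iso_insert) auto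
  then show ?thesis using maximal by blast
qed

lemma chord:
  assumes u: "(u', u) \<in> F" and v: "(v', v) \<in> F" and c: "(seg K u' v' r, c) \<in> F"
    and r: "0 < r" "r < mdist K u' v'"
    and s: "0 < s" "s < mdist K u' v'" and sD: "seg K u' v' s \<in> D"
  shows "seg K u' v' s \<in> fst ` F"
proof -
  consider "s < r" | "s = r" | "r < s" by linarith
  then have "\<exists>x. (seg K u' v' s, x) \<in> F"
  proof cases
    case 1
    then show ?thesis using chord_before [OF u v c] s r sD by blast
  next
    case 3
    have "\<exists>x. (seg K v' u' (mdist K u' v' - s), x) \<in> F"
      using chord_before [OF v u, of "mdist K u' v' - r" c "mdist K u' v' - s"] c r s 3 sD
      by (simp add: seg_commute [of K u'] mdist_commute [of K v'])
    then show ?thesis by (simp add: seg_commute [of K u'])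
  qed (use c in blast)
  then show ?thesis by force
qed

text \<open>The images of points approaching \<open>x'\<close> form a Cauchy sequence because
  distances are preserved. Its limit has the right distances by continuity, so maximality
  applies.\<close>

lemma limit_on_segment:
  assumes o: "o' \<in> D" and x: "x' \<in> D" "o' \<noteq> x'"
    and dense: "\<And>r. 0 < r \<Longrightarrow> r < mdist K o' x' \<Longrightarrow> seg K o' x' r \<in> fst ` F"
  shows "x' \<in> fst ` F"
proof -
  define l where "l = mdist K o' x'"
  have M: "o' \<in> msp K" "x' \<in> msp K" using o x D_model by auto
  have l: "short K (mdist K o' x')" using narrow_short [OF narrow o x(1)] .
  have lpos: "0 < l" using mdist_pos [OF M x(2)] by (simp add: l_def)
  note S = short_S_nonzero [OF M x(2) l]
  \<comment> \<open>Denominators from 2 on keep the points strictly between \<open>o'\<close> and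
    \<open>x'\<close>, also for \<open>n = 0\<close>.\<close>
  define e where "e = (\<lambda>n. l / real (n + 2))"
  have e: "0 < e n" "e n < l" for n using lpos by (auto simp: e_def field_simps intro!: add_pos_nonneg)
  have e_lim: "e \<longlonglongrightarrow> 0"
    unfolding e_def by (rule LIMSEQ_ignore_initial_segment [OF lim_const_over_n])
  define y where "y = (\<lambda>n. seg K o' x' (l - e n))"
  have "\<exists>u. (y n, u) \<in> F" for n
    using dense [of "l - e n"] e [of n] by (force simp: y_def l_def)
  then obtain f where f: "\<And>n. (y n, f n) \<in> F" by metis
  have yD: "y n \<in> D" for n using F_D f by blast
  have dist_f: "dist (f m) (f n) \<le> e m + e n" for m n
  proof -
    have "mdist K (y m) (y n) \<le> e m + e n"
    proof (cases "e m \<le> e n")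
      case True
      have "mdist K (y n) (y m) = e n - e m" unfolding y_def
        using mdist_seg_seg [OF M S, of "l - e n" "l - e m"] e [of n] e [of m] True by (auto simp: l_def)
      then show ?thesis using e [of m] by (simp add: mdist_commute [of K "y m"])
    next
      case False
      have "mdist K (y m) (y n) = e m - e n" unfolding y_def
        using mdist_seg_seg [OF M S, of "l - e m" "l - e n"] e [of n] e [of m] False by (auto simp: l_def)
      then show ?thesis using e [of n] by simp
    qed
    then show ?thesis using F_dist [OF f f] by simp
  qed
  have "Cauchy f"
  proof (rule metric_CauchyI)
    fix \<epsilon> :: real assume "0 < \<epsilon>"
    then have "eventually (\<lambda>n. e n < \<epsilon> / 2) sequentially" by (intro order_tendstoD(2) [OF e_lim]) simp
    then obtain N where N: "\<And>n. n \<ge> N \<Longrightarrow> e n < \<epsilon> / 2" unfolding eventually_sequentially by blast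
    have "dist (f m) (f n) < \<epsilon>" if "m \<ge> N" "n \<ge> N" for m n
      using dist_f [of m n] N [OF that(1)] N [OF that(2)] by simp
    then show "\<exists>N. \<forall>m\<ge>N. \<forall>n\<ge>N. dist (f m) (f n) < \<epsilon>" by blast
  qed
  then obtain u where u: "f \<longlonglongrightarrow> u"
    using alex unfolding alexandrov_space_def complete_def by auto
  have "dist w u = mdist K z x'" if z: "(z, w) \<in> F" for z w
  proof -
    have zD: "z \<in> D" using F_D z by blast
    have yx: "mdist K (y n) x' = e n" for n
      using mdist_seg_end [OF M S, of "l - e n"] e [of n] by (simp add: y_def l_def)
    have bd: "\<bar>mdist K z (y n) - mdist K z x'\<bar> \<le> e n" for n
      using model_triangle_ineq [of z K x' "y n"] model_triangle_ineq [of z K "y n" x']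
        narrow_short [OF narrow zD x(1)] narrow_short [OF narrow zD yD [of n]] D_model zD yD [of n] x(1) yx [of n]
      by (simp add: mdist_commute [of K x'])
    have "(\<lambda>n. mdist K z (y n) - mdist K z x') \<longlonglongrightarrow> 0"
      by (rule Lim_null_comparison [OF _ e_lim]) (use bd in auto)
    then have "(\<lambda>n. mdist K z (y n)) \<longlonglongrightarrow> mdist K z x'" by (simp add: LIM_zero_iff)
    moreover have "(\<lambda>n. mdist K z (y n)) = (\<lambda>n. dist w (f n))" using F_dist [OF z f] by simp
    moreover have "(\<lambda>n. dist w (f n)) \<longlonglongrightarrow> dist w u" by (intro tendsto_intros u)
    ultimately show ?thesis using LIMSEQ_unique by metis
  qed
  then have "partial_iso K D (insert (x', u) F)"
    using iso x(1) D_model by (intro partial_iso_insert) auto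
  then show ?thesis using maximal by force
qed

end

section \<open>Distances between the two sides, and from a chord point to a side\<close>

lemma seg_sub:
  assumes M: "u \<in> msp K" "v \<in> msp K" and ne: "u \<noteq> v" and l: "short K (mdist K u v)"
    and r: "0 \<le> r\<^sub>1" "r\<^sub>1 \<le> r" "r \<le> r\<^sub>2" "r\<^sub>1 < r\<^sub>2" "r\<^sub>2 \<le> mdist K u v"
  shows "seg K (seg K u v r\<^sub>1) (seg K u v r\<^sub>2) (r - r\<^sub>1) = seg K u v r"
proof -
  note S = short_S_nonzero [OF M ne l]
  note y = seg_in_model [OF M S]
  have d: "mdist K (seg K u v r\<^sub>1) (seg K u v r) = r - r\<^sub>1" "mdist K (seg K u v r) (seg K u v r\<^sub>2) = r\<^sub>2 - r"
    "mdist K (seg K u v r\<^sub>1) (seg K u v r\<^sub>2) = r\<^sub>2 - r\<^sub>1"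
    using r by (auto intro!: mdist_seg_seg [OF M S])
  have "seg K u v r\<^sub>1 \<noteq> seg K u v r\<^sub>2" using d(3) r(4) y by auto
  moreover have "short K (mdist K (seg K u v r\<^sub>1) (seg K u v r\<^sub>2))"
    using d(3) r by (auto intro: short_mono [OF l])
  ultimately show ?thesis using model_between(1) [OF y y y, of r\<^sub>1 r\<^sub>2 r] d by simp
qed

text \<open>A constant comparison angle means that the law of cosines \<open>H\<close>, with one
  cosine \<open>q\<close>, gives all distances between the two sides in the space. The model
  distances obey the same law since Stewart's identity preserves it.\<close>

lemma hinge_dist:
  fixes g h :: "real \<Rightarrow> 'a::metric_space"
  assumes M: "o' \<in> msp K" "a' \<in> msp K" "b' \<in> msp K"
    and L: "L\<^sub>1 = mdist K o' a'" "L\<^sub>2 = mdist K o' b'" and pos: "0 < L\<^sub>1" "0 < L\<^sub>2"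
    and per: "short K (peri (g 0) (g L\<^sub>1) (h L\<^sub>2) / 2)"
    and g: "\<And>s t. 0 \<le> s \<Longrightarrow> s \<le> t \<Longrightarrow> t \<le> L\<^sub>1 \<Longrightarrow> dist (g s) (g t) = t - s"
    and h: "\<And>s t. 0 \<le> s \<Longrightarrow> s \<le> t \<Longrightarrow> t \<le> L\<^sub>2 \<Longrightarrow> dist (h s) (h t) = t - s"
    and gh: "h 0 = g 0" and ends: "dist (g L\<^sub>1) (h L\<^sub>2) = mdist K a' b'"
    and ang: "\<And>s t. 0 < s \<Longrightarrow> s \<le> L\<^sub>1 \<Longrightarrow> 0 < t \<Longrightarrow> t \<le> L\<^sub>2 \<Longrightarrow>
      comp_angle K (g 0) (g s) (h t) = comp_angle K (g 0) (g L\<^sub>1) (h L\<^sub>2)"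
    and s: "0 \<le> s" "s \<le> L\<^sub>1" and t: "0 \<le> t" "t \<le> L\<^sub>2"
  shows "dist (g s) (h t) = mdist K (seg K o' a' s) (seg K o' b' t)"
proof -
  have dg: "dist (g 0) (g r) = r" if "0 \<le> r" "r \<le> L\<^sub>1" for r using g [of 0 r] that by simp
  have dh: "dist (g 0) (h r) = r" if "0 \<le> r" "r \<le> L\<^sub>2" for r using h [of 0 r] that gh by simp
  have "dist (g 0) (g L\<^sub>1) \<le> dist (g 0) (h L\<^sub>2) + dist (g L\<^sub>1) (h L\<^sub>2)"
    "dist (g 0) (h L\<^sub>2) \<le> dist (g 0) (g L\<^sub>1) + dist (g L\<^sub>1) (h L\<^sub>2)" by metric+
  then have "L\<^sub>1 \<le> peri (g 0) (g L\<^sub>1) (h L\<^sub>2) / 2" "L\<^sub>2 \<le> peri (g 0) (g L\<^sub>1) (h L\<^sub>2) / 2"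
    using dg [of L\<^sub>1] dh [of L\<^sub>2] pos by (auto simp: peri_def dist_commute)
  then have sh: "short K L\<^sub>1" "short K L\<^sub>2" using short_mono [OF per] by auto
  have S: "sn K (mdist K o' a') \<noteq> 0" "sn K (mdist K o' b') \<noteq> 0"
    using sn_pos [OF pos(1) sh(1)] sn_pos [OF pos(2) sh(2)] L by auto
  note aM = seg_in_model [OF M(1,2) S(1)] and bM = seg_in_model [OF M(1,3) S(2)]
  define q where "q = cos (comp_angle K (g 0) (g L\<^sub>1) (h L\<^sub>2))"
  define H where "H = (\<lambda>s t. md K s + md K t - K * md K s * md K t - sn K s * sn K t * q)"
  have perst: "short K (peri (g 0) (g s) (h t) / 2)" if "0 \<le> s" "s \<le> L\<^sub>1" "0 \<le> t" "t \<le> L\<^sub>2" for s t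
  proof -
    have "dist (g s) (h t) \<le> dist (g s) (g L\<^sub>1) + dist (g L\<^sub>1) (h L\<^sub>2) + dist (h t) (h L\<^sub>2)" by metric
    then have "peri (g 0) (g s) (h t) \<le> peri (g 0) (g L\<^sub>1) (h L\<^sub>2)"
      using g [of s L\<^sub>1] h [of t L\<^sub>2] dg [of s] dg [of L\<^sub>1] dh [of t] dh [of L\<^sub>2] that pos
      by (simp add: peri_def dist_commute)
    then show ?thesis by (intro short_mono [OF per]) simp
  qed
  have X: "md K (dist (g s) (h t)) = H s t" if st: "0 < s" "s \<le> L\<^sub>1" "0 < t" "t \<le> L\<^sub>2" for s t
  proof -
    have "g 0 \<noteq> g s" "g 0 \<noteq> h t" using dg [of s] dh [of t] st by auto
    from comp_angle_cos(1) [OF this perst [of s t]] show ?thesis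
      using st dg [of s] dh [of t] ang [OF st] by (simp add: H_def q_def)
  qed
  \<comment> \<open>Stewart's theorem along one side with apex \<open>b'\<close>, and then along the
    other side with apex \<open>seg K o' a' s\<close>. Only side lengths of the model triangle
    enter, never its angles.\<close>
  have Mb: "md K (mdist K b' (seg K o' a' s)) = H s L\<^sub>2"
  proof -
    have rt: "s + (L\<^sub>1 - s) = mdist K o' a'" using L by simp
    have "sn K L\<^sub>1 * md K (mdist K b' (seg K o' a' s)) =
        sn K (L\<^sub>1 - s) * md K L\<^sub>2 + sn K s * H L\<^sub>1 L\<^sub>2
          - (sn K (L\<^sub>1 - s) * md K s + sn K s * md K (L\<^sub>1 - s))"
      using model_stewart [OF M S(1) rt] X [of L\<^sub>1 L\<^sub>2] pos L ends
      by (simp add: mdist_commute [of K b'])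
    also have "\<dots> = sn K L\<^sub>1 * H s L\<^sub>2"
      using stewart_hinge [of K s "L\<^sub>1 - s" "md K L\<^sub>2" "sn K L\<^sub>2 * q"]
      by (simp add: H_def algebra_simps)
    finally show ?thesis using S(1) L by simp
  qed
  have Hc: "md K (mdist K (seg K o' a' s) (seg K o' b' t)) = H s t"
  proof -
    have rt: "t + (L\<^sub>2 - t) = mdist K o' b'" using L by simp
    have ds: "mdist K (seg K o' a' s) o' = s"
      using mdist_seg_start [OF M(1,2) S(1)] s L by (simp add: mdist_commute [of K _ o'])
    have "sn K L\<^sub>2 * md K (mdist K (seg K o' a' s) (seg K o' b' t)) =
        sn K (L\<^sub>2 - t) * md K s + sn K t * H s L\<^sub>2
          - (sn K (L\<^sub>2 - t) * md K t + sn K t * md K (L\<^sub>2 - t))"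
      using model_stewart [OF M(1,3) aM S(2) rt] L Mb
      by (simp add: ds mdist_commute [of K b'])
    also have "\<dots> = sn K L\<^sub>2 * H s t"
      using stewart_hinge [of K t "L\<^sub>2 - t" "md K s" "sn K s * q"]
      by (simp add: H_def algebra_simps)
    finally show ?thesis using S(2) L by simp
  qed
  consider "s = 0" | "t = 0" | "0 < s" "0 < t" using s t by linarith
  then show ?thesis
  proof cases
    case 1
    then show ?thesis using dh [OF t] mdist_seg_start [OF M(1,3) S(2)] t L S by simp
  next
    case 2
    then show ?thesis using dg [OF s] mdist_seg_start [OF M(1,2) S(1)] s L S gh
      by (simp add: dist_commute mdist_commute [of K _ o'])
  next
    case 3
    have "md K (dist (g s) (h t)) = md K (mdist K (seg K o' a' s) (seg K o' b' t))"
      using X [of s t] Hc 3 s t by simp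
    moreover have "dist (g s) (h t) \<le> dist (g 0) (g s) + dist (g 0) (h t)" by metric
    then have "dist (g s) (h t) \<le> peri (g 0) (g s) (h t) / 2" by (simp add: peri_def dist_commute)
    then have "short K (dist (g s) (h t))" using short_mono [OF perst [OF s t]] by simp
    ultimately show ?thesis
      using md_eq_iff [of "dist (g s) (h t)" "mdist K (seg K o' a' s) (seg K o' b' t)" K]
        mdist_le [OF aM bM, of s t] mdist_nonneg [OF aM bM, of s t] by (force simp: short_def)
  qed
qed

text \<open>\<open>chord_ends_dist_eq\<close> on a piece of the side around
  \<open>s\<^sub>0\<close>; a piece can be chosen such that its perimeter with \<open>p\<close> is
  under control.\<close>

lemma side_dist_eq_aux:
  fixes g :: "real \<Rightarrow> 'a::metric_space"
  assumes curv: "curvature_ge K TYPE('a)"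
    and M: "o' \<in> msp K" "a' \<in> msp K" "p' \<in> msp K"
    and ne: "o' \<noteq> a'" and l: "short K (mdist K o' a')"
    and g: "\<And>s t. 0 \<le> s \<Longrightarrow> s \<le> t \<Longrightarrow> t \<le> mdist K o' a' \<Longrightarrow> dist (g s) (g t) = t - s"
    and ge: "\<And>s. 0 \<le> s \<Longrightarrow> s \<le> mdist K o' a' \<Longrightarrow> mdist K p' (seg K o' a' s) \<le> dist p (g s)"
    and eq: "dist p (g s\<^sub>0) = mdist K p' (seg K o' a' s\<^sub>0)"
    and s: "0 \<le> s\<^sub>1" "s\<^sub>1 < s\<^sub>0" "s\<^sub>0 < s\<^sub>2" "s\<^sub>2 \<le> mdist K o' a'"
    and per: "short K (peri (g s\<^sub>1) p (g s\<^sub>2) / 2)"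
  shows "dist p (g s\<^sub>1) = mdist K p' (seg K o' a' s\<^sub>1)" "dist p (g s\<^sub>2) = mdist K p' (seg K o' a' s\<^sub>2)"
proof -
  note S = short_S_nonzero [OF M(1,2) ne l]
  note y = seg_in_model [OF M(1,2) S]
  have d: "mdist K (seg K o' a' s\<^sub>1) (seg K o' a' s\<^sub>2) = s\<^sub>2 - s\<^sub>1"
    using s by (auto intro!: mdist_seg_seg [OF M(1,2) S])
  have ne': "seg K o' a' s\<^sub>1 \<noteq> seg K o' a' s\<^sub>2" using d s y by auto
  have c: "seg K (seg K o' a' s\<^sub>1) (seg K o' a' s\<^sub>2) (s\<^sub>0 - s\<^sub>1) = seg K o' a' s\<^sub>0"
    using s by (intro seg_sub M ne l) auto
  have l': "short K (mdist K (seg K o' a' s\<^sub>1) (seg K o' a' s\<^sub>2))"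
    using s d by (intro short_mono [OF l]) auto
  note * = chord_ends_dist_eq [OF curv y y M(3) ne' l', of "s\<^sub>0 - s\<^sub>1" "g s\<^sub>1" "g s\<^sub>2" "g s\<^sub>0" p]
  show "dist p (g s\<^sub>1) = mdist K p' (seg K o' a' s\<^sub>1)" "dist p (g s\<^sub>2) = mdist K p' (seg K o' a' s\<^sub>2)"
    by (intro *; use s g [of s\<^sub>1 s\<^sub>2] g [of s\<^sub>1 s\<^sub>0] g [of s\<^sub>0 s\<^sub>2] d c eq ge per in force)+
qed

text \<open>The second point \<open>s'\<close> on the other side of \<open>s\<^sub>0\<close> is taken so close to \<open>s\<^sub>0\<close> that the perimeter bound
  needed for the four-point condition survives.\<close>

lemma side_dist_eq:
  fixes g :: "real \<Rightarrow> 'a::metric_space"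
  assumes curv: "curvature_ge K TYPE('a)"
    and M: "o' \<in> msp K" "a' \<in> msp K" "p' \<in> msp K"
    and ne: "o' \<noteq> a'" and l: "short K (mdist K o' a')"
    and g: "\<And>s t. 0 \<le> s \<Longrightarrow> s \<le> t \<Longrightarrow> t \<le> mdist K o' a' \<Longrightarrow> dist (g s) (g t) = t - s"
    and ge: "\<And>s. 0 \<le> s \<Longrightarrow> s \<le> mdist K o' a' \<Longrightarrow> mdist K p' (seg K o' a' s) \<le> dist p (g s)"
    and eq: "dist p (g s\<^sub>0) = mdist K p' (seg K o' a' s\<^sub>0)"
    and s0: "0 < s\<^sub>0" "s\<^sub>0 < mdist K o' a'"
    and per: "\<And>s. 0 \<le> s \<Longrightarrow> s \<le> mdist K o' a' \<Longrightarrow> short K (peri (g s) p (g s\<^sub>0) / 2)"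
    and s: "0 \<le> s" "s \<le> mdist K o' a'"
  shows "dist p (g s) = mdist K p' (seg K o' a' s)"
proof -
  note aux = side_dist_eq_aux [OF curv M ne l g ge eq]
  obtain \<delta> where \<delta>: "\<delta> > 0" "short K (peri (g s) p (g s\<^sub>0) / 2 + \<delta>)"
    using short_less_ex [OF per [OF s]] by blast
  have near: "short K (peri (g s) p (g s') / 2)" if "dist (g s\<^sub>0) (g s') \<le> \<delta>" for s'
  proof -
    have "dist p (g s') \<le> dist p (g s\<^sub>0) + dist (g s\<^sub>0) (g s')" "dist (g s) (g s') \<le> dist (g s) (g s\<^sub>0) + dist (g s\<^sub>0) (g s')"
      by metric+
    then show ?thesis using that by (intro short_mono [OF \<delta>(2)]) (simp add: peri_def dist_commute field_simps)
  qed
  consider "s = s\<^sub>0" | "s < s\<^sub>0" | "s\<^sub>0 < s" by linarith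
  then show ?thesis
  proof cases
    case 2
    define s' where "s' = min (mdist K o' a') (s\<^sub>0 + \<delta>)"
    have s': "s\<^sub>0 < s'" "s' \<le> mdist K o' a'" "s' - s\<^sub>0 \<le> \<delta>" using s0 \<delta> by (auto simp: s'_def)
    show ?thesis
      by (rule aux(1) [of s s']) (use s s' 2 s0 g [of s\<^sub>0 s'] near [of s'] in auto)
  next
    case 3
    define s' where "s' = max 0 (s\<^sub>0 - \<delta>)"
    have s': "0 \<le> s'" "s' < s\<^sub>0" "s\<^sub>0 - s' \<le> \<delta>" using s0 \<delta> by (auto simp: s'_def)
    have "short K (peri (g s') p (g s) / 2)"
      using near [of s'] g [of s' s\<^sub>0] s' s0 by (simp add: peri_def dist_commute algebra_simps)
    then show ?thesis
      by (intro aux(2) [of s' s]) (use s s' 3 in auto)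
  qed (use eq in simp)
qed

section \<open>The model region as a cone\<close>

definition cone3 :: "real \<Rightarrow> real^3 \<Rightarrow> real^3 \<Rightarrow> real^3 \<Rightarrow> (real^3) set" where
  "cone3 K a b c = {\<alpha> *\<^sub>R hom K a + \<beta> *\<^sub>R hom K b + \<gamma> *\<^sub>R hom K c | \<alpha> \<beta> \<gamma>. 0 \<le> \<alpha> \<and> 0 \<le> \<beta> \<and> 0 \<le> \<gamma>}"

text \<open>A description by linear inequalities of \<open>model_region\<close>, which is defined
  through complementary components; they agree by \<open>model_region_eq\<close>.\<close>

definition cone_region :: "real \<Rightarrow> real^3 \<Rightarrow> real^3 \<Rightarrow> real^3 \<Rightarrow> (real^3) set" where
  "cone_region K a b c = {x \<in> msp K. hom K x \<in> cone3 K a b c}"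

lemma cone3_add: "x \<in> cone3 K a b c \<Longrightarrow> y \<in> cone3 K a b c \<Longrightarrow> x + y \<in> cone3 K a b c"
proof -
  assume "x \<in> cone3 K a b c" "y \<in> cone3 K a b c"
  then obtain p q r p' q' r' where c: "0 \<le> p" "0 \<le> q" "0 \<le> r" "0 \<le> p'" "0 \<le> q'" "0 \<le> r'"
    and "x = p *\<^sub>R hom K a + q *\<^sub>R hom K b + r *\<^sub>R hom K c" "y = p' *\<^sub>R hom K a + q' *\<^sub>R hom K b + r' *\<^sub>R hom K c"
    unfolding cone3_def by blast
  then have "x + y = (p + p') *\<^sub>R hom K a + (q + q') *\<^sub>R hom K b + (r + r') *\<^sub>R hom K c"
    by (simp add: algebra_simps)
  then show ?thesis unfolding cone3_def using c by (blast intro: add_nonneg_nonneg)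
qed

lemma cone3_scale: "x \<in> cone3 K a b c \<Longrightarrow> 0 \<le> t \<Longrightarrow> t *\<^sub>R x \<in> cone3 K a b c"
proof -
  assume "x \<in> cone3 K a b c" and t: "0 \<le> t"
  then obtain p q r where c: "0 \<le> p" "0 \<le> q" "0 \<le> r"
    and "x = p *\<^sub>R hom K a + q *\<^sub>R hom K b + r *\<^sub>R hom K c"
    unfolding cone3_def by blast
  then have "t *\<^sub>R x = (t * p) *\<^sub>R hom K a + (t * q) *\<^sub>R hom K b + (t * r) *\<^sub>R hom K c"
    by (simp add: algebra_simps)
  then show ?thesis unfolding cone3_def using c t by (blast intro: mult_nonneg_nonneg)
qed

lemma cone3_vertices: "hom K a \<in> cone3 K a b c" "hom K b \<in> cone3 K a b c" "hom K c \<in> cone3 K a b c"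
proof -
  have "hom K a = 1 *\<^sub>R hom K a + 0 *\<^sub>R hom K b + 0 *\<^sub>R hom K c" "hom K b = 0 *\<^sub>R hom K a + 1 *\<^sub>R hom K b + 0 *\<^sub>R hom K c"
    "hom K c = 0 *\<^sub>R hom K a + 0 *\<^sub>R hom K b + 1 *\<^sub>R hom K c" by simp_all
  then show "hom K a \<in> cone3 K a b c" "hom K b \<in> cone3 K a b c" "hom K c \<in> cone3 K a b c"
    unfolding cone3_def using zero_le_one order_refl by blast+
qed

lemma cone3_scaleD:
  assumes "t *\<^sub>R x \<in> cone3 K a b c" "0 < t" shows "x \<in> cone3 K a b c"
  using cone3_scale [OF assms(1), of "1 / t"] assms(2) by simp

lemma closed_cone3: "closed (cone3 K a b c)"
proof -
  let ?H = "convex_cone hull {hom K a, hom K b, hom K c}"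
  have "cone3 K a b c \<subseteq> ?H"
  proof -
    have "hom K a \<in> ?H" "hom K b \<in> ?H" "hom K c \<in> ?H" by (auto intro: hull_inc)
    then show ?thesis unfolding cone3_def by (auto intro!: convex_cone_hull_add convex_cone_hull_mul)
  qed
  moreover have "convex_cone (cone3 K a b c)"
    unfolding convex_cone_iff
    using cone3_add cone3_scale cone3_scale [OF cone3_vertices(1), of 0] by auto
  then have "?H \<subseteq> cone3 K a b c"
    using cone3_vertices by (intro hull_minimal) auto
  ultimately have "cone3 K a b c = ?H" by blast
  then show ?thesis by (simp add: closed_convex_cone_hull)
qed

lemma between_set_iff_cone:
  assumes M: "u \<in> msp K" "v \<in> msp K" and l: "short K (mdist K u v)"
  shows "x \<in> between_set (msp K) (mdist K) u v \<longleftrightarrow>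
    x \<in> msp K \<and> (\<exists>\<alpha> \<beta>. 0 \<le> \<alpha> \<and> 0 \<le> \<beta> \<and> hom K x = \<alpha> *\<^sub>R hom K u + \<beta> *\<^sub>R hom K v)"
proof (cases "x \<in> msp K")
  case xM: True
  show ?thesis
  proof (cases "u = v")
    case True
    have "x \<in> between_set (msp K) (mdist K) u v \<longleftrightarrow> mdist K u x = 0"
      using xM M True by (auto simp: between_set_def mdist_commute [of K x])
    also have "\<dots> \<longleftrightarrow> x = u" using mdist_eq_0 [OF M(1) xM] by blast
    also have "\<dots> \<longleftrightarrow> (\<exists>\<alpha> \<beta>. 0 \<le> \<alpha> \<and> 0 \<le> \<beta> \<and> hom K x = \<alpha> *\<^sub>R hom K u + \<beta> *\<^sub>R hom K v)"
    proof
      assume "x = u"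
      then have "hom K x = 1 *\<^sub>R hom K u + 0 *\<^sub>R hom K v" by simp
      then show "\<exists>\<alpha> \<beta>. 0 \<le> \<alpha> \<and> 0 \<le> \<beta> \<and> hom K x = \<alpha> *\<^sub>R hom K u + \<beta> *\<^sub>R hom K v"
        using zero_le_one order_refl by blast
    next
      assume "\<exists>\<alpha> \<beta>. 0 \<le> \<alpha> \<and> 0 \<le> \<beta> \<and> hom K x = \<alpha> *\<^sub>R hom K u + \<beta> *\<^sub>R hom K v"
      then obtain \<alpha> \<beta> where "0 \<le> \<alpha>" "0 \<le> \<beta>" "hom K x = (\<alpha> + \<beta>) *\<^sub>R hom K u"
        using True by (auto simp: scaleR_left_distrib)
      moreover then have "\<alpha> + \<beta> \<noteq> 0" using hom_nonzero [OF xM] by auto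
      ultimately show "x = u" using hom_ray_unique [OF xM M(1), of "\<alpha> + \<beta>"] by simp
    qed
    finally show ?thesis using xM by simp
  next
    case False
    note S = short_S_nonzero [OF M False l]
    have pos: "0 < sn K (mdist K u v)" using sn_pos [OF mdist_pos [OF M False] l] .
    show ?thesis
    proof
      assume "x \<in> between_set (msp K) (mdist K) u v"
      then have d: "mdist K u v = mdist K u x + mdist K x v" by (simp add: between_set_def)
      define r where "r = mdist K u x"
      have r: "0 \<le> r" "r \<le> mdist K u v" using d xM M by (auto simp: r_def)
      have "x = seg K u v r" using model_between(1) [OF M xM False l] d by (simp add: r_def)
      then have "sn K (mdist K u v) *\<^sub>R hom K x = sn K (mdist K u v - r) *\<^sub>R hom K u + sn K r *\<^sub>R hom K v"
        using hom_seg [OF S, of r] by simp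
      then have "hom K x = (sn K (mdist K u v - r) / sn K (mdist K u v)) *\<^sub>R hom K u
          + (sn K r / sn K (mdist K u v)) *\<^sub>R hom K v"
        by (rule scaleR_combination(1) [OF S])
      moreover have "0 \<le> sn K (mdist K u v - r)" "0 \<le> sn K r"
        using r by (auto intro!: sn_nonneg short_mono [OF l])
      ultimately show "x \<in> msp K \<and> (\<exists>\<alpha> \<beta>. 0 \<le> \<alpha> \<and> 0 \<le> \<beta> \<and> hom K x = \<alpha> *\<^sub>R hom K u + \<beta> *\<^sub>R hom K v)"
        using xM pos by (meson divide_nonneg_pos)
    next
      assume "x \<in> msp K \<and> (\<exists>\<alpha> \<beta>. 0 \<le> \<alpha> \<and> 0 \<le> \<beta> \<and> hom K x = \<alpha> *\<^sub>R hom K u + \<beta> *\<^sub>R hom K v)"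
      then obtain \<alpha> \<beta> where c: "0 \<le> \<alpha>" "0 \<le> \<beta>" "hom K x = \<alpha> *\<^sub>R hom K u + \<beta> *\<^sub>R hom K v" by blast
      obtain r where r: "0 \<le> r" "r \<le> mdist K u v" "x = seg K u v r"
        by (rule seg_of_cone [OF M xM False l c]) blast
      then show "x \<in> between_set (msp K) (mdist K) u v"
        using xM mdist_seg_start [OF M S r(1,2)] mdist_seg_end [OF M S r(1,2)]
        by (simp add: between_set_def)
    qed
  qed
qed (simp add: between_set_def)

lemma sphere_minus: "K > 0 \<Longrightarrow> x \<in> msp K \<Longrightarrow> - x \<in> msp K"
  by (simp add: model_space_def)

lemma mdist_minus:
  assumes "K > 0" "x \<in> msp K" "y \<in> msp K"
  shows "mdist K x (- y) = pi / sqrt K - mdist K x y"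
  using assms sphere_bform [OF assms] by (simp add: model_dist_def arccos_minus abs_le_iff diff_divide_distrib)

lemma not_antipodal:
  assumes M: "u \<in> msp K" "v \<in> msp K" and l: "short K (mdist K u v)" and c: "c \<ge> 0"
  shows "hom K u \<noteq> - c *\<^sub>R hom K v"
proof
  assume eq: "hom K u = - c *\<^sub>R hom K v"
  show False
  proof (cases "K > 0")
    case True
    have "u = - c *\<^sub>R v" using eq True by (simp add: hom_def)
    then have "hom K (- u) = c *\<^sub>R hom K v" using True by (simp add: hom_def)
    moreover have "c \<noteq> 0" using eq hom_nonzero [OF M(1)] by auto
    ultimately have "- u = v" using hom_ray_unique [OF sphere_minus [OF True M(1)] M(2), of c] c by simp
    then have "mdist K v (- u) = 0" using M(2) by simp
    then show False using mdist_minus [OF True M(2,1)] l True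
      by (simp add: short_def mdist_commute [of K v u])
  next
    case False
    have "hom K u $ 3 = - c * hom K v $ 3" unfolding eq by simp
    moreover have pos: "0 < hom K u $ 3" "0 < hom K v $ 3" using False M hom_nth3_pos by auto
    moreover have "0 \<le> c * hom K v $ 3" using c pos(2) by simp
    ultimately show False by linarith
  qed
qed

text \<open>With a larger perimeter, passing to \<open>- w\<close> would give equality in the
  triangle inequality, or reverse it, for \<open>u\<close> and \<open>v\<close>. Then
  \<open>- w\<close> lies on the segment between them, where the product with \<open>\<zeta>\<close>
  cannot be negative.\<close>

lemma hemisphere_perimeter:
  assumes K: "K > 0" and M: "u \<in> msp K" "v \<in> msp K" "w \<in> msp K"
    and z: "0 < \<zeta> \<bullet> u" "0 < \<zeta> \<bullet> v" "0 < \<zeta> \<bullet> w"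
  shows "short K ((mdist K u v + mdist K v w + mdist K w u) / 2)"
proof -
  define \<pi>' where "\<pi>' = pi / sqrt K"
  have sh: "mdist K x y < \<pi>'" if "x \<in> msp K" "y \<in> msp K" "0 < \<zeta> \<bullet> x" "0 < \<zeta> \<bullet> y" for x y
  proof (rule ccontr)
    assume "\<not> ?thesis"
    then have "mdist K x (- y) \<le> 0" using mdist_minus [OF K that(1,2)] by (simp add: \<pi>'_def)
    then have "x = - y"
      using mdist_nonneg [OF that(1) sphere_minus [OF K that(2)]] mdist_eq_0 [OF that(1) sphere_minus [OF K that(2)]] by simp
    then show False using that by simp
  qed
  have "mdist K u v + mdist K v w + mdist K w u < 2 * \<pi>'"
  proof (cases "u = v")
    case True
    then show ?thesis using sh [OF M(1,3) z(1,3)] M by (simp add: mdist_commute [of K w])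
  next
    case False
    have l: "short K (mdist K u v)" using sh [OF M(1,2) z(1,2)] by (simp add: short_def \<pi>'_def)
    note S = short_S_nonzero [OF M(1,2) False l]
    have wM: "- w \<in> msp K" by (rule sphere_minus [OF K M(3)])
    have d: "mdist K u (- w) = \<pi>' - mdist K w u" "mdist K (- w) v = \<pi>' - mdist K v w"
      using mdist_minus [OF K M(1,3)] mdist_minus [OF K M(2,3)]
      by (simp_all add: \<pi>'_def mdist_commute [of K w] mdist_commute [of K "- w"])
    show ?thesis
    proof (rule ccontr)
      assume "\<not> ?thesis"
      then have le: "mdist K u (- w) + mdist K (- w) v \<le> mdist K u v" unfolding d by simp
      define r where "r = mdist K u (- w)"
      have r: "0 \<le> r" "r \<le> mdist K u v"
        using le mdist_nonneg [OF M(1) wM] mdist_nonneg [OF wM M(2)] unfolding r_def by linarith+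
      have "- w = seg K u v r" using model_between(1) [OF M(1,2) wM False l le] by (simp add: r_def)
      then have "sn K (mdist K u v) *\<^sub>R (- w) = sn K (mdist K u v - r) *\<^sub>R u + sn K r *\<^sub>R v"
        using seg_scaled [OF S, of r] by simp
      then have "\<zeta> \<bullet> (sn K (mdist K u v) *\<^sub>R (- w)) = \<zeta> \<bullet> (sn K (mdist K u v - r) *\<^sub>R u + sn K r *\<^sub>R v)"
        by simp
      then have "- (sn K (mdist K u v) * (\<zeta> \<bullet> w)) = sn K (mdist K u v - r) * (\<zeta> \<bullet> u) + sn K r * (\<zeta> \<bullet> v)"
        by (simp add: inner_add_right)
      moreover have "0 < sn K (mdist K u v) * (\<zeta> \<bullet> w)"
        using sn_pos [OF mdist_pos [OF M(1,2) False] l] z by simp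
      moreover have "0 \<le> sn K (mdist K u v - r) * (\<zeta> \<bullet> u)" "0 \<le> sn K r * (\<zeta> \<bullet> v)"
        using r z by (auto intro!: mult_nonneg_nonneg sn_nonneg short_mono [OF l])
      ultimately show False by linarith
    qed
  qed
  then show ?thesis by (simp add: short_half_iff \<pi>'_def)
qed

section \<open>Linear algebra of the vertices: degenerate triangles and hemispheres\<close>

definition det3 :: "real^3 \<Rightarrow> real^3 \<Rightarrow> real^3 \<Rightarrow> real" where
  "det3 x y z = x \<bullet> cross3 y z"

text \<open>Cramer's rule; the cofactors are inner products with cross products.\<close>

lemma cross3_coordinates:
  "det3 x y z *\<^sub>R v = (v \<bullet> cross3 y z) *\<^sub>R x + (v \<bullet> cross3 z x) *\<^sub>R y + (v \<bullet> cross3 x y) *\<^sub>R z"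
  by (simp add: det3_def cross3_def vec_eq_iff forall_3 inner_vec_def sum_3) algebra

locale model_tri =
  fixes K :: real and o' a' b' :: "real^3"
  assumes M: "o' \<in> msp K" "a' \<in> msp K" "b' \<in> msp K"
    and ne: "o' \<noteq> a'" "o' \<noteq> b'"
    and per: "short K ((mdist K o' a' + mdist K a' b' + mdist K b' o') / 2)"
begin

abbreviation "h \<equiv> hom K"
abbreviation "\<Delta> \<equiv> cone_region K o' a' b'"
abbreviation "T \<equiv> model_triangle K o' a' b'"

text \<open>\<open>model_triangle_ineq\<close> presupposes a short side. A side of length
  \<open>pi / sqrt K\<close> joins antipodes, and the other two sides add up to it; in either case
  such a side would make the perimeter too large.\<close>

lemma sides_short: "short K (mdist K o' a')" "short K (mdist K a' b')" "short K (mdist K b' o')"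
proof -
  define \<pi>' where "\<pi>' = pi / sqrt K"
  have *: "x < \<pi>'" if "x + y + z < 2 * \<pi>'" "x \<le> \<pi>'" "\<pi>' \<le> y + z \<or> x \<le> y + z" for x y z :: real
    using that by linarith
  have "mdist K u v \<le> mdist K u w + mdist K w v \<or> pi / sqrt K \<le> mdist K u w + mdist K w v"
    if k: "K > 0" and M': "u \<in> msp K" "v \<in> msp K" "w \<in> msp K" for u v w
  proof (cases "short K (mdist K u v)")
    case True
    then show ?thesis using model_triangle_ineq [OF M' True] by simp
  next
    case False
    then have "mdist K u v = pi / sqrt K" using mdist_le [OF M'(1,2) k] by (simp add: short_def k)
    then have "mdist K u (- v) = 0" using mdist_minus [OF k M'(1,2)] by simp
    then have "u = - v" using mdist_eq_0 [OF M'(1) sphere_minus [OF k M'(2)]] by simp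
    then have "v = - u" by simp
    then have "mdist K w v = pi / sqrt K - mdist K w u" using mdist_minus [OF k M'(3,1)] by simp
    then show ?thesis by (simp add: mdist_commute [of K w u])
  qed
  note tri = this [unfolded \<pi>'_def [symmetric]]
  have "mdist K o' a' < \<pi>' \<and> mdist K a' b' < \<pi>' \<and> mdist K b' o' < \<pi>'" if k: "K > 0"
  proof -
    have P: "mdist K o' a' + mdist K a' b' + mdist K b' o' < 2 * \<pi>'"
      using per k by (simp add: short_half_iff \<pi>'_def)
    show ?thesis
      using P tri [OF k M(1,2,3)] tri [OF k M(2,3,1)] tri [OF k M(3,1,2)]
      by (simp add: mdist_commute [of K a' o'] mdist_commute [of K b' a'] mdist_commute [of K o' b'])
        linarith
  qed
  then show "short K (mdist K o' a')" "short K (mdist K a' b')" "short K (mdist K b' o')"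
    by (auto simp: short_def \<pi>'_def)
qed

lemma sides_short': "short K (mdist K a' o')" "short K (mdist K b' a')" "short K (mdist K o' b')"
  using sides_short by (simp_all add: mdist_commute)

text \<open>One vertex lies on the opposite side, in the language of cones. The case that
  \<open>a'\<close> and \<open>b'\<close> coincide is included.\<close>

definition degenerate :: bool where
  "degenerate \<longleftrightarrow> (\<exists>s t. 0 \<le> s \<and> 0 \<le> t \<and>
     (h o' = s *\<^sub>R h a' + t *\<^sub>R h b' \<or> h a' = s *\<^sub>R h o' + t *\<^sub>R h b' \<or> h b' = s *\<^sub>R h o' + t *\<^sub>R h a'))"

text \<open>Cramer's rule for the normal of the plane through \<open>h o'\<close> and
  \<open>h a'\<close> expresses \<open>h b'\<close> by these two; the signs of the coefficients tell
  which vertex is between the others. Combinations without a positive coefficient are excluded by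
  the perimeter bound.\<close>

lemma det_zero_degenerate:
  assumes "det3 (h o') (h a') (h b') = 0" shows degenerate
proof -
  define n where "n = cross3 (h o') (h a')"
  have "n \<noteq> 0"
  proof
    assume "n = 0"
    then have "collinear {0, h o', h a'}" by (simp add: n_def cross_eq_0)
    then obtain c where c: "h a' = c *\<^sub>R h o'"
      using hom_nonzero M by (auto simp: collinear_lemma)
    show False
    proof (cases "c > 0")
      case True
      then show False using hom_ray_unique [OF M(2,1) True c] ne by simp
    next
      case False
      then show False using not_antipodal [OF M(2,1) sides_short'(1), of "- c"] c by simp
    qed
  qed
  then have nn: "0 < n \<bullet> n" by simp
  define c\<^sub>1 c\<^sub>2 where c1: "c\<^sub>1 = - (n \<bullet> cross3 (h a') (h b')) / (n \<bullet> n)" and c2: "c\<^sub>2 = - (n \<bullet> cross3 (h b') (h o')) / (n \<bullet> n)"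
  have "(n \<bullet> n) *\<^sub>R h b' = (- (n \<bullet> cross3 (h a') (h b'))) *\<^sub>R h o' + (- (n \<bullet> cross3 (h b') (h o'))) *\<^sub>R h a'"
    using cross3_coordinates [of "h o'" "h a'" "h b'" n] assms
    by (simp add: n_def [symmetric] eq_neg_iff_add_eq_0 algebra_simps)
  then have hb: "h b' = c\<^sub>1 *\<^sub>R h o' + c\<^sub>2 *\<^sub>R h a'"
    unfolding c1 c2 by (rule scaleR_combination(1) [rotated]) (use nn in simp)
  consider "0 \<le> c\<^sub>1" "0 \<le> c\<^sub>2" | "c\<^sub>1 < 0" "0 < c\<^sub>2" | "c\<^sub>1 < 0" "c\<^sub>2 = 0" | "0 < c\<^sub>1" "c\<^sub>2 < 0" | "c\<^sub>1 = 0" "c\<^sub>2 < 0" | "c\<^sub>1 < 0" "c\<^sub>2 < 0"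
    by linarith
  then show ?thesis
  proof cases
    case 1
    then show ?thesis using hb unfolding degenerate_def by blast
  next
    case 2
    have "c\<^sub>2 *\<^sub>R h a' = (- c\<^sub>1) *\<^sub>R h o' + 1 *\<^sub>R h b'" using hb by simp
    then have "h a' = (- c\<^sub>1 / c\<^sub>2) *\<^sub>R h o' + (1 / c\<^sub>2) *\<^sub>R h b'"
      by (rule scaleR_combination(1) [rotated]) (use 2 in simp)
    moreover have "0 \<le> - c\<^sub>1 / c\<^sub>2" "0 \<le> 1 / c\<^sub>2" using 2 by (auto simp: divide_nonpos_pos)
    ultimately show ?thesis unfolding degenerate_def by blast
  next
    case 3
    then show ?thesis using not_antipodal [OF M(3,1) sides_short(3), of "- c\<^sub>1"] hb by simp
  next
    case 4
    have "c\<^sub>1 *\<^sub>R h o' = (- c\<^sub>2) *\<^sub>R h a' + 1 *\<^sub>R h b'" using hb by simp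
    then have "h o' = (- c\<^sub>2 / c\<^sub>1) *\<^sub>R h a' + (1 / c\<^sub>1) *\<^sub>R h b'"
      by (rule scaleR_combination(1) [rotated]) (use 4 in simp)
    moreover have "0 \<le> - c\<^sub>2 / c\<^sub>1" "0 \<le> 1 / c\<^sub>1" using 4 by (auto simp: divide_nonpos_pos)
    ultimately show ?thesis unfolding degenerate_def by blast
  next
    case 5
    then show ?thesis using not_antipodal [OF M(3,2) sides_short'(2), of "- c\<^sub>2"] hb by simp
  next
    \<comment> \<open>For \<open>K > 0\<close>, \<open>- b'\<close> would lie on the side from
      \<open>o'\<close> to \<open>a'\<close>, which makes the perimeter exactly
      \<open>2 * pi / sqrt K\<close>. For \<open>K \<le> 0\<close> the positive third coordinates
      forbid it.\<close>
    case 6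
    have False
    proof (cases "K > 0")
      case True
      note bM = sphere_minus [OF True M(3)]
      have "hom K (- b') = (- c\<^sub>1) *\<^sub>R hom K o' + (- c\<^sub>2) *\<^sub>R hom K a'" using hb True by (simp add: hom_def)
      then have "- b' \<in> between_set (msp K) (mdist K) o' a'"
        unfolding between_set_iff_cone [OF M(1,2) sides_short(1)] using 6 bM by (metis neg_0_le_iff_le less_imp_le)
      then have "mdist K o' a' = mdist K o' (- b') + mdist K (- b') a'" by (simp add: between_set_def)
      then have "mdist K o' a' + mdist K a' b' + mdist K b' o' = 2 * (pi / sqrt K)"
        using mdist_minus [OF True M(1,3)] mdist_minus [OF True M(2,3)]
        by (simp add: mdist_commute [of K "- b'"] mdist_commute [of K b'])
      then show False using per True unfolding short_half_iff by simp
    next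
      case False
      have "h b' $ 3 = c\<^sub>1 * h o' $ 3 + c\<^sub>2 * h a' $ 3" unfolding hb by simp
      moreover have "0 < h b' $ 3" "0 < h o' $ 3" "0 < h a' $ 3" using False M hom_nth3_pos by auto
      ultimately show False using 6 by (smt (verit) mult_neg_pos)
    qed
    then show ?thesis ..
  qed
qed

lemma inner_sum_pos:
  assumes k: "K > 0" and uv: "u \<in> msp K" "v \<in> msp K" "short K (mdist K u v)"
  shows "0 < (u + v) \<bullet> u" "0 < (u + v) \<bullet> v"
proof -
  have "K * (u \<bullet> v) \<noteq> - 1"
    using uv(3) k by (auto simp: short_def model_dist_def)
  then have c: "0 < 1 + K * (u \<bullet> v)" using sphere_bform [OF k uv(1,2)] by (simp add: abs_le_iff)
  have "K * (u \<bullet> u) = 1" "K * (v \<bullet> v) = 1"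
    using bform_self [of K u] bform_self [of K v] uv k by (auto simp: bform_nonneg_curv)
  then have "0 < K * ((u + v) \<bullet> u)" "0 < K * ((u + v) \<bullet> v)"
    using c by (simp_all add: inner_add_left distrib_left inner_commute [of v u])
  then show "0 < (u + v) \<bullet> u" "0 < (u + v) \<bullet> v" using k by (auto simp: zero_less_mult_iff)
qed

text \<open>For \<open>K \<le> 0\<close> the third axis works. For \<open>K > 0\<close> and
  independent vertices there is a vector with product 1 with each of them; a degenerate triangle
  lies on one of its sides, and the sum of the ends of that side serves.\<close>

lemma hemisphere:
  obtains \<zeta> where "0 < \<zeta> \<bullet> h o'" "0 < \<zeta> \<bullet> h a'" "0 < \<zeta> \<bullet> h b'"
proof (cases "K > 0")
  case False
  show ?thesis
    by (rule that [of "axis 3 1"]) (use False M hom_nth3_pos in \<open>auto simp: inner_axis'\<close>)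
next
  case True
  have hh: "h x = x" for x using True by (simp add: hom_def)
  define d where "d = det3 (h o') (h a') (h b')"
  show ?thesis
  proof (cases "d = 0")
    case False
    define \<zeta> where "\<zeta> = (1 / d) *\<^sub>R (cross3 (h a') (h b') + cross3 (h b') (h o') + cross3 (h o') (h a'))"
    have "h o' \<bullet> cross3 (h a') (h b') = d" "h a' \<bullet> cross3 (h b') (h o') = d" "h b' \<bullet> cross3 (h o') (h a') = d"
      by (simp_all add: d_def det3_def cross3_def inner_vec_def sum_3 algebra_simps)
    then have "\<zeta> \<bullet> h o' = 1" "\<zeta> \<bullet> h a' = 1" "\<zeta> \<bullet> h b' = 1"
      using False by (simp_all add: \<zeta>_def inner_add_left inner_commute [of "cross3 _ _"] dot_cross_self)
    then show ?thesis using that [of \<zeta>] by simp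
  next
    case d0: True
    have nn: "0 < \<zeta> \<bullet> h x" if "h x = s *\<^sub>R h u + t *\<^sub>R h v" "0 \<le> s" "0 \<le> t" "0 < \<zeta> \<bullet> h u" "0 < \<zeta> \<bullet> h v" "x \<in> msp K"
      for x u v s t \<zeta>
    proof -
      have "s \<noteq> 0 \<or> t \<noteq> 0" using that(1) hom_nonzero [OF that(6)] by auto
      then show ?thesis using that by (auto simp: inner_add_right intro: add_pos_nonneg add_nonneg_pos)
    qed
    obtain s t where st: "0 \<le> s" "0 \<le> t" and "h o' = s *\<^sub>R h a' + t *\<^sub>R h b' \<or> h a' = s *\<^sub>R h o' + t *\<^sub>R h b' \<or> h b' = s *\<^sub>R h o' + t *\<^sub>R h a'"
      using det_zero_degenerate d0 unfolding degenerate_def d_def by blast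
    then consider "h o' = s *\<^sub>R h a' + t *\<^sub>R h b'" | "h a' = s *\<^sub>R h o' + t *\<^sub>R h b'" | "h b' = s *\<^sub>R h o' + t *\<^sub>R h a'" by blast
    then show ?thesis
    proof cases
      case 1
      show ?thesis using that [of "a' + b'"] nn [OF 1 st] inner_sum_pos [OF True M(2,3) sides_short(2)] M by (simp add: hh)
    next
      case 2
      show ?thesis using that [of "o' + b'"] nn [OF 2 st] inner_sum_pos [OF True M(1,3) sides_short'(3)] M by (simp add: hh)
    next
      case 3
      show ?thesis using that [of "o' + a'"] nn [OF 3 st] inner_sum_pos [OF True M(1,2) sides_short(1)] M by (simp add: hh)
    qed
  qed
qed

end

section \<open>Topology of the region and of its complement\<close>

lemma closed_msp: "closed (msp K)"
proof -
  have bf: "continuous_on UNIV (\<lambda>x. bform K x x)"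
    unfolding bform_def by (intro continuous_intros)
  consider "K = 0" | "K > 0" | "K < 0" by linarith
  then show ?thesis
  proof cases
    case 1
    then have "msp K = {x. x$3 = 0}" by (auto simp: msp_iff)
    then show ?thesis by (simp add: closed_Collect_eq continuous_on_component)
  next
    case 2
    then show ?thesis by (simp add: model_space_def)
  next
    case 3
    \<comment> \<open>The height 0 does not occur on the quadric, so the strict inequality can be
      replaced by a closed condition.\<close>
    have "x$3 > 0" if "K * bform K x x = 1" "x$3 \<ge> 0" for x
    proof (rule ccontr)
      assume "\<not> x$3 > 0"
      with that have "x$3 = 0" by simp
      then have "bform K x x \<ge> 0" by (simp add: bform_def)
      then have "K * bform K x x \<le> 0" using 3 by (simp add: mult_nonpos_nonneg)
      with that show False by simp
    qed
    then have "msp K = {x. K * bform K x x = 1} \<inter> {x. 0 \<le> x$3}"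
      using 3 by (force simp: msp_iff)
    also have "closed \<dots>"
      by (intro closed_Int closed_Collect_eq closed_Collect_le continuous_intros bf)
    finally show ?thesis .
  qed
qed

lemma continuous_on_mdist:
  assumes x: "x \<in> msp K"
  shows "continuous_on (msp K) (mdist K x)"
proof -
  consider "K = 0" | "K > 0" | "K < 0" by linarith
  then show ?thesis
  proof cases
    case 1
    then show ?thesis unfolding model_dist_def [abs_def] by (auto intro!: continuous_intros)
  next
    case 2
    have "continuous_on (msp K) (\<lambda>y. arccos (K * (x \<bullet> y)) / sqrt K)"
      using sphere_bform [OF 2 x] 2
      by (intro continuous_on_divide continuous_on_arccos continuous_intros) (auto simp: abs_le_iff)
    then show ?thesis using 2 unfolding model_dist_def [abs_def] by simp
  next
    case 3
    have "continuous_on (msp K) (\<lambda>y. K * minkowski x y)"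
      unfolding minkowski_def by (intro continuous_intros)
    then have "continuous_on (msp K) (\<lambda>y. arcosh (K * minkowski x y))"
      using hyperboloid_bform(1) [OF 3 x] 3
      by (intro continuous_on_compose2 [OF continuous_on_arcosh [OF order_refl]]) (auto simp: bform_neg_curv)
    then have "continuous_on (msp K) (\<lambda>y. arcosh (K * minkowski x y) / sqrt (- K))"
      using 3 by (intro continuous_on_divide continuous_on_const) auto
    then show ?thesis using 3 unfolding model_dist_def [abs_def] by simp
  qed
qed

context model_tri
begin

lemma \<Delta>_model: "\<Delta> \<subseteq> msp K"
  by (auto simp: cone_region_def)

lemma vertices_\<Delta>: "o' \<in> \<Delta>" "a' \<in> \<Delta>" "b' \<in> \<Delta>"
  using M by (auto simp: cone_region_def cone3_vertices)

lemma \<Delta>_coords: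
  assumes "x \<in> \<Delta>"
  obtains \<alpha> \<beta> \<gamma> where "0 \<le> \<alpha>" "0 \<le> \<beta>" "0 \<le> \<gamma>" "h x = \<alpha> *\<^sub>R h o' + \<beta> *\<^sub>R h a' + \<gamma> *\<^sub>R h b'"
  using assms unfolding cone_region_def cone3_def by blast

lemma boundary_in_T:
  assumes x: "x \<in> msp K" and c: "0 \<le> \<alpha>" "0 \<le> \<beta>" "0 \<le> \<gamma>" "\<alpha> = 0 \<or> \<beta> = 0 \<or> \<gamma> = 0"
    and h: "h x = \<alpha> *\<^sub>R h o' + \<beta> *\<^sub>R h a' + \<gamma> *\<^sub>R h b'"
  shows "x \<in> T"
proof -
  consider "\<alpha> = 0" | "\<beta> = 0" | "\<gamma> = 0" using c by blast
  then show ?thesis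
  proof cases
    case 1
    then have "h x = \<beta> *\<^sub>R h a' + \<gamma> *\<^sub>R h b'" using h by simp
    then have "x \<in> between_set (msp K) (mdist K) a' b'"
      using between_set_iff_cone [OF M(2,3) sides_short(2)] x c by blast
    then show ?thesis by (simp add: model_triangle_def)
  next
    case 2
    then have "h x = \<gamma> *\<^sub>R h b' + \<alpha> *\<^sub>R h o'" using h by (simp add: add.commute)
    then have "x \<in> between_set (msp K) (mdist K) b' o'"
      using between_set_iff_cone [OF M(3,1) sides_short(3)] x c by blast
    then show ?thesis by (simp add: model_triangle_def)
  next
    case 3
    then have "h x = \<alpha> *\<^sub>R h o' + \<beta> *\<^sub>R h a'" using h by simp
    then have "x \<in> between_set (msp K) (mdist K) o' a'"
      using between_set_iff_cone [OF M(1,2) sides_short(1)] x c by blast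
    then show ?thesis by (simp add: model_triangle_def)
  qed
qed

lemma T_subset: "T \<subseteq> \<Delta>"
proof
  fix x assume "x \<in> T"
  then consider "x \<in> between_set (msp K) (mdist K) o' a'" | "x \<in> between_set (msp K) (mdist K) a' b'"
    | "x \<in> between_set (msp K) (mdist K) b' o'" unfolding model_triangle_def by blast
  then show "x \<in> \<Delta>"
  proof cases
    case 1
    then show ?thesis unfolding between_set_iff_cone [OF M(1,2) sides_short(1)]
      by (auto simp: cone_region_def intro!: cone3_add cone3_scale cone3_vertices)
  next
    case 2
    then show ?thesis unfolding between_set_iff_cone [OF M(2,3) sides_short(2)]
      by (auto simp: cone_region_def intro!: cone3_add cone3_scale cone3_vertices)
  next
    case 3
    then show ?thesis unfolding between_set_iff_cone [OF M(3,1) sides_short(3)]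
      by (auto simp: cone_region_def intro!: cone3_add cone3_scale cone3_vertices)
  qed
qed

lemma cone_inner_pos:
  assumes z: "0 < \<zeta> \<bullet> h o'" "0 < \<zeta> \<bullet> h a'" "0 < \<zeta> \<bullet> h b'"
    and v: "v \<in> cone3 K o' a' b'" "v \<noteq> 0"
  shows "0 < \<zeta> \<bullet> v"
proof -
  obtain \<alpha> \<beta> \<gamma> where c: "0 \<le> \<alpha>" "0 \<le> \<beta>" "0 \<le> \<gamma>" "v = \<alpha> *\<^sub>R h o' + \<beta> *\<^sub>R h a' + \<gamma> *\<^sub>R h b'"
    using v(1) unfolding cone3_def by blast
  then have "\<zeta> \<bullet> v = \<alpha> * (\<zeta> \<bullet> h o') + \<beta> * (\<zeta> \<bullet> h a') + \<gamma> * (\<zeta> \<bullet> h b')"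
    by (simp add: inner_add_right)
  moreover have "0 \<le> \<alpha> * (\<zeta> \<bullet> h o')" "0 \<le> \<beta> * (\<zeta> \<bullet> h a')" "0 \<le> \<gamma> * (\<zeta> \<bullet> h b')" using c z by auto
  moreover have "0 < \<alpha> * (\<zeta> \<bullet> h o') \<or> 0 < \<beta> * (\<zeta> \<bullet> h a') \<or> 0 < \<gamma> * (\<zeta> \<bullet> h b')"
    using c z v(2) by (auto simp: zero_less_mult_iff)
  ultimately show ?thesis by linarith
qed

text \<open>A vector with positive products with the vertices has positive products with the whole
  cone except 0, so one hemisphere serves for all triples.\<close>

lemma narrow_\<Delta>: "narrow K \<Delta>"
proof (cases "K > 0")
  case True
  have hh: "h x = x" for x using True by (simp add: hom_def)
  obtain \<zeta> where z: "0 < \<zeta> \<bullet> h o'" "0 < \<zeta> \<bullet> h a'" "0 < \<zeta> \<bullet> h b'" by (rule hemisphere)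
  have "0 < \<zeta> \<bullet> x" if "x \<in> \<Delta>" for x
    using cone_inner_pos [OF z, of x] that hom_nonzero [of x K] by (simp add: cone_region_def hh)
  then show ?thesis
    unfolding narrow_def using hemisphere_perimeter [OF True] \<Delta>_model by blast
qed (auto simp: narrow_def short_def cone_region_def)

text \<open>For the compactness of the region. The bound comes from the height for
  \<open>K = 0\<close>, from the hemisphere for \<open>K > 0\<close> and from the reverse
  Cauchy-Schwarz inequality for \<open>K < 0\<close>.\<close>

lemma coordinate_sum_bound:
  obtains C where "\<And>x \<alpha> \<beta> \<gamma>. x \<in> msp K \<Longrightarrow> 0 \<le> \<alpha> \<Longrightarrow> 0 \<le> \<beta> \<Longrightarrow> 0 \<le> \<gamma> \<Longrightarrow>
    h x = \<alpha> *\<^sub>R h o' + \<beta> *\<^sub>R h a' + \<gamma> *\<^sub>R h b' \<Longrightarrow> \<alpha> + \<beta> + \<gamma> \<le> C"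
proof -
  consider "K = 0" | "K > 0" | "K < 0" by linarith
  then show ?thesis
  proof cases
    case 1
    have "\<alpha> + \<beta> + \<gamma> \<le> 1" if "x \<in> msp K" "h x = \<alpha> *\<^sub>R h o' + \<beta> *\<^sub>R h a' + \<gamma> *\<^sub>R h b'" for x \<alpha> \<beta> \<gamma>
      using arg_cong [OF that(2), of "\<lambda>v. v$3"] hom_nth3 [OF 1] M that(1) by simp
    then show ?thesis using that by blast
  next
    case 2
    have hh: "h x = x" for x using 2 by (simp add: hom_def)
    obtain \<zeta> where z: "0 < \<zeta> \<bullet> h o'" "0 < \<zeta> \<bullet> h a'" "0 < \<zeta> \<bullet> h b'" by (rule hemisphere)
    define m where "m = min (\<zeta> \<bullet> h o') (min (\<zeta> \<bullet> h a') (\<zeta> \<bullet> h b'))"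
    have m: "0 < m" "m \<le> \<zeta> \<bullet> h o'" "m \<le> \<zeta> \<bullet> h a'" "m \<le> \<zeta> \<bullet> h b'" using z by (auto simp: m_def)
    have "\<alpha> + \<beta> + \<gamma> \<le> norm \<zeta> * (1 / sqrt K) / m"
      if "x \<in> msp K" "0 \<le> \<alpha>" "0 \<le> \<beta>" "0 \<le> \<gamma>" "h x = \<alpha> *\<^sub>R h o' + \<beta> *\<^sub>R h a' + \<gamma> *\<^sub>R h b'" for x \<alpha> \<beta> \<gamma>
    proof -
      have "m * (\<alpha> + \<beta> + \<gamma>) = \<alpha> * m + \<beta> * m + \<gamma> * m" by (simp add: algebra_simps)
      also have "\<dots> \<le> \<alpha> * (\<zeta> \<bullet> h o') + \<beta> * (\<zeta> \<bullet> h a') + \<gamma> * (\<zeta> \<bullet> h b')"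
        using that m by (intro add_mono mult_left_mono) auto
      also have "\<dots> = \<zeta> \<bullet> x" using that(5) by (simp add: hh inner_add_right)
      also have "\<dots> \<le> norm \<zeta> * norm x" by (rule norm_cauchy_schwarz)
      also have "norm x = 1 / sqrt K" using that(1) 2 by (simp add: model_space_def)
      finally show ?thesis by (simp only: pos_le_divide_eq [OF m(1)] mult.commute [of _ m])
    qed
    then show ?thesis using that by blast
  next
    case 3
    have hh: "h x = x" for x using 3 by (simp add: hom_def)
    have "\<alpha> + \<beta> + \<gamma> \<le> 1"
      if x: "x \<in> msp K" and c: "0 \<le> \<alpha>" "0 \<le> \<beta>" "0 \<le> \<gamma>" and hx: "h x = \<alpha> *\<^sub>R h o' + \<beta> *\<^sub>R h a' + \<gamma> *\<^sub>R h b'" for x \<alpha> \<beta> \<gamma>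
    proof -
      \<comment> \<open>\<open>B\<close> is at least 1 on pairs of points of the hyperboloid, so
        expanding \<open>B x x = 1\<close> bounds the square of the sum of the weights by 1.\<close>
      define B where "B = (\<lambda>u v. K * bform K u v)"
      have B_ge: "1 \<le> B u v" if "u \<in> msp K" "v \<in> msp K" for u v
        using hyperboloid_bform(1) [OF 3 that] by (simp add: B_def)
      have B_lin: "B (p + q) w = B p w + B q w" "B w (p + q) = B w p + B w q"
        "B (c *\<^sub>R p) w = c * B p w" "B w (c *\<^sub>R p) = c * B w p" for p q w c
        by (simp_all add: B_def distrib_left)
      have B_sym: "B a' o' = B o' a'" "B b' o' = B o' b'" "B b' a' = B a' b'"
        by (simp_all add: B_def bform_commute)
      have x_eq: "x = \<alpha> *\<^sub>R o' + \<beta> *\<^sub>R a' + \<gamma> *\<^sub>R b'" using hx by (simp add: hh)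
      have "1 = B x x" using bform_self [of K x] 3 x by (simp add: B_def)
      also have "B x x = \<alpha> * \<alpha> * B o' o' + \<beta> * \<beta> * B a' a' + \<gamma> * \<gamma> * B b' b'
         + 2 * (\<alpha> * \<beta>) * B o' a' + 2 * (\<alpha> * \<gamma>) * B o' b' + 2 * (\<beta> * \<gamma>) * B a' b'"
        unfolding x_eq B_lin B_sym by (simp add: algebra_simps)
      finally have one: "1 = \<dots>" .
      have ge: "c * 1 \<le> c * B u v" if "0 \<le> c" "u \<in> msp K" "v \<in> msp K" for c u v
        using that B_ge by (intro mult_left_mono) auto
      have "(\<alpha> + \<beta> + \<gamma>)\<^sup>2 = \<alpha> * \<alpha> * 1 + \<beta> * \<beta> * 1 + \<gamma> * \<gamma> * 1 + 2 * (\<alpha> * \<beta>) * 1 + 2 * (\<alpha> * \<gamma>) * 1 + 2 * (\<beta> * \<gamma>) * 1"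
        by (simp add: power2_eq_square algebra_simps)
      also have "\<dots> \<le> \<alpha> * \<alpha> * B o' o' + \<beta> * \<beta> * B a' a' + \<gamma> * \<gamma> * B b' b'
         + 2 * (\<alpha> * \<beta>) * B o' a' + 2 * (\<alpha> * \<gamma>) * B o' b' + 2 * (\<beta> * \<gamma>) * B a' b'"
        using c M by (intro add_mono ge) auto
      also note one [symmetric]
      finally have "(\<alpha> + \<beta> + \<gamma>)\<^sup>2 \<le> 1\<^sup>2" by simp
      then show ?thesis by (rule power2_le_imp_le) simp
    qed
    then show ?thesis using that by blast
  qed
qed

lemma compact_\<Delta>: "compact \<Delta>"
proof -
  obtain C where C: "\<And>x \<alpha> \<beta> \<gamma>. x \<in> msp K \<Longrightarrow> 0 \<le> \<alpha> \<Longrightarrow> 0 \<le> \<beta> \<Longrightarrow> 0 \<le> \<gamma> \<Longrightarrow>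
    h x = \<alpha> *\<^sub>R h o' + \<beta> *\<^sub>R h a' + \<gamma> *\<^sub>R h b' \<Longrightarrow> \<alpha> + \<beta> + \<gamma> \<le> C"
    by (rule coordinate_sum_bound) blast
  define N where "N = norm (h o') + norm (h a') + norm (h b')"
  have "norm x \<le> C * N + 1" if xD: "x \<in> \<Delta>" for x
  proof -
    obtain \<alpha> \<beta> \<gamma> where c: "0 \<le> \<alpha>" "0 \<le> \<beta>" "0 \<le> \<gamma>" "h x = \<alpha> *\<^sub>R h o' + \<beta> *\<^sub>R h a' + \<gamma> *\<^sub>R h b'"
      using xD by (rule \<Delta>_coords)
    have le: "\<alpha> + \<beta> + \<gamma> \<le> C" using C c xD \<Delta>_model by blast
    have "norm (h x) \<le> norm (\<alpha> *\<^sub>R h o') + norm (\<beta> *\<^sub>R h a') + norm (\<gamma> *\<^sub>R h b')"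
      unfolding c(4) by (intro norm_triangle_le add_right_mono norm_triangle_ineq)
    also have "\<dots> = \<alpha> * norm (h o') + \<beta> * norm (h a') + \<gamma> * norm (h b')" using c by simp
    also have "\<dots> \<le> C * norm (h o') + C * norm (h a') + C * norm (h b')"
      using c le by (intro add_mono mult_right_mono) auto
    finally have "norm (h x) \<le> C * N" by (simp add: N_def algebra_simps)
    moreover have "norm x \<le> norm (h x) + 1"
      using norm_triangle_ineq4 [of "h x" "axis 3 1"] by (auto simp: hom_def norm_axis_1)
    ultimately show ?thesis by simp
  qed
  then have "bounded \<Delta>" unfolding bounded_iff by blast
  moreover have "closed \<Delta>"
  proof -
    have "continuous_on UNIV h" unfolding hom_def [abs_def] by (cases "K = 0") (auto intro!: continuous_intros)
    then have "closed (h -` cone3 K o' a' b')"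
      by (intro continuous_closed_vimage closed_cone3) (simp add: continuous_on_eq_continuous_at)
    moreover have "\<Delta> = msp K \<inter> h -` cone3 K o' a' b'" by (auto simp: cone_region_def)
    ultimately show ?thesis using closed_msp by auto
  qed
  ultimately show ?thesis by (simp add: compact_eq_bounded_closed)
qed

text \<open>Outside the region one can move away from \<open>o'\<close> along a geodesic without entering the region: to
  infinity if \<open>K \<le> 0\<close>, and to the antipode of \<open>o'\<close> if \<open>K > 0\<close>.\<close>

lemma outside_nonpos:
  assumes k: "K \<le> 0" and x: "x \<in> msp K - \<Delta>" and z: "z \<in> msp K"
  shows "\<not> connected_component_set (msp K - T) x \<subseteq> {y \<in> msp K. mdist K z y < r}"
proof
  assume sub: "connected_component_set (msp K - T) x \<subseteq> {y \<in> msp K. mdist K z y < r}"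
  have sh: "short K s" for s using k by (simp add: short_def)
  have ne: "o' \<noteq> x" using x vertices_\<Delta> by auto
  have xM: "x \<in> msp K" using x by simp
  note S = short_S_nonzero [OF M(1) xM ne sh]
  define l where "l = mdist K o' x"
  have lpos: "0 < l" using mdist_pos [OF M(1) xM ne] by (simp add: l_def)
  \<comment> \<open>Far enough from \<open>o'\<close> to be outside the ball of radius
    \<open>r\<close> around \<open>z\<close>.\<close>
  define R where "R = max l (mdist K o' z + r)"
  define A where "A = seg K o' x ` {l..R}"
  have "continuous_on {l..R} (seg K o' x)"
    unfolding seg_def [abs_def] using S by (intro continuous_intros) auto
  then have "connected A" unfolding A_def by (intro connected_continuous_image) auto
  moreover have "x \<in> A" using seg_end [OF S] by (force simp: A_def R_def l_def)
  moreover have "A \<subseteq> msp K - T"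
  proof
    fix y assume "y \<in> A"
    then obtain s where s: "l \<le> s" "y = seg K o' x s" by (auto simp: A_def)
    have yM: "y \<in> msp K" unfolding s(2) by (rule seg_in_model [OF M(1) xM S])
    have "y \<notin> \<Delta>"
    proof
      assume "y \<in> \<Delta>"
      then have "h y \<in> cone3 K o' a' b'" by (simp add: cone_region_def)
      moreover have "sn K l *\<^sub>R h y = sn K (l - s) *\<^sub>R h o' + sn K s *\<^sub>R h x"
        unfolding s(2) l_def by (rule hom_seg [OF S])
      \<comment> \<open>Beyond \<open>x\<close> the weight of \<open>o'\<close> is negative. Brought
        to the other side, it shows \<open>x\<close> between \<open>o'\<close> and \<open>y\<close>,
        so a cone containing \<open>y\<close> would contain \<open>x\<close>.\<close>
      then have "sn K s *\<^sub>R h x = sn K l *\<^sub>R h y + sn K (s - l) *\<^sub>R h o'"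
        using sn_minus [of K "s - l"] by simp
      ultimately have "sn K s *\<^sub>R h x \<in> cone3 K o' a' b'"
        using s lpos sh by (auto intro!: cone3_add cone3_scale cone3_vertices sn_nonneg)
      then have "h x \<in> cone3 K o' a' b'"
        using s lpos sh by (auto intro!: sn_pos elim!: cone3_scaleD)
      then show False using x by (simp add: cone_region_def)
    qed
    then show "y \<in> msp K - T" using yM T_subset by blast
  qed
  ultimately have "A \<subseteq> connected_component_set (msp K - T) x"
    by (intro connected_component_maximal)
  moreover have "seg K o' x R \<in> A" by (auto simp: A_def R_def)
  ultimately have y: "seg K o' x R \<in> msp K" "mdist K z (seg K o' x R) < r"
    using sub by auto
  have "mdist K o' (seg K o' x R) = R"
    using lpos k by (intro mdist_seg [OF M(1) xM S]) (auto simp: R_def)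
  then have "R \<le> mdist K o' z + mdist K z (seg K o' x R)"
    using model_triangle_ineq [OF M(1) y(1) z sh] by simp
  then show False using y(2) by (simp add: R_def)
qed

lemma antipode_in_component:
  assumes k: "K > 0" and x: "x \<in> msp K - \<Delta>"
  shows "- o' \<in> connected_component_set (msp K - T) x"
proof -
  have hh: "h x = x" for x using k by (simp add: hom_def)
  obtain \<zeta> where z: "0 < \<zeta> \<bullet> h o'" "0 < \<zeta> \<bullet> h a'" "0 < \<zeta> \<bullet> h b'" by (rule hemisphere)
  have xK: "x \<notin> cone3 K o' a' b'" and xM: "x \<in> msp K" using x by (auto simp: cone_region_def hh)
  \<comment> \<open>The straight line from \<open>- o'\<close> at \<open>t = 0\<close> to
    \<open>x\<close> at \<open>t = 1\<close>, later projected to the sphere. If it met the cone at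
    some \<open>t > 0\<close>, adding a multiple of \<open>o'\<close> would put \<open>x\<close>
    into the cone; at \<open>t = 0\<close> the hemisphere forbids it.\<close>
  define v where "v = (\<lambda>t. t *\<^sub>R x - (1 - t) *\<^sub>R o')"
  have v: "v t \<notin> cone3 K o' a' b'" if t: "t \<in> {0..1}" for t
  proof
    assume vt: "v t \<in> cone3 K o' a' b'"
    show False
    proof (cases "t = 0")
      case True
      then have "- o' \<in> cone3 K o' a' b'" using vt by (simp add: v_def)
      moreover have "- o' \<noteq> 0" using hom_nonzero [OF M(1)] by (simp add: hh)
      ultimately show False using cone_inner_pos [OF z, of "- o'"] z(1) by (simp add: hh)
    next
      case False
      have "v t + (1 - t) *\<^sub>R h o' \<in> cone3 K o' a' b'"
        using vt t by (auto intro!: cone3_add cone3_scale cone3_vertices)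
      then have "t *\<^sub>R x \<in> cone3 K o' a' b'" by (simp add: v_def hh)
      then show False using cone3_scaleD [of t x] xK False t by auto
    qed
  qed
  have "0 \<in> cone3 K o' a' b'" using cone3_scale [OF cone3_vertices(1), of 0] by simp
  then have vn: "v t \<noteq> 0" if "t \<in> {0..1}" for t using v [OF that] by auto
  define A where "A = (\<lambda>t. (1 / (sqrt K * norm (v t))) *\<^sub>R v t) ` {0..1}"
  have "continuous_on {0..1} (\<lambda>t. (1 / (sqrt K * norm (v t))) *\<^sub>R v t)"
    unfolding v_def using vn [unfolded v_def] k by (intro continuous_intros) auto
  then have "connected A" unfolding A_def by (intro connected_continuous_image) auto
  moreover have n: "norm x = 1 / sqrt K" "norm o' = 1 / sqrt K" using xM M k by (auto simp: model_space_def)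
  have "x \<in> A" unfolding A_def by (rule image_eqI [of _ _ 1]) (use n k in \<open>auto simp: v_def\<close>)
  moreover have oA: "- o' \<in> A" unfolding A_def by (rule image_eqI [of _ _ 0]) (use n k in \<open>auto simp: v_def\<close>)
  moreover have "A \<subseteq> msp K - T"
  proof
    fix y assume "y \<in> A"
    then obtain t where t: "t \<in> {0..1}" "y = (1 / (sqrt K * norm (v t))) *\<^sub>R v t" by (auto simp: A_def)
    have yM: "y \<in> msp K" using vn [OF t(1)] k unfolding t(2) by (simp add: model_space_def)
    have "y \<notin> \<Delta>"
    proof
      assume "y \<in> \<Delta>"
      then have "y \<in> cone3 K o' a' b'" by (simp add: cone_region_def hh)
      then have "v t \<in> cone3 K o' a' b'" unfolding t(2) by (rule cone3_scaleD) (use vn [OF t(1)] k in auto)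
      then show False using v [OF t(1)] by simp
    qed
    then show "y \<in> msp K - T" using yM T_subset by blast
  qed
  ultimately have "A \<subseteq> connected_component_set (msp K - T) x"
    by (intro connected_component_maximal)
  then show ?thesis using oA by blast
qed

text \<open>All points outside the region share the component of \<open>- o'\<close>, so this
  component contains the great circle orthogonal to \<open>\<zeta>\<close>. That circle contains
  antipodes \<open>w\<close> and \<open>- w\<close>, and no open ball of radius at most
  \<open>pi / (2 * sqrt K)\<close> contains both.\<close>

lemma outside_pos:
  assumes k: "K > 0" and x: "x \<in> msp K - \<Delta>" and z: "z \<in> msp K" and r: "r \<le> pi / (2 * sqrt K)"
  shows "\<not> connected_component_set (msp K - T) x \<subseteq> {y \<in> msp K. mdist K z y < r}"
proof
  assume sub: "connected_component_set (msp K - T) x \<subseteq> {y \<in> msp K. mdist K z y < r}"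
  have hh: "h x = x" for x using k by (simp add: hom_def)
  obtain \<zeta> where ze: "0 < \<zeta> \<bullet> h o'" "0 < \<zeta> \<bullet> h a'" "0 < \<zeta> \<bullet> h b'" by (rule hemisphere)
  obtain e :: "real^3" where e: "e \<noteq> 0" "orthogonal \<zeta> e"
    using orthogonal_to_vector_exists [of \<zeta>] by auto
  define w where "w = (1 / (sqrt K * norm e)) *\<^sub>R e"
  have w: "w \<in> msp K" "\<zeta> \<bullet> w = 0" "w \<noteq> 0" using e k by (auto simp: w_def model_space_def orthogonal_def)
  have comp: "y \<in> connected_component_set (msp K - T) x" if y: "y \<in> msp K" "\<zeta> \<bullet> y = 0" for y
  proof -
    have "y \<in> msp K - \<Delta>"
      using cone_inner_pos [OF ze, of y] y hom_nonzero [OF y(1)] by (auto simp: cone_region_def hh)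
    then have "- o' \<in> connected_component_set (msp K - T) y" by (rule antipode_in_component [OF k])
    moreover have "- o' \<in> connected_component_set (msp K - T) x" by (rule antipode_in_component [OF k x])
    ultimately show ?thesis
      by (metis connected_component_sym connected_component_trans mem_Collect_eq)
  qed
  have pos: "0 < K * (z \<bullet> y)" if y: "y \<in> msp K" "\<zeta> \<bullet> y = 0" for y
  proof (rule ccontr)
    assume "\<not> ?thesis"
    then have "arccos 0 \<le> arccos (K * (z \<bullet> y))"
      using sphere_bform [OF k z y(1)] by (intro arccos_le_arccos) auto
    then have "arccos 0 / sqrt K \<le> arccos (K * (z \<bullet> y)) / sqrt K" using k by (intro divide_right_mono) auto
    then have "pi / (2 * sqrt K) \<le> mdist K z y" using k by (simp add: model_dist_def)
    moreover have "mdist K z y < r" using sub comp [OF y] by blast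
    ultimately show False using r by simp
  qed
  show False using pos [OF w(1,2)] pos [OF sphere_minus [OF k w(1)]] w(2) by simp
qed

text \<open>The weight of a vertex by Cramer's rule; \<open>u\<close> and \<open>v\<close> are the
  two other lifted vertices in cyclic order.\<close>

definition coord :: "real^3 \<Rightarrow> real^3 \<Rightarrow> real^3 \<Rightarrow> real" where
  "coord u v y = (h y \<bullet> cross3 u v) / det3 (h o') (h a') (h b')"

lemma coord_eq:
  assumes d: "det3 (h o') (h a') (h b') \<noteq> 0" and y: "h y = \<alpha> *\<^sub>R h o' + \<beta> *\<^sub>R h a' + \<gamma> *\<^sub>R h b'"
  shows "coord (h a') (h b') y = \<alpha>" "coord (h b') (h o') y = \<beta>" "coord (h o') (h a') y = \<gamma>"
proof -
  have "h o' \<bullet> cross3 (h a') (h b') = det3 (h o') (h a') (h b')" "h a' \<bullet> cross3 (h b') (h o') = det3 (h o') (h a') (h b')"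
    "h b' \<bullet> cross3 (h o') (h a') = det3 (h o') (h a') (h b')"
    by (simp_all add: det3_def cross3_def inner_vec_def sum_3 algebra_simps)
  then show "coord (h a') (h b') y = \<alpha>" "coord (h b') (h o') y = \<beta>" "coord (h o') (h a') y = \<gamma>"
    using d unfolding coord_def y by (simp_all add: inner_add_left dot_cross_self)
qed

lemma coord_expansion:
  assumes d: "det3 (h o') (h a') (h b') \<noteq> 0"
  shows "h y = coord (h a') (h b') y *\<^sub>R h o' + coord (h b') (h o') y *\<^sub>R h a' + coord (h o') (h a') y *\<^sub>R h b'"
  unfolding coord_def using cross3_coordinates [of "h o'" "h a'" "h b'" "h y"] by (rule scaleR_combination(2) [OF d])

lemma continuous_coord: "continuous_on UNIV (coord u v)"
proof -
  have "continuous_on UNIV h" unfolding hom_def [abs_def] by (cases "K = 0") (auto intro!: continuous_intros)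
  then show ?thesis unfolding coord_def [abs_def] divide_inverse by (intro continuous_intros)
qed

text \<open>A point off the triangle has either three positive weights or a negative one, since
  nonnegative weights with a zero among them give boundary points. Both conditions are open, so a
  component cannot change between them.\<close>

lemma inside_component:
  assumes d: "det3 (h o') (h a') (h b') \<noteq> 0" and x: "x \<in> \<Delta> - T"
  shows "connected_component_set (msp K - T) x \<subseteq> \<Delta>"
proof -
  define c1 c2 c3 where "c1 = coord (h a') (h b')" and "c2 = coord (h b') (h o')" and "c3 = coord (h o') (h a')"
  have D_iff: "y \<in> \<Delta> \<longleftrightarrow> 0 \<le> c1 y \<and> 0 \<le> c2 y \<and> 0 \<le> c3 y" if "y \<in> msp K" for y
  proof
    assume "y \<in> \<Delta>"
    then obtain \<alpha> \<beta> \<gamma> where "0 \<le> \<alpha>" "0 \<le> \<beta>" "0 \<le> \<gamma>" "h y = \<alpha> *\<^sub>R h o' + \<beta> *\<^sub>R h a' + \<gamma> *\<^sub>R h b'"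
      by (rule \<Delta>_coords)
    then show "0 \<le> c1 y \<and> 0 \<le> c2 y \<and> 0 \<le> c3 y" using coord_eq [OF d] by (simp add: c1_def c2_def c3_def)
  next
    assume "0 \<le> c1 y \<and> 0 \<le> c2 y \<and> 0 \<le> c3 y"
    then show "y \<in> \<Delta>" using that coord_expansion [OF d, of y]
      unfolding cone_region_def cone3_def c1_def c2_def c3_def by blast
  qed
  have T_if: "y \<in> T" if "y \<in> msp K" "0 \<le> c1 y" "0 \<le> c2 y" "0 \<le> c3 y" "c1 y = 0 \<or> c2 y = 0 \<or> c3 y = 0" for y
    using boundary_in_T [OF that(1) that(2-5)] coord_expansion [OF d, of y] by (simp add: c1_def c2_def c3_def)
  define U where "U = {y. 0 < c1 y} \<inter> {y. 0 < c2 y} \<inter> {y. 0 < c3 y}"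
  define V where "V = {y. c1 y < 0} \<union> {y. c2 y < 0} \<union> {y. c3 y < 0}"
  define A where "A = connected_component_set (msp K - T) x"
  have "open U" "open V"
    unfolding U_def V_def c1_def c2_def c3_def
    by (intro open_Int open_Un open_Collect_less continuous_coord continuous_on_const)+
  moreover have "connected A" by (simp add: A_def)
  moreover have AM: "A \<subseteq> msp K - T" unfolding A_def by (rule connected_component_subset)
  have "A \<subseteq> U \<union> V"
  proof
    fix y assume "y \<in> A"
    then have "y \<in> msp K" "y \<notin> T" using AM by auto
    then show "y \<in> U \<union> V" using T_if [of y] unfolding U_def V_def by fastforce
  qed
  moreover have "U \<inter> V \<inter> A = {}" by (auto simp: U_def V_def)
  ultimately have "U \<inter> A = {} \<or> V \<inter> A = {}" using connectedD by blast
  moreover have "x \<in> A" using x \<Delta>_model by (auto simp: A_def)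
  moreover have "x \<notin> V" using x D_iff [of x] \<Delta>_model by (auto simp: V_def)
  ultimately have "V \<inter> A = {}" using \<open>A \<subseteq> U \<union> V\<close> by blast
  then show ?thesis using \<open>A \<subseteq> U \<union> V\<close> AM D_iff unfolding A_def [symmetric] by (fastforce simp: U_def)
qed

lemma \<Delta>_in_ball:
  "\<exists>z \<in> msp K. \<exists>r. (K > 0 \<longrightarrow> r \<le> pi / (2 * sqrt K)) \<and> \<Delta> \<subseteq> {y \<in> msp K. mdist K z y < r}"
proof (cases "K > 0")
  case True
  have hh: "h x = x" for x using True by (simp add: hom_def)
  obtain \<zeta> where ze: "0 < \<zeta> \<bullet> h o'" "0 < \<zeta> \<bullet> h a'" "0 < \<zeta> \<bullet> h b'" by (rule hemisphere)
  have z0: "\<zeta> \<noteq> 0" using ze by auto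
  define z where "z = (1 / (sqrt K * norm \<zeta>)) *\<^sub>R \<zeta>"
  have zM: "z \<in> msp K" using z0 True by (simp add: z_def model_space_def)
  have "mdist K z y < pi / (2 * sqrt K)" if "y \<in> \<Delta>" for y
  proof -
    have yM: "y \<in> msp K" using that \<Delta>_model by blast
    have "0 < \<zeta> \<bullet> y" using cone_inner_pos [OF ze, of y] that hom_nonzero [OF yM] by (simp add: cone_region_def hh)
    then have "0 < K * (z \<bullet> y)" using True z0 by (simp add: z_def)
    then have "arccos (K * (z \<bullet> y)) < arccos 0"
      using sphere_bform [OF True zM yM] by (intro arccos_less_arccos) auto
    then show ?thesis using True by (simp add: model_dist_def divide_simps)
  qed
  then show ?thesis using zM \<Delta>_model by blast
next
  case False
  have "compact (mdist K o' ` \<Delta>)"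
    using continuous_on_subset [OF continuous_on_mdist [OF M(1)] \<Delta>_model] compact_\<Delta>
    by (rule compact_continuous_image)
  then have "bounded (mdist K o' ` \<Delta>)" by (rule compact_imp_bounded)
  then obtain B where "\<forall>x\<in>mdist K o' ` \<Delta>. norm x \<le> B"
    unfolding bounded_iff by (rule exE)
  then have "\<Delta> \<subseteq> {y \<in> msp K. mdist K o' y < B + 1}"
    using \<Delta>_model by fastforce
  then show ?thesis using M(1) False by blast
qed

lemma degenerate_T: "degenerate \<Longrightarrow> \<Delta> \<subseteq> T"
proof
  fix x assume "degenerate" "x \<in> \<Delta>"
  then obtain s t where st: "0 \<le> s" "0 \<le> t" and
    "h o' = s *\<^sub>R h a' + t *\<^sub>R h b' \<or> h a' = s *\<^sub>R h o' + t *\<^sub>R h b' \<or> h b' = s *\<^sub>R h o' + t *\<^sub>R h a'"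
    unfolding degenerate_def by blast
  then consider "h o' = s *\<^sub>R h a' + t *\<^sub>R h b'" | "h a' = s *\<^sub>R h o' + t *\<^sub>R h b'" | "h b' = s *\<^sub>R h o' + t *\<^sub>R h a'" by blast
  note cases = this
  obtain \<alpha> \<beta> \<gamma> where c: "0 \<le> \<alpha>" "0 \<le> \<beta>" "0 \<le> \<gamma>" "h x = \<alpha> *\<^sub>R h o' + \<beta> *\<^sub>R h a' + \<gamma> *\<^sub>R h b'"
    using \<open>x \<in> \<Delta>\<close> by (rule \<Delta>_coords)
  have xM: "x \<in> msp K" using \<open>x \<in> \<Delta>\<close> \<Delta>_model by blast
  from cases show "x \<in> T"
  proof cases
    case 1
    have "h x = 0 *\<^sub>R h o' + (\<alpha> * s + \<beta>) *\<^sub>R h a' + (\<alpha> * t + \<gamma>) *\<^sub>R h b'"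
      unfolding c(4) 1 by (simp add: algebra_simps)
    from boundary_in_T [OF xM _ _ _ _ this] show ?thesis using c st by auto
  next
    case 2
    have "h x = (\<beta> * s + \<alpha>) *\<^sub>R h o' + 0 *\<^sub>R h a' + (\<beta> * t + \<gamma>) *\<^sub>R h b'"
      unfolding c(4) 2 by (simp add: algebra_simps)
    from boundary_in_T [OF xM _ _ _ _ this] show ?thesis using c st by auto
  next
    case 3
    have "h x = (\<gamma> * s + \<alpha>) *\<^sub>R h o' + (\<gamma> * t + \<beta>) *\<^sub>R h a' + 0 *\<^sub>R h b'"
      unfolding c(4) 3 by (simp add: algebra_simps)
    from boundary_in_T [OF xM _ _ _ _ this] show ?thesis using c st by auto
  qed
qed

lemma model_region_eq: "model_region K o' a' b' = \<Delta>"
proof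
  show "model_region K o' a' b' \<subseteq> \<Delta>"
  proof
    fix x assume x: "x \<in> model_region K o' a' b'"
    show "x \<in> \<Delta>"
    proof (rule ccontr)
      assume xD: "x \<notin> \<Delta>"
      then have "x \<notin> T" using T_subset by blast
      then obtain z r where *: "x \<in> msp K" "z \<in> msp K" "K > 0 \<longrightarrow> r \<le> pi / (2 * sqrt K)"
        "connected_component_set (msp K - T) x \<subseteq> {y \<in> msp K. mdist K z y < r}"
        using x unfolding model_region_def by blast
      then show False
        using outside_pos [of x z r] outside_nonpos [of x z r] xD by (cases "K > 0") auto
    qed
  qed
  show "\<Delta> \<subseteq> model_region K o' a' b'"
  proof
    fix x assume x: "x \<in> \<Delta>"
    show "x \<in> model_region K o' a' b'"
    proof (cases "x \<in> T")
      case False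
      then have "det3 (h o') (h a') (h b') \<noteq> 0" using degenerate_T det_zero_degenerate x by blast
      then have "connected_component_set (msp K - T) x \<subseteq> \<Delta>" using inside_component x False by blast
      moreover obtain z r where "z \<in> msp K" "K > 0 \<longrightarrow> r \<le> pi / (2 * sqrt K)"
        "\<Delta> \<subseteq> {y \<in> msp K. mdist K z y < r}" using \<Delta>_in_ball by blast
      ultimately show ?thesis using x \<Delta>_model False unfolding model_region_def by blast
    qed (simp add: model_region_def)
  qed
qed

end

section \<open>Filling the triangle\<close>

lemma seg_weights:
  assumes M: "u \<in> msp K" "v \<in> msp K" and ne: "u \<noteq> v" and l: "short K (mdist K u v)"
    and r: "0 < r" "r < mdist K u v"
  obtains s t where "0 < s" "0 < t" "hom K (seg K u v r) = s *\<^sub>R hom K u + t *\<^sub>R hom K v"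
proof -
  define S where "S = sn K (mdist K u v)"
  have S: "0 < S" using sn_pos [OF mdist_pos [OF M ne] l] by (simp add: S_def)
  have "S *\<^sub>R hom K (seg K u v r) = sn K (mdist K u v - r) *\<^sub>R hom K u + sn K r *\<^sub>R hom K v"
    using hom_seg [of K u v r] S by (simp add: S_def)
  then have "hom K (seg K u v r) = (sn K (mdist K u v - r) / S) *\<^sub>R hom K u + (sn K r / S) *\<^sub>R hom K v"
    by (rule scaleR_combination(1) [rotated]) (use S in simp)
  moreover have "0 < sn K (mdist K u v - r) / S" "0 < sn K r / S"
    using r S by (auto intro!: divide_pos_pos sn_pos short_mono [OF l])
  ultimately show ?thesis using that by blast
qed

section \<open>Constructing points of the region from weights\<close>

context model_tri
begin

text \<open>The combination is nonzero because of the hemisphere, and its ray meets the surface: for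
  \<open>K \<le> 0\<close> the set \<open>visible K\<close> is closed under addition, for
  \<open>K > 0\<close> every nonzero vector is visible.\<close>

lemma point_of_weights:
  assumes c: "0 \<le> \<alpha>" "0 \<le> \<beta>" "0 \<le> \<gamma>" "0 < \<alpha> + \<beta> + \<gamma>"
  obtains t x where "0 < t" "x \<in> \<Delta>" "\<alpha> *\<^sub>R h o' + \<beta> *\<^sub>R h a' + \<gamma> *\<^sub>R h b' = t *\<^sub>R h x"
proof -
  let ?v = "\<alpha> *\<^sub>R h o' + \<beta> *\<^sub>R h a' + \<gamma> *\<^sub>R h b'"
  have vK: "?v \<in> cone3 K o' a' b'" using c unfolding cone3_def by blast
  have v0: "?v \<noteq> 0"
  proof
    assume v: "?v = 0"
    obtain \<zeta> where z: "0 < \<zeta> \<bullet> h o'" "0 < \<zeta> \<bullet> h a'" "0 < \<zeta> \<bullet> h b'" by (rule hemisphere)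
    have "\<alpha> * (\<zeta> \<bullet> h o') + \<beta> * (\<zeta> \<bullet> h a') + \<gamma> * (\<zeta> \<bullet> h b') = \<zeta> \<bullet> ?v" by (simp add: inner_add_right)
    also have "\<dots> = 0" unfolding v by simp
    finally have sum: "\<alpha> * (\<zeta> \<bullet> h o') + \<beta> * (\<zeta> \<bullet> h a') + \<gamma> * (\<zeta> \<bullet> h b') = 0" .
    have "0 \<le> \<alpha> * (\<zeta> \<bullet> h o')" "0 \<le> \<beta> * (\<zeta> \<bullet> h a')" "0 \<le> \<gamma> * (\<zeta> \<bullet> h b')" using c z by auto
    with sum have "\<alpha> * (\<zeta> \<bullet> h o') = 0" "\<beta> * (\<zeta> \<bullet> h a') = 0" "\<gamma> * (\<zeta> \<bullet> h b') = 0" by linarith+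
    then show False using c z by auto
  qed
  have "?v \<in> visible K"
  proof (cases "K > 0")
    case True
    then show ?thesis using v0 by (simp add: visible_def)
  next
    case False
    define W where "W = insert 0 (visible K)"
    have add: "p + q \<in> W" if "p \<in> W" "q \<in> W" for p q
      using that visible_add [of K p q] False by (auto simp: W_def)
    have sc: "t *\<^sub>R h x \<in> W" if "0 \<le> t" "x \<in> msp K" for t x
      using visible_scale [OF visible_hom [OF that(2)], of t] that by (cases "t = 0") (auto simp: W_def)
    have "?v \<in> W" using c M by (intro add sc)
    then show ?thesis using v0 by (simp add: W_def)
  qed
  then obtain t x where t: "0 < t" "x \<in> msp K" "?v = t *\<^sub>R h x" by (rule visible_ray)
  have "x \<in> \<Delta>" using t vK cone3_scaleD [of t "h x"] by (simp add: cone_region_def)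
  then show ?thesis using that t by blast
qed

lemma seg_in_\<Delta>:
  assumes u: "u \<in> \<Delta>" and v: "v \<in> \<Delta>" and r: "0 \<le> r" "r \<le> mdist K u v" and ne: "u \<noteq> v"
  shows "seg K u v r \<in> \<Delta>"
proof -
  have M': "u \<in> msp K" "v \<in> msp K" using u v \<Delta>_model by auto
  note l = narrow_short [OF narrow_\<Delta> u v]
  note S = short_S_nonzero [OF M' ne l]
  have pos: "0 < sn K (mdist K u v)" using sn_pos [OF mdist_pos [OF M' ne] l] .
  have "sn K (mdist K u v) *\<^sub>R h (seg K u v r) \<in> cone3 K o' a' b'"
    unfolding hom_seg [OF S] using u v r
    by (intro cone3_add cone3_scale sn_nonneg) (auto simp: cone_region_def intro: short_mono [OF l])
  then show ?thesis using cone3_scaleD [OF _ pos] seg_in_model [OF M' S] by (simp add: cone_region_def)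
qed

text \<open>Only the two sides at \<open>o'\<close> are known in advance, and in the degenerate case
  they have to cover the region. This is not immediate only if \<open>o'\<close> is between
  \<open>a'\<close> and \<open>b'\<close>.\<close>

lemma degenerate_two_sides:
  assumes deg: degenerate and x: "x \<in> \<Delta>"
  shows "\<exists>s t. 0 \<le> s \<and> 0 \<le> t \<and> (h x = s *\<^sub>R h o' + t *\<^sub>R h a' \<or> h x = s *\<^sub>R h o' + t *\<^sub>R h b')"
proof -
  obtain s t where st: "0 \<le> s" "0 \<le> t" and
    "h o' = s *\<^sub>R h a' + t *\<^sub>R h b' \<or> h a' = s *\<^sub>R h o' + t *\<^sub>R h b' \<or> h b' = s *\<^sub>R h o' + t *\<^sub>R h a'"
    using deg unfolding degenerate_def by blast
  then consider "h o' = s *\<^sub>R h a' + t *\<^sub>R h b'" | "h a' = s *\<^sub>R h o' + t *\<^sub>R h b'" | "h b' = s *\<^sub>R h o' + t *\<^sub>R h a'" by blast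
  note cases = this
  obtain \<alpha> \<beta> \<gamma> where c: "0 \<le> \<alpha>" "0 \<le> \<beta>" "0 \<le> \<gamma>" "h x = \<alpha> *\<^sub>R h o' + \<beta> *\<^sub>R h a' + \<gamma> *\<^sub>R h b'"
    using x by (rule \<Delta>_coords)
  from cases show ?thesis
  proof cases
    case 1
    have s: "0 < s"
    proof (rule ccontr)
      assume "\<not> 0 < s"
      then have o: "h o' = t *\<^sub>R h b'" using 1 st by simp
      then have "t \<noteq> 0" using hom_nonzero [OF M(1)] by auto
      then show False using hom_ray_unique [OF M(1,3) _ o] st ne by simp
    qed
    have t: "0 < t"
    proof (rule ccontr)
      assume "\<not> 0 < t"
      then have o: "h o' = s *\<^sub>R h a'" using 1 st by simp
      then show False using hom_ray_unique [OF M(1,2) s o] ne by simp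
    qed
    define \<beta>' \<gamma>' where "\<beta>' = \<alpha> * s + \<beta>" and "\<gamma>' = \<alpha> * t + \<gamma>"
    have hx: "h x = \<beta>' *\<^sub>R h a' + \<gamma>' *\<^sub>R h b'" unfolding c(4) 1 \<beta>'_def \<gamma>'_def by (simp add: algebra_simps)
    have nn: "0 \<le> \<beta>'" "0 \<le> \<gamma>'" using c st by (auto simp: \<beta>'_def \<gamma>'_def)
    show ?thesis
    \<comment> \<open>The ratio of the weights decides on which side of \<open>o'\<close> the point
      is; as much of \<open>h o'\<close> as possible is split off.\<close>
    proof (cases "\<beta>' * t \<le> \<gamma>' * s")
      case True
      have "(\<beta>' / s) *\<^sub>R h o' + (\<gamma>' - \<beta>' * t / s) *\<^sub>R h b' = h x"
        unfolding hx 1 using s by (simp add: algebra_simps)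
      moreover have "0 \<le> \<beta>' / s" "0 \<le> \<gamma>' - \<beta>' * t / s" using nn s True by (simp_all add: divide_le_eq)
      ultimately show ?thesis by metis
    next
      case False
      have "(\<gamma>' / t) *\<^sub>R h o' + (\<beta>' - \<gamma>' * s / t) *\<^sub>R h a' = h x"
        unfolding hx 1 using t by (simp add: algebra_simps)
      moreover have "0 \<le> \<gamma>' / t" "0 \<le> \<beta>' - \<gamma>' * s / t" using nn t False by (simp_all add: divide_le_eq)
      ultimately show ?thesis by metis
    qed
  next
    case 2
    have "h x = (\<beta> * s + \<alpha>) *\<^sub>R h o' + (\<beta> * t + \<gamma>) *\<^sub>R h b'"
      unfolding c(4) 2 by (simp add: algebra_simps)
    moreover have "0 \<le> \<beta> * s + \<alpha>" "0 \<le> \<beta> * t + \<gamma>" using c st by auto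
    ultimately show ?thesis by blast
  next
    case 3
    have "h x = (\<gamma> * s + \<alpha>) *\<^sub>R h o' + (\<gamma> * t + \<beta>) *\<^sub>R h a'"
      unfolding c(4) 3 by (simp add: algebra_simps)
    moreover have "0 \<le> \<gamma> * s + \<alpha>" "0 \<le> \<gamma> * t + \<beta>" using c st by auto
    ultimately show ?thesis by blast
  qed
qed

text \<open>The segment from \<open>x\<close> is prolonged beyond \<open>p\<close> by subtracting
  multiples of \<open>h x\<close> from \<open>h p\<close>, until the first weight vanishes.\<close>

lemma opposite_boundary_point:
  assumes p: "p \<in> \<Delta>" and c: "0 < p1" "0 < p2" "0 < p3" and hp: "h p = p1 *\<^sub>R h o' + p2 *\<^sub>R h a' + p3 *\<^sub>R h b'"
    and x: "x \<in> \<Delta>" "x \<noteq> p"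
  obtains z \<rho> where "z \<in> T" "z \<noteq> x" "0 < \<rho>" "\<rho> < mdist K z x" "p = seg K z x \<rho>"
proof -
  obtain x1 x2 x3 where xc: "0 \<le> x1" "0 \<le> x2" "0 \<le> x3" and hx: "h x = x1 *\<^sub>R h o' + x2 *\<^sub>R h a' + x3 *\<^sub>R h b'"
    using x(1) by (rule \<Delta>_coords)
  have M': "p \<in> msp K" "x \<in> msp K" using p x \<Delta>_model by auto
  \<comment> \<open>The candidates for the multiple at which a weight of \<open>h p\<close> is used
    up; the least of them keeps the others nonnegative.\<close>
  define R where "R = (if 0 < x1 then {p1 / x1} else {}) \<union> (if 0 < x2 then {p2 / x2} else {}) \<union>
    (if 0 < x3 then {p3 / x3} else {})"
  have fin: "finite R" by (auto simp: R_def)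
  have "0 < x1 \<or> 0 < x2 \<or> 0 < x3" using hx hom_nonzero [OF M'(2)] xc by auto
  then have Rne: "R \<noteq> {}" by (auto simp: R_def)
  define \<tau> where "\<tau> = Min R"
  have \<tau>R: "\<tau> \<in> R" unfolding \<tau>_def using fin Rne by (rule Min_in)
  then have \<tau>: "0 < \<tau>" using c by (auto simp: R_def split: if_splits)
  have le: "\<tau> \<le> y" if "y \<in> R" for y unfolding \<tau>_def by (rule Min_le [OF fin that])
  have q_aux: "0 \<le> u - \<tau> * v" if "0 < u" "0 \<le> v" "0 < v \<Longrightarrow> u / v \<in> R" for u v
  proof (cases "v = 0")
    case False
    then have "\<tau> \<le> u / v" "0 < v" using le that by auto
    then show ?thesis by (simp add: pos_le_divide_eq)
  qed (use that in simp)
  have q: "0 \<le> p1 - \<tau> * x1" "0 \<le> p2 - \<tau> * x2" "0 \<le> p3 - \<tau> * x3"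
    using q_aux [of p1 x1] q_aux [of p2 x2] q_aux [of p3 x3] c xc by (simp_all add: R_def)
  have q0: "p1 - \<tau> * x1 = 0 \<or> p2 - \<tau> * x2 = 0 \<or> p3 - \<tau> * x3 = 0"
    using \<tau>R by (auto simp: R_def split: if_splits)
  have hp_split: "h p = (p1 - \<tau> * x1) *\<^sub>R h o' + (p2 - \<tau> * x2) *\<^sub>R h a' + (p3 - \<tau> * x3) *\<^sub>R h b' + \<tau> *\<^sub>R h x"
    unfolding hp hx by (simp add: algebra_simps)
  have pos: "0 < (p1 - \<tau> * x1) + (p2 - \<tau> * x2) + (p3 - \<tau> * x3)"
  proof (rule ccontr)
    assume "\<not> ?thesis"
    with q have "p1 - \<tau> * x1 = 0" "p2 - \<tau> * x2 = 0" "p3 - \<tau> * x3 = 0" by linarith+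
    then have "h p = \<tau> *\<^sub>R h x" using hp_split by simp
    then show False using hom_ray_unique [OF M' \<tau>] x by simp
  qed
  obtain t z where z: "0 < t" "z \<in> \<Delta>" "(p1 - \<tau> * x1) *\<^sub>R h o' + (p2 - \<tau> * x2) *\<^sub>R h a' + (p3 - \<tau> * x3) *\<^sub>R h b' = t *\<^sub>R h z"
    by (rule point_of_weights [OF q pos])
  then have hp': "h p = t *\<^sub>R h z + \<tau> *\<^sub>R h x" using hp_split by simp
  have zM: "z \<in> msp K" using z \<Delta>_model by auto
  have hz: "h z = ((p1 - \<tau> * x1) / t) *\<^sub>R h o' + ((p2 - \<tau> * x2) / t) *\<^sub>R h a' + ((p3 - \<tau> * x3) / t) *\<^sub>R h b'"
    using z by (intro scaleR_combination(2)) auto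
  from boundary_in_T [OF zM _ _ _ _ hz] have zT: "z \<in> T" using q q0 z(1) by auto
  have zx: "z \<noteq> x"
  proof
    assume "z = x"
    then have "h p = (t + \<tau>) *\<^sub>R h x" using hp' by (simp add: scaleR_left_distrib)
    then show False using hom_ray_unique [OF M', of "t + \<tau>"] z(1) \<tau> x by simp
  qed
  have "0 \<le> t" "0 \<le> \<tau>" using z(1) \<tau> by auto
  then obtain \<rho> where "p = seg K z x \<rho>" "0 < \<rho>" "\<rho> < mdist K z x"
    by (rule seg_of_cone [OF zM M'(2,1) zx narrow_short [OF narrow_\<Delta> z(2) x(1)] _ _ hp']) (use z(1) \<tau> in blast)
  then show ?thesis by (intro that [OF zT zx])
qed

text \<open>\<open>x - y\<close> is orthogonal to the vertices up to a constant, and it lies in their span.\<close>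

lemma determined_by_vertex_distances:
  assumes x: "x \<in> \<Delta>" and y: "y \<in> \<Delta>"
    and d: "\<And>e. e \<in> {o', a', b'} \<Longrightarrow> mdist K x e = mdist K y e"
  shows "x = y"
proof -
  have M': "x \<in> msp K" "y \<in> msp K" using x y \<Delta>_model by auto
  obtain \<alpha> \<beta> \<gamma> where hx: "h x = \<alpha> *\<^sub>R h o' + \<beta> *\<^sub>R h a' + \<gamma> *\<^sub>R h b'" using x by (rule \<Delta>_coords)
  obtain \<alpha>' \<beta>' \<gamma>' where hy: "h y = \<alpha>' *\<^sub>R h o' + \<beta>' *\<^sub>R h a' + \<gamma>' *\<^sub>R h b'" using y by (rule \<Delta>_coords)
  define w where "w = x - y"
  define c where "c = (bform K x x - bform K y y) / 2"
  have e: "bform K w e = c" if "e \<in> {o', a', b'}" for e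
  proof -
    have eM: "e \<in> msp K" using that M by auto
    have "Q_form K x e = Q_form K y e"
      using d [OF that] md_mdist [OF M'(1) eM] md_mdist [OF M'(2) eM] by simp
    then show ?thesis
      by (simp add: Q_form_def w_def c_def bform_commute [of K e x] bform_commute [of K e y] field_simps)
  qed
  define k where "k = (\<alpha> - \<alpha>') + (\<beta> - \<beta>') + (\<gamma> - \<gamma>')"
  have hw: "h x - h y = (\<alpha> - \<alpha>') *\<^sub>R h o' + (\<beta> - \<beta>') *\<^sub>R h a' + (\<gamma> - \<gamma>') *\<^sub>R h b'"
    unfolding hx hy by (simp add: algebra_simps)
  \<comment> \<open>The product vanishes for different reasons: \<open>k = 0\<close> by the height
    for \<open>K = 0\<close>, and \<open>c = 0\<close> by the equation of the quadric
    otherwise.\<close>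
  have kc: "k * c = 0" and w: "w = (\<alpha> - \<alpha>') *\<^sub>R o' + (\<beta> - \<beta>') *\<^sub>R a' + (\<gamma> - \<gamma>') *\<^sub>R b'"
  proof -
    show "k * c = 0"
    proof (cases "K = 0")
      case True
      have "(h x - h y) $ 3 = k" unfolding hw using hom_nth3 [OF True] M by (simp add: k_def)
      then have "k = 0" using hom_nth3 [OF True] M' by simp
      then show ?thesis by simp
    next
      case False
      have "K * bform K x x = K * bform K y y" using bform_self [OF False] M' by simp
      then show ?thesis using False by (simp add: c_def)
    qed
    show "w = (\<alpha> - \<alpha>') *\<^sub>R o' + (\<beta> - \<beta>') *\<^sub>R a' + (\<gamma> - \<gamma>') *\<^sub>R b'"
    proof (cases "K = 0")
      case True
      have "(h x - h y) $ 3 = k" unfolding hw using hom_nth3 [OF True] M by (simp add: k_def)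
      then have k0: "k = 0" using hom_nth3 [OF True] M' by simp
      have "w = (\<alpha> - \<alpha>') *\<^sub>R o' + (\<beta> - \<beta>') *\<^sub>R a' + (\<gamma> - \<gamma>') *\<^sub>R b' + k *\<^sub>R axis 3 1"
        using hw True by (simp add: w_def hom_def k_def scaleR_right_distrib scaleR_left_distrib)
      then show ?thesis using k0 by simp
    next
      case False
      then show ?thesis using hw by (simp add: hom_def w_def)
    qed
  qed
  have "bform K w w = (\<alpha> - \<alpha>') * bform K w o' + (\<beta> - \<beta>') * bform K w a' + (\<gamma> - \<gamma>') * bform K w b'"
    by (subst (2) w) simp
  also have "\<dots> = k * c" using e by (simp add: k_def algebra_simps)
  finally have "Q_form K x y = 0" using kc by (simp add: Q_form_def w_def [symmetric] del: bform_linear)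
  then show ?thesis by (rule Q_form_eq_0 [OF M'])
qed

end

text \<open>The sides at \<open>o'\<close> and one point with three positive weights are the initial
  data; the third side is not assumed.\<close>

locale filled_triangle = model_tri K o' a' b' + maximal_iso K "cone_region K o' a' b'" F
  for K o' a' b' and F :: "((real^3) \<times> 'a::metric_space) set" +
  fixes p' :: "real^3" and p1 p2 p3 :: real
  assumes side_a: "between_set (msp K) (mdist K) o' a' \<subseteq> fst ` F"
    and side_b: "between_set (msp K) (mdist K) o' b' \<subseteq> fst ` F"
    and p_F: "p' \<in> fst ` F"
    and p_pos: "0 < p1" "0 < p2" "0 < p3"
    and p_weights: "hom K p' = p1 *\<^sub>R hom K o' + p2 *\<^sub>R hom K a' + p3 *\<^sub>R hom K b'"
begin

lemma dom_\<Delta>: "x \<in> fst ` F \<Longrightarrow> x \<in> \<Delta>"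
  using F_D by force

lemma chord_by_weights:
  assumes u: "u \<in> fst ` F" and v: "v \<in> fst ` F" and ne: "u \<noteq> v"
    and c: "c \<in> fst ` F" "0 < s" "0 < t" "h c = s *\<^sub>R h u + t *\<^sub>R h v"
    and x: "x \<in> \<Delta>" "0 < s'" "0 < t'" "h x = s' *\<^sub>R h u + t' *\<^sub>R h v"
  shows "x \<in> fst ` F"
proof -
  have M': "u \<in> msp K" "v \<in> msp K" "c \<in> msp K" "x \<in> msp K"
    using dom_\<Delta> u v c x \<Delta>_model by blast+
  have l: "short K (mdist K u v)" using narrow_short [OF narrow_\<Delta>] dom_\<Delta> u v by blast
  obtain r where r: "c = seg K u v r" "0 < r" "r < mdist K u v"
    using seg_of_cone [OF M'(1,2,3) ne l _ _ c(4)] c(2,3) by force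
  obtain q where q: "x = seg K u v q" "0 < q" "q < mdist K u v"
    using seg_of_cone [OF M'(1,2,4) ne l _ _ x(4)] x(2,3) by force
  obtain u2 v2 c2 where "(u, u2) \<in> F" "(v, v2) \<in> F" "(c, c2) \<in> F" using u v c by auto
  then show ?thesis using chord [of u u2 v v2 r c2 q] r q x(1) by simp
qed

lemma vertices_dom: "o' \<in> fst ` F" "a' \<in> fst ` F" "b' \<in> fst ` F"
  using side_a side_b M by (auto simp: between_set_def subset_iff)

lemma side_a_dom: "x \<in> \<Delta> \<Longrightarrow> 0 \<le> s \<Longrightarrow> 0 \<le> t \<Longrightarrow> h x = s *\<^sub>R h o' + t *\<^sub>R h a' \<Longrightarrow> x \<in> fst ` F"
  using side_a between_set_iff_cone [OF M(1,2) sides_short(1), of x] \<Delta>_model by blast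

lemma side_b_dom: "x \<in> \<Delta> \<Longrightarrow> 0 \<le> s \<Longrightarrow> 0 \<le> t \<Longrightarrow> h x = s *\<^sub>R h o' + t *\<^sub>R h b' \<Longrightarrow> x \<in> fst ` F"
  using side_b between_set_iff_cone [OF M(1,3) sides_short'(3), of x] \<Delta>_model by blast

text \<open>The cevian from \<open>a'\<close> through \<open>p'\<close> meets the cevian from \<open>b'\<close> through \<open>x\<close> in a point with
  weights \<open>(p1 * x1, p1 * x2, p3 * x1)\<close>.\<close>

lemma interior_dom:
  assumes nd: "\<not> degenerate" and x: "x \<in> \<Delta>" "0 < x1" "0 < x2" "0 < x3"
    and hx: "h x = x1 *\<^sub>R h o' + x2 *\<^sub>R h a' + x3 *\<^sub>R h b'"
  shows "x \<in> fst ` F"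
proof -
  \<comment> \<open>\<open>w\<close> is the foot on \<open>o' b'\<close> of the cevian from
    \<open>a'\<close> through \<open>p'\<close>, \<open>y\<close> the foot on \<open>o' a'\<close>
    of the cevian from \<open>b'\<close> through \<open>x\<close>, and \<open>c\<close> their
    crossing.\<close>
  obtain t w where w: "0 < t" "w \<in> \<Delta>" "p1 *\<^sub>R h o' + 0 *\<^sub>R h a' + p3 *\<^sub>R h b' = t *\<^sub>R h w"
    by (rule point_of_weights [of p1 0 p3]) (use p_pos in auto)
  obtain t' y where y: "0 < t'" "y \<in> \<Delta>" "x1 *\<^sub>R h o' + x2 *\<^sub>R h a' + 0 *\<^sub>R h b' = t' *\<^sub>R h y"
    by (rule point_of_weights [of x1 x2 0]) (use x in auto)
  obtain q c where c: "0 < q" "c \<in> \<Delta>" "(p1 * x1) *\<^sub>R h o' + (p1 * x2) *\<^sub>R h a' + (p3 * x1) *\<^sub>R h b' = q *\<^sub>R h c"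
    by (rule point_of_weights [of "p1 * x1" "p1 * x2" "p3 * x1"]) (use p_pos x in \<open>auto intro!: add_pos_pos\<close>)
  have hw: "h w = (p1 / t) *\<^sub>R h o' + (p3 / t) *\<^sub>R h b'"
    using w by (intro scaleR_combination(1)) auto
  have hy: "h y = (x1 / t') *\<^sub>R h o' + (x2 / t') *\<^sub>R h a'"
    using y by (intro scaleR_combination(1)) auto
  have wF: "w \<in> fst ` F" using w p_pos by (intro side_b_dom [OF _ _ _ hw]) auto
  have yF: "y \<in> fst ` F" using y x by (intro side_a_dom [OF _ _ _ hy]) auto
  have aw: "a' \<noteq> w"
  proof
    assume "a' = w"
    then have "h a' = (p1 / t) *\<^sub>R h o' + (p3 / t) *\<^sub>R h b'" using hw by simp
    moreover have "0 \<le> p1 / t" "0 \<le> p3 / t" using p_pos w by auto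
    ultimately show False using nd unfolding degenerate_def by blast
  qed
  have yb: "b' \<noteq> y"
  proof
    assume "b' = y"
    then have "h b' = (x1 / t') *\<^sub>R h o' + (x2 / t') *\<^sub>R h a'" using hy by simp
    moreover have "0 \<le> x1 / t'" "0 \<le> x2 / t'" using x y by auto
    ultimately show False using nd unfolding degenerate_def by blast
  qed
  have hp': "h p' = p2 *\<^sub>R h a' + t *\<^sub>R h w"
    using p_weights w(3) by (simp add: add.commute add.left_commute flip: w(3))
  have "q *\<^sub>R h c = (p1 * x2) *\<^sub>R h a' + (x1 * t) *\<^sub>R h w"
    unfolding scaleR_scaleR [symmetric, of x1 t] c(3) [symmetric] w(3) [symmetric] by (simp add: algebra_simps)
  then have hc: "h c = (p1 * x2 / q) *\<^sub>R h a' + (x1 * t / q) *\<^sub>R h w"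
    by (rule scaleR_combination(1) [rotated]) (use c in simp)
  have "q *\<^sub>R h c = (p3 * x1) *\<^sub>R h b' + (p1 * t') *\<^sub>R h y"
    unfolding scaleR_scaleR [symmetric, of p1 t'] c(3) [symmetric] y(3) [symmetric] by (simp add: algebra_simps)
  then have hc': "h c = (p3 * x1 / q) *\<^sub>R h b' + (p1 * t' / q) *\<^sub>R h y"
    by (rule scaleR_combination(1) [rotated]) (use c in simp)
  have hx': "h x = x3 *\<^sub>R h b' + t' *\<^sub>R h y"
    using hx y(3) by (simp add: add.commute flip: y(3))
  \<comment> \<open>\<open>p'\<close> is the known inner point of the cevian from \<open>a'\<close>
    and yields \<open>c\<close>; then \<open>c\<close> plays this role for the cevian from
    \<open>b'\<close> and yields \<open>x\<close>.\<close>
  have cF: "c \<in> fst ` F"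
    by (rule chord_by_weights [OF vertices_dom(2) wF aw p_F _ _ hp' c(2) _ _ hc]) (use p_pos w x c in auto)
  show ?thesis
    by (rule chord_by_weights [OF vertices_dom(3) yF yb cF _ _ hc' x(1) _ _ hx']) (use p_pos y x c in auto)
qed

lemma full_domain: "fst ` F = \<Delta>"
proof
  show "fst ` F \<subseteq> \<Delta>" using dom_\<Delta> by blast
  show "\<Delta> \<subseteq> fst ` F"
  proof
    fix x assume x: "x \<in> \<Delta>"
    show "x \<in> fst ` F"
    proof (cases degenerate)
      case True
      then show ?thesis using degenerate_two_sides [OF True x] side_a_dom [OF x] side_b_dom [OF x] by blast
    next
      case nd: False
      obtain x1 x2 x3 where c: "0 \<le> x1" "0 \<le> x2" "0 \<le> x3" and hx: "h x = x1 *\<^sub>R h o' + x2 *\<^sub>R h a' + x3 *\<^sub>R h b'"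
        using x by (rule \<Delta>_coords)
      consider "x2 = 0" | "x3 = 0" | "0 < x1" "0 < x2" "0 < x3" | "x1 = 0" "0 < x2" "0 < x3" using c by linarith
      then show ?thesis
      proof cases
        case 1
        then show ?thesis using side_b_dom [OF x c(1,3)] hx by simp
      next
        case 2
        then show ?thesis using side_a_dom [OF x c(1,2)] hx by simp
      next
        case 3
        then show ?thesis using interior_dom [OF nd x _ _ _ hx] by blast
      next
        \<comment> \<open>The open third side: inner points of the segment from \<open>o'\<close>
          have three positive weights, and \<open>x\<close> is their limit.\<close>
        case 4
        have hx4: "h x = x2 *\<^sub>R h a' + x3 *\<^sub>R h b'" using hx 4 by simp
        have xM: "x \<in> msp K" using x \<Delta>_model by blast
        have ox: "o' \<noteq> x"
        proof
          assume "o' = x"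
          then have "h o' = x2 *\<^sub>R h a' + x3 *\<^sub>R h b'" using hx4 by simp
          then show False using nd c unfolding degenerate_def by blast
        qed
        note l = narrow_short [OF narrow_\<Delta> vertices_\<Delta>(1) x]
        show ?thesis
        proof (rule limit_on_segment [OF vertices_\<Delta>(1) x ox])
          fix r assume r: "0 < r" "r < mdist K o' x"
          obtain s t where st: "0 < s" "0 < t" "h (seg K o' x r) = s *\<^sub>R h o' + t *\<^sub>R h x"
            by (rule seg_weights [OF M(1) xM ox l r])
          have "h (seg K o' x r) = s *\<^sub>R h o' + (t * x2) *\<^sub>R h a' + (t * x3) *\<^sub>R h b'"
            unfolding st(3) hx4 by (simp add: algebra_simps)
          then show "seg K o' x r \<in> fst ` F"
            using seg_in_\<Delta> [OF vertices_\<Delta>(1) x _ _ ox, of r] r st 4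
            by (intro interior_dom [OF nd, of _ s "t * x2" "t * x3"]) auto
        qed
      qed
    qed
  qed
qed

end

section \<open>Uniqueness of the filling\<close>

definition iso_on :: "real \<Rightarrow> (real^3) set \<Rightarrow> (real^3 \<Rightarrow> 'a::metric_space) \<Rightarrow> bool" where
  "iso_on K D f \<longleftrightarrow> (\<forall>u\<in>D. \<forall>v\<in>D. dist (f u) (f v) = mdist K u v)"

text \<open>The perimeter of \<open>z\<close>, \<open>y\<close>, \<open>f x\<close> may be too large for the four-point condition, so \<open>z\<close> is replaced by a
  point close to the branching point; then twice the length of the branches bounds it.\<close>

lemma no_branching:
  fixes f :: "real^3 \<Rightarrow> 'a::metric_space"
  assumes curv: "curvature_ge K TYPE('a)" and f: "iso_on K D f" and D: "D \<subseteq> msp K"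
    and zx: "z \<in> D" "x \<in> D" "z \<noteq> x" and l: "short K (mdist K z x)"
    and segD: "\<And>r. 0 \<le> r \<Longrightarrow> r \<le> mdist K z x \<Longrightarrow> seg K z x r \<in> D"
    and \<rho>: "0 < \<rho>" "\<rho> < mdist K z x" and half: "short K (2 * (mdist K z x - \<rho>))"
    and y: "dist (f z) y = mdist K z x" "dist (f (seg K z x \<rho>)) y = mdist K z x - \<rho>"
  shows "y = f x"
proof -
  define l where "l = mdist K z x"
  have M: "z \<in> msp K" "x \<in> msp K" using zx D by auto
  note S = short_S_nonzero [OF M zx(3) l]
  define t where "t = l - \<rho>"
  have t: "0 < t" "short K (2 * t)" using \<rho> half by (auto simp: t_def l_def)
  obtain \<delta> where \<delta>: "\<delta> > 0" "short K (2 * t + \<delta>)" using short_less_ex [OF t(2)] by blast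
  define r where "r = min \<rho> \<delta>"
  have r: "0 < r" "r \<le> \<rho>" "r \<le> \<delta>" using \<rho> \<delta> by (auto simp: r_def)
  define c z2 where "c = f (seg K z x \<rho>)" and "z2 = f (seg K z x (\<rho> - r))"
  have inD: "seg K z x \<rho> \<in> D" "seg K z x (\<rho> - r) \<in> D" using segD \<rho> r by auto
  have d: "dist z2 c = r" "dist c (f x) = t" "dist z2 (f x) = r + t" "dist (f z) z2 = \<rho> - r"
  proof -
    show "dist z2 c = r"
      using f inD mdist_seg_seg [OF M S, of "\<rho> - r" \<rho>] r \<rho> by (simp add: iso_on_def c_def z2_def)
    show "dist c (f x) = t"
      using f inD zx mdist_seg_end [OF M S, of \<rho>] \<rho> by (simp add: iso_on_def c_def t_def l_def)
    show "dist z2 (f x) = r + t"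
      using f inD zx mdist_seg_end [OF M S, of "\<rho> - r"] \<rho> r by (simp add: iso_on_def z2_def t_def l_def)
    show "dist (f z) z2 = \<rho> - r"
      using f inD zx mdist_seg_start [OF M S, of "\<rho> - r"] \<rho> r by (simp add: iso_on_def z2_def)
  qed
  have cy: "dist c y = t" using y(2) by (simp add: c_def t_def l_def)
  have "dist (f z) y \<le> dist (f z) z2 + dist z2 y" "dist z2 y \<le> dist z2 c + dist c y" by metric+
  then have zy: "dist z2 y = r + t" using d y(1) cy by (simp add: t_def l_def)
  have "dist y (f x) \<le> dist c y + dist c (f x)" by metric
  then have yx: "dist y (f x) \<le> 2 * t" using cy d by simp
  have per: "short K (peri z2 y (f x) / 2)"
    using yx d zy r by (intro short_mono [OF \<delta>(2)]) (simp add: peri_def dist_commute)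
  have ne: "z2 \<noteq> c" "f x \<noteq> c" using d r t by auto
  \<comment> \<open>\<open>y\<close> has the distances of \<open>f x\<close> from \<open>z2\<close>
    and \<open>c\<close>, so by \<open>stewart_self\<close> everything cancels except the term with
    the distance from \<open>y\<close> to \<open>f x\<close>.\<close>
  have "sn K t * md K (r + t) + sn K r * md K (dist y (f x))
    \<le> sn K (r + t) * md K t + (sn K t * md K r + sn K r * md K t)"
    using stewart_ineq [OF curv _ ne per] d zy cy by (simp add: dist_commute)
  then have "sn K r * md K (dist y (f x)) \<le> 0"
    using stewart_self [of K t r] by (simp add: add.commute)
  moreover have "0 < sn K r" using r t by (intro sn_pos short_mono [OF \<delta>(2)]) auto
  ultimately have "md K (dist y (f x)) \<le> md K 0" by (simp add: mult_le_0_iff)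
  moreover have "short K (dist y (f x))" using short_mono [OF t(2) yx] .
  ultimately have "dist y (f x) \<le> 0"
    using md_le_distD [of K "dist y (f x)" 0] by (auto simp: short_def)
  then show ?thesis by simp
qed

context model_tri
begin

text \<open>Only the distances of \<open>y\<close> to the vertices enter, so \<open>y\<close> may be
  a point of another filling.\<close>

lemma boundary_dist_ge:
  fixes f :: "real^3 \<Rightarrow> 'a::metric_space"
  assumes curv: "curvature_ge K TYPE('a)" and f: "iso_on K \<Delta> f" and z: "z \<in> T"
    and x: "x \<in> \<Delta>" and y: "\<And>e. e \<in> {o', a', b'} \<Longrightarrow> dist y (f e) = mdist K x e"
  shows "mdist K x z \<le> dist y (f z)"
proof -
  have *: "mdist K x z \<le> dist y (f z)"
    if e: "e1 \<in> {o', a', b'}" "e2 \<in> {o', a', b'}" and zb: "z \<in> between_set (msp K) (mdist K) e1 e2" for e1 e2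
  proof -
    have eD: "e1 \<in> \<Delta>" "e2 \<in> \<Delta>" using e vertices_\<Delta> by auto
    have M': "e1 \<in> msp K" "e2 \<in> msp K" "x \<in> msp K" "z \<in> msp K"
      using eD x \<Delta>_model zb by (auto simp: between_set_def)
    have zD: "z \<in> \<Delta>" using z T_subset by blast
    have d: "mdist K e1 e2 = mdist K e1 z + mdist K z e2" using zb by (simp add: between_set_def)
    show ?thesis
    proof (cases "e1 = e2")
      case True
      have nn: "0 \<le> mdist K e1 z" "0 \<le> mdist K z e2" using M' by auto
      have "mdist K e1 z + mdist K z e2 = 0" using d True M' by simp
      then have "mdist K e1 z = 0" using nn by linarith
      then have "e1 = z" using mdist_eq_0 [OF M'(1,4)] by simp
      then show ?thesis using y [OF e(1)] by simp
    next
      case False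
      note l = narrow_short [OF narrow_\<Delta> eD]
      define r where "r = mdist K e1 z"
      have zr: "z = seg K e1 e2 r" using model_between(1) [OF M'(1,2,4) False l] d by (simp add: r_def)
      have r: "0 \<le> r" "r \<le> mdist K e1 e2" using d M' by (auto simp: r_def)
      have dd: "dist (f e1) (f e2) = mdist K e1 e2" "dist (f e1) (f z) = r" "dist (f z) (f e2) = mdist K e1 e2 - r"
        using f eD zD d by (auto simp: iso_on_def r_def)
      have "short K ((mdist K e1 x + mdist K x e2 + mdist K e2 e1) / 2)"
        using narrow_\<Delta> eD x unfolding narrow_def by blast
      then have per: "short K (peri (f e1) y (f e2) / 2)"
        using y e dd(1) by (simp add: peri_def dist_commute mdist_commute [of K e1 x] mdist_commute [of K e2 e1])
      show ?thesis
        using chord_dist_ge [OF curv M'(1,2,3) False l r dd y [OF e(1)] y [OF e(2)] per] by (simp add: zr)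
    qed
  qed
  from z consider "z \<in> between_set (msp K) (mdist K) o' a'" | "z \<in> between_set (msp K) (mdist K) a' b'"
    | "z \<in> between_set (msp K) (mdist K) b' o'" unfolding model_triangle_def by blast
  then show ?thesis using *[of o' a'] *[of a' b'] *[of b' o'] by cases auto
qed

lemma filling_unique:
  fixes f g :: "real^3 \<Rightarrow> 'a::metric_space"
  assumes curv: "curvature_ge K TYPE('a)" and f: "iso_on K \<Delta> f" and g: "iso_on K \<Delta> g"
    and e: "\<And>e. e \<in> {o', a', b'} \<Longrightarrow> f e = g e"
    and p: "p \<in> \<Delta>" "0 < p1" "0 < p2" "0 < p3" "h p = p1 *\<^sub>R h o' + p2 *\<^sub>R h a' + p3 *\<^sub>R h b'"
    and fp: "f p = g p" and x: "x \<in> \<Delta>"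
  shows "g x = f x"
proof (cases "x = p")
  case False
  obtain z \<rho> where z: "z \<in> T" "z \<noteq> x" and \<rho>: "0 < \<rho>" "\<rho> < mdist K z x" "p = seg K z x \<rho>"
    by (rule opposite_boundary_point [OF p x False])
  define l where "l = mdist K z x"
  have zD: "z \<in> \<Delta>" using z T_subset by blast
  have M': "z \<in> msp K" "x \<in> msp K" using zD x \<Delta>_model by auto
  note sh = narrow_short [OF narrow_\<Delta> zD x]
  note S = short_S_nonzero [OF M' z(2) sh]
  have segD: "seg K z x r \<in> \<Delta>" if "0 \<le> r" "r \<le> l" for r
    using seg_in_\<Delta> [OF zD x _ _ z(2)] that by (simp add: l_def)
  have md: "mdist K (seg K z x r) (seg K z x s) = s - r" if "0 \<le> r" "r \<le> s" "s \<le> l" for r s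
    using mdist_seg_seg [OF M' S] that by (simp add: l_def)
  have dz: "mdist K z (seg K z x r) = r" if "0 \<le> r" "r \<le> l" for r
    using mdist_seg_start [OF M' S] that by (simp add: l_def)
  \<comment> \<open>The path from \<open>f z\<close> to \<open>p\<close> in one filling and on to
    the point in the other has length \<open>r\<close>, and \<open>boundary_dist_ge\<close> forbids
    a shorter distance of its ends.\<close>
  have straight: "dist (f z) (g (seg K z x r)) = r" if r: "\<rho> \<le> r" "r \<le> l" for r
  proof -
    have rD: "seg K z x r \<in> \<Delta>" using segD r \<rho> by simp
    have "mdist K (seg K z x r) z \<le> dist (g (seg K z x r)) (f z)"
      using rD g e vertices_\<Delta> by (intro boundary_dist_ge [OF curv f z(1) rD]) (auto simp: iso_on_def)
    then have "r \<le> dist (f z) (g (seg K z x r))"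
      using dz [of r] r \<rho> by (simp add: mdist_commute [of K _ z] dist_commute)
    moreover have "dist (f z) (g (seg K z x r)) \<le> dist (f z) (f p) + dist (g p) (g (seg K z x r))"
      unfolding fp by metric
    moreover have "dist (f z) (f p) = \<rho>" using f zD p(1) dz [of \<rho>] \<rho> by (simp add: iso_on_def l_def)
    moreover have "dist (g p) (g (seg K z x r)) = r - \<rho>"
      using g p(1) rD md [of \<rho> r] \<rho> r by (simp add: iso_on_def)
    ultimately show ?thesis by simp
  qed
  have xl: "seg K z x l = x" using seg_end [OF S] by (simp add: l_def)
  \<comment> \<open>\<open>no_branching\<close> needs twice the length of the branches to be short.
    The branch from \<open>p\<close> to \<open>x\<close> is therefore halved, and the two halves are
    treated in turn.\<close>
  define m where "m = (\<rho> + l) / 2"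
  have m: "\<rho> < m" "m < l" "2 * (m - \<rho>) = l - \<rho>" "2 * (l - m) = l - \<rho>" using \<rho> by (auto simp: m_def l_def field_simps)
  have half: "short K (l - \<rho>)" using \<rho> by (intro short_mono [OF sh]) (simp add: l_def)
  define y where "y = seg K z x m"
  have y: "y \<in> \<Delta>" "mdist K z y = m" using segD dz m \<rho> by (auto simp: y_def)
  have yz: "z \<noteq> y" using y m \<rho> M'(1) by auto
  have sub: "seg K z y r = seg K z x r" if "0 \<le> r" "r \<le> m" for r
    unfolding y_def using that m \<rho> by (intro seg_seg [OF M' z(2) sh]) (auto simp: l_def)
  have gy: "g y = f y"
  proof (rule no_branching [OF curv f \<Delta>_model zD y(1) yz, where \<rho> = \<rho>])
    show "short K (mdist K z y)" using narrow_short [OF narrow_\<Delta> zD y(1)] .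
    show "seg K z y r \<in> \<Delta>" if "0 \<le> r" "r \<le> mdist K z y" for r
      using that sub segD y m by simp
    show "0 < \<rho>" "\<rho> < mdist K z y" using \<rho> y m by auto
    show "short K (2 * (mdist K z y - \<rho>))" using half m y by simp
    show "dist (f z) (g y) = mdist K z y" using straight [of m] m y by (simp add: y_def)
    have "dist (g p) (g y) = m - \<rho>" using g p(1) y(1) md [of \<rho> m] \<rho> m by (simp add: iso_on_def y_def)
    then show "dist (f (seg K z y \<rho>)) (g y) = mdist K z y - \<rho>"
      using sub [of \<rho>] \<rho> m y fp by simp
  qed
  show ?thesis
  proof (rule no_branching [OF curv f \<Delta>_model zD x z(2) sh, where \<rho> = m])
    show "seg K z x r \<in> \<Delta>" if "0 \<le> r" "r \<le> mdist K z x" for r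
      using that segD by (simp add: l_def)
    show "0 < m" "m < mdist K z x" using \<rho> m by (auto simp: l_def)
    show "short K (2 * (mdist K z x - m))" using half m by (simp add: l_def)
    show "dist (f z) (g x) = mdist K z x" using straight [of l] xl \<rho> by (simp add: l_def)
    have "dist (g y) (g x) = l - m" using g y(1) x md [of m l] xl \<rho> m by (simp add: iso_on_def y_def)
    then show "dist (f (seg K z x m)) (g x) = mdist K z x - m"
      using gy by (simp add: y_def l_def)
  qed
qed (simp add: fp)

end

section \<open>From the hypotheses on the geodesics to the initial relation\<close>

lemma constant_comp_angle:
  fixes \<gamma> \<eta> :: "real \<Rightarrow> 'a::metric_space"
  assumes curv: "curvature_ge K TYPE('a)"
    and v: "0 < v" "0 < l\<^sub>1" and w: "0 < w" "0 < l\<^sub>2"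
    and \<gamma>: "\<And>s t. 0 \<le> s \<Longrightarrow> s \<le> t \<Longrightarrow> t \<le> l\<^sub>1 \<Longrightarrow> dist (\<gamma> s) (\<gamma> t) = v * (t - s)"
    and \<eta>: "\<And>s t. 0 \<le> s \<Longrightarrow> s \<le> t \<Longrightarrow> t \<le> l\<^sub>2 \<Longrightarrow> dist (\<eta> s) (\<eta> t) = w * (t - s)"
    and o: "\<eta> 0 = \<gamma> 0"
    and per: "short K (peri (\<gamma> 0) (\<gamma> l\<^sub>1) (\<eta> l\<^sub>2) / 2)"
    and ang: "angle K \<gamma> \<eta> = comp_angle K (\<gamma> 0) (\<gamma> l\<^sub>1) (\<eta> l\<^sub>2)"
    and s: "0 < s" "s \<le> l\<^sub>1" and t: "0 < t" "t \<le> l\<^sub>2"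
  shows "comp_angle K (\<gamma> 0) (\<gamma> s) (\<eta> t) = comp_angle K (\<gamma> 0) (\<gamma> l\<^sub>1) (\<eta> l\<^sub>2)"
proof -
  have d\<gamma>: "dist (\<gamma> 0) (\<gamma> r) = v * r" if "0 \<le> r" "r \<le> l\<^sub>1" for r using \<gamma> [of 0 r] that by simp
  have d\<eta>: "dist (\<gamma> 0) (\<eta> r) = w * r" if "0 \<le> r" "r \<le> l\<^sub>2" for r using \<eta> [of 0 r] that o by simp
  have ne\<gamma>: "\<gamma> 0 \<noteq> \<gamma> r" if "0 < r" "r \<le> l\<^sub>1" for r using d\<gamma> [of r] that v by auto
  have ne\<eta>: "\<gamma> 0 \<noteq> \<eta> r" if "0 < r" "r \<le> l\<^sub>2" for r using d\<eta> [of r] that w by auto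
  have perst: "short K (peri (\<gamma> 0) (\<gamma> s) (\<eta> t) / 2)" if "0 \<le> s" "s \<le> l\<^sub>1" "0 \<le> t" "t \<le> l\<^sub>2" for s t
  proof -
    have "dist (\<gamma> s) (\<eta> t) \<le> dist (\<gamma> s) (\<gamma> l\<^sub>1) + dist (\<gamma> l\<^sub>1) (\<eta> l\<^sub>2) + dist (\<eta> t) (\<eta> l\<^sub>2)" by metric
    then have "peri (\<gamma> 0) (\<gamma> s) (\<eta> t) \<le> peri (\<gamma> 0) (\<gamma> l\<^sub>1) (\<eta> l\<^sub>2)"
      using \<gamma> [of s l\<^sub>1] \<eta> [of t l\<^sub>2] d\<gamma> [of s] d\<gamma> [of l\<^sub>1] d\<eta> [of t] d\<eta> [of l\<^sub>2] that v w
      by (simp add: peri_def dist_commute algebra_simps)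
    then show ?thesis by (intro short_mono [OF per]) simp
  qed
  show ?thesis
  proof (rule antimono_Lim_constant [of l\<^sub>1 l\<^sub>2 _ pi])
    fix s s' t assume h: "0 < s'" "s' \<le> s" "s \<le> l\<^sub>1" "0 < t" "t \<le> l\<^sub>2"
    show "comp_angle K (\<gamma> 0) (\<gamma> s) (\<eta> t) \<le> comp_angle K (\<gamma> 0) (\<gamma> s') (\<eta> t)"
    proof (rule comp_angle_antimono [OF curv])
      show "dist (\<gamma> 0) (\<gamma> s) = dist (\<gamma> 0) (\<gamma> s') + dist (\<gamma> s') (\<gamma> s)"
        using h d\<gamma> \<gamma> [of s' s] by (simp add: algebra_simps)
      show "\<gamma> 0 \<noteq> \<gamma> s'" "\<eta> t \<noteq> \<gamma> 0" using h ne\<gamma> [of s'] ne\<eta> [of t] by auto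
      show "short K (peri (\<gamma> 0) (\<eta> t) (\<gamma> s) / 2)"
        using perst [of s t] h by (simp add: peri_def dist_commute algebra_simps)
    qed
  next
    fix s t t' assume h: "0 < s" "s \<le> l\<^sub>1" "0 < t'" "t' \<le> t" "t \<le> l\<^sub>2"
    have "comp_angle K (\<gamma> 0) (\<eta> t) (\<gamma> s) \<le> comp_angle K (\<gamma> 0) (\<eta> t') (\<gamma> s)"
    proof (rule comp_angle_antimono [OF curv])
      show "dist (\<gamma> 0) (\<eta> t) = dist (\<gamma> 0) (\<eta> t') + dist (\<eta> t') (\<eta> t)"
        using h d\<eta> \<eta> [of t' t] by (simp add: algebra_simps)
      show "\<gamma> 0 \<noteq> \<eta> t'" "\<gamma> s \<noteq> \<gamma> 0" using h ne\<eta> [of t'] ne\<gamma> [of s] by auto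
      show "short K (peri (\<gamma> 0) (\<gamma> s) (\<eta> t) / 2)" using perst [of s t] h by simp
    qed
    then show "comp_angle K (\<gamma> 0) (\<gamma> s) (\<eta> t) \<le> comp_angle K (\<gamma> 0) (\<gamma> s) (\<eta> t')"
      by (simp add: comp_angle_commute)
  next
    fix s t assume h: "0 < s" "s \<le> l\<^sub>1" "0 < t" "t \<le> l\<^sub>2"
    then show "comp_angle K (\<gamma> 0) (\<gamma> s) (\<eta> t) \<le> pi"
      using comp_angle_cos(3) [OF ne\<gamma> ne\<eta>, of s t] perst [of s t] by simp
  next
    show "Lim (at_right 0 \<times>\<^sub>F at_right 0) (\<lambda>(s, t). comp_angle K (\<gamma> 0) (\<gamma> s) (\<eta> t)) =
        comp_angle K (\<gamma> 0) (\<gamma> l\<^sub>1) (\<eta> l\<^sub>2)"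
      using ang unfolding angle_def .
  qed (use v w s t in auto)
qed

context model_tri
begin

lemma sides_partial_iso:
  fixes g k :: "real \<Rightarrow> 'a::metric_space"
  assumes g: "\<And>s t. 0 \<le> s \<Longrightarrow> s \<le> t \<Longrightarrow> t \<le> mdist K o' a' \<Longrightarrow> dist (g s) (g t) = t - s"
    and k: "\<And>s t. 0 \<le> s \<Longrightarrow> s \<le> t \<Longrightarrow> t \<le> mdist K o' b' \<Longrightarrow> dist (k s) (k t) = t - s"
    and gk: "\<And>s t. 0 \<le> s \<Longrightarrow> s \<le> mdist K o' a' \<Longrightarrow> 0 \<le> t \<Longrightarrow> t \<le> mdist K o' b' \<Longrightarrow>
      dist (g s) (k t) = mdist K (seg K o' a' s) (seg K o' b' t)"
  shows "partial_iso K \<Delta> ((\<lambda>s. (seg K o' a' s, g s)) ` {0..mdist K o' a'} \<union>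
    (\<lambda>t. (seg K o' b' t, k t)) ` {0..mdist K o' b'})" (is "partial_iso K \<Delta> (?A \<union> ?B)")
proof -
  note S = short_S_nonzero [OF M(1,2) ne(1) sides_short(1)] short_S_nonzero [OF M(1,3) ne(2) sides_short'(3)]
  have one: "dist (f s) (f t) = mdist K (seg K o' e s) (seg K o' e t)"
    if e: "e \<in> msp K" "sn K (mdist K o' e) \<noteq> 0"
      and f: "\<And>s t. 0 \<le> s \<Longrightarrow> s \<le> t \<Longrightarrow> t \<le> mdist K o' e \<Longrightarrow> dist (f s) (f t) = t - s"
      and st: "s \<in> {0..mdist K o' e}" "t \<in> {0..mdist K o' e}" for f :: "real \<Rightarrow> 'a" and e s t
  proof (cases "s \<le> t")
    case True
    then show ?thesis using f [of s t] mdist_seg_seg [OF M(1) e, of s t] st by simp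
  next
    case False
    then show ?thesis using f [of t s] mdist_seg_seg [OF M(1) e, of t s] st
      by (simp add: dist_commute [of "f s"] mdist_commute [of K "seg K o' e s"])
  qed
  have "dist u v = mdist K x y" if xy: "(x, u) \<in> ?A \<union> ?B" "(y, v) \<in> ?A \<union> ?B" for x u y v
  proof -
    consider "(x, u) \<in> ?A" "(y, v) \<in> ?A" | "(x, u) \<in> ?B" "(y, v) \<in> ?B" | "(x, u) \<in> ?A" "(y, v) \<in> ?B"
      | "(x, u) \<in> ?B" "(y, v) \<in> ?A" using xy by blast
    then show ?thesis
    proof cases
      case 1
      then show ?thesis using one [OF M(2) S(1) g] by auto
    next
      case 2
      then show ?thesis using one [OF M(3) S(2) k] by auto
    next
      case 3
      then show ?thesis using gk by auto
    next
      case 4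
      then show ?thesis using gk by (auto simp: dist_commute [of u] mdist_commute [of K x])
    qed
  qed
  moreover have "?A \<union> ?B \<subseteq> \<Delta> \<times> UNIV"
    using seg_in_\<Delta> [OF vertices_\<Delta>(1,2) _ _ ne(1)] seg_in_\<Delta> [OF vertices_\<Delta>(1,3) _ _ ne(2)] by auto
  ultimately show ?thesis unfolding partial_iso_def by blast
qed

text \<open>The chord gives lower bounds for the distances from \<open>p\<close> to all points of
  the sides. Equality holds at the two ends of the chord, which are inner points of the sides, and
  spreads along each side by \<open>side_dist_eq\<close>.\<close>

lemma chord_point_partial_iso:
  fixes g k :: "real \<Rightarrow> 'a::metric_space"
  assumes curv: "curvature_ge K TYPE('a)"
    and g: "\<And>s t. 0 \<le> s \<Longrightarrow> s \<le> t \<Longrightarrow> t \<le> mdist K o' a' \<Longrightarrow> dist (g s) (g t) = t - s"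
    and k: "\<And>s t. 0 \<le> s \<Longrightarrow> s \<le> t \<Longrightarrow> t \<le> mdist K o' b' \<Longrightarrow> dist (k s) (k t) = t - s"
    and gk: "\<And>s t. 0 \<le> s \<Longrightarrow> s \<le> mdist K o' a' \<Longrightarrow> 0 \<le> t \<Longrightarrow> t \<le> mdist K o' b' \<Longrightarrow>
      dist (g s) (k t) = mdist K (seg K o' a' s) (seg K o' b' t)"
    and s0: "0 < s\<^sub>0" "s\<^sub>0 < mdist K o' a'" and t0: "0 < t\<^sub>0" "t\<^sub>0 < mdist K o' b'"
    and r: "0 < r" "r < mdist K (seg K o' a' s\<^sub>0) (seg K o' b' t\<^sub>0)"
    and p: "dist (g s\<^sub>0) p = r" "dist p (k t\<^sub>0) = mdist K (seg K o' a' s\<^sub>0) (seg K o' b' t\<^sub>0) - r"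
  shows "partial_iso K \<Delta> (insert (seg K (seg K o' a' s\<^sub>0) (seg K o' b' t\<^sub>0) r, p)
    ((\<lambda>s. (seg K o' a' s, g s)) ` {0..mdist K o' a'} \<union>
     (\<lambda>t. (seg K o' b' t, k t)) ` {0..mdist K o' b'}))" (is "partial_iso K \<Delta> (insert _ ?F)")
proof -
  have iso: "partial_iso K \<Delta> ?F" by (rule sides_partial_iso [OF g k gk])
  define u v where "u = seg K o' a' s\<^sub>0" and "v = seg K o' b' t\<^sub>0"
  define p' where "p' = seg K u v r"
  have uF: "(u, g s\<^sub>0) \<in> ?F" and vF: "(v, k t\<^sub>0) \<in> ?F" using s0 t0 by (auto simp: u_def v_def)
  have uv: "u \<in> \<Delta>" "v \<in> \<Delta>" using partial_isoD(2) [OF iso uF uF] partial_isoD(2) [OF iso vF vF] by auto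
  have M': "u \<in> msp K" "v \<in> msp K" using uv \<Delta>_model by auto
  have r': "0 < r" "r < mdist K u v" using r by (auto simp: u_def v_def)
  have ne': "u \<noteq> v" using r' M' by auto
  note sh = narrow_short [OF narrow_\<Delta> uv]
  note S = short_S_nonzero [OF M' ne' sh]
  have p'D: "p' \<in> \<Delta>" unfolding p'_def using r' by (intro seg_in_\<Delta> uv ne') auto
  have p'M: "p' \<in> msp K" using p'D \<Delta>_model by auto
  have duv: "dist (g s\<^sub>0) (k t\<^sub>0) = mdist K u v" using partial_isoD(1) [OF iso uF vF] .
  have dp: "dist (g s\<^sub>0) p = r" "dist p (k t\<^sub>0) = mdist K u v - r" using p by (auto simp: u_def v_def)
  have per3: "short K (peri a b c / 2)" if a: "(x, a) \<in> ?F" and b: "(y, b) \<in> ?F" and c: "(z, c) \<in> ?F" for x y z a b c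
  proof -
    note partial_isoD(2) [OF iso a a] partial_isoD(2) [OF iso b b] partial_isoD(2) [OF iso c c]
    then have "short K ((mdist K x y + mdist K y z + mdist K z x) / 2)"
      using narrow_\<Delta> unfolding narrow_def by blast
    then show ?thesis
      unfolding peri_def partial_isoD(1) [OF iso a b] partial_isoD(1) [OF iso b c] partial_isoD(1) [OF iso c a] .
  qed
  have ge: "mdist K p' y' \<le> dist p y" if y: "(y', y) \<in> ?F" for y' y
  proof -
    have yM: "y' \<in> msp K" using partial_isoD(2) [OF iso y y] \<Delta>_model by auto
    have "mdist K y' p' \<le> dist y p"
      unfolding p'_def
      by (rule chord_dist_ge [OF curv M' yM ne' sh _ _ duv dp])
        (use r' partial_isoD(1) [OF iso y uF] partial_isoD(1) [OF iso y vF] per3 [OF uF y vF] in auto)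
    then show ?thesis by (simp only: mdist_commute [of K p' y'] dist_commute [of p y])
  qed
  \<comment> \<open>Replacing an end of the chord by its point \<open>p\<close> does not increase
    the perimeter, so bounds for triangles within the two sides suffice.\<close>
  have per_p: "short K (peri y p (g s\<^sub>0) / 2)" "short K (peri y p (k t\<^sub>0) / 2)" if y: "(y', y) \<in> ?F" for y' y
  proof -
    have "dist y p \<le> dist y (k t\<^sub>0) + dist p (k t\<^sub>0)" "dist y p \<le> dist y (g s\<^sub>0) + dist p (g s\<^sub>0)" by metric+
    then have "peri y p (g s\<^sub>0) \<le> peri (g s\<^sub>0) y (k t\<^sub>0)" "peri y p (k t\<^sub>0) \<le> peri (g s\<^sub>0) y (k t\<^sub>0)"
      using duv dp by (auto simp: peri_def dist_commute)
    then show "short K (peri y p (g s\<^sub>0) / 2)" "short K (peri y p (k t\<^sub>0) / 2)"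
      by (auto intro!: short_mono [OF per3 [OF uF y vF]])
  qed
  have inA: "(seg K o' a' s, g s) \<in> ?F" if "0 \<le> s" "s \<le> mdist K o' a'" for s using that by auto
  have inB: "(seg K o' b' t, k t) \<in> ?F" if "0 \<le> t" "t \<le> mdist K o' b'" for t using that by auto
  have pu: "dist p (g s\<^sub>0) = mdist K p' (seg K o' a' s\<^sub>0)"
    using dp(1) mdist_seg_start [OF M' S, of r] r'
    by (simp add: p'_def u_def [symmetric] dist_commute mdist_commute [of K _ u])
  have pv: "dist p (k t\<^sub>0) = mdist K p' (seg K o' b' t\<^sub>0)"
    using dp(2) mdist_seg_end [OF M' S, of r] r' by (simp add: p'_def v_def [symmetric])
  have eqA: "dist p (g s) = mdist K p' (seg K o' a' s)" if "0 \<le> s" "s \<le> mdist K o' a'" for s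
    by (rule side_dist_eq [OF curv M(1,2) p'M ne(1) sides_short(1) g ge [OF inA] pu s0 per_p(1) [OF inA] that])
  have eqB: "dist p (k t) = mdist K p' (seg K o' b' t)" if "0 \<le> t" "t \<le> mdist K o' b'" for t
    by (rule side_dist_eq [OF curv M(1,3) p'M ne(2) sides_short'(3) k ge [OF inB] pv t0 per_p(2) [OF inB] that])
  show ?thesis
  proof (rule partial_iso_insert [OF iso \<Delta>_model])
    show "seg K (seg K o' a' s\<^sub>0) (seg K o' b' t\<^sub>0) r \<in> \<Delta>" using p'D by (simp add: p'_def u_def v_def)
    fix y' y assume "(y', y) \<in> ?F"
    then have "dist p y = mdist K p' y'" using eqA eqB by auto
    then show "dist y p = mdist K y' (seg K (seg K o' a' s\<^sub>0) (seg K o' b' t\<^sub>0) r)"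
      by (simp add: p'_def u_def v_def dist_commute [of y p] mdist_commute [of K y'])
  qed
qed

lemma chord_point_weights:
  assumes s0: "0 < s\<^sub>0" "s\<^sub>0 < mdist K o' a'" and t0: "0 < t\<^sub>0" "t\<^sub>0 < mdist K o' b'"
    and r: "0 < r" "r < mdist K (seg K o' a' s\<^sub>0) (seg K o' b' t\<^sub>0)"
  obtains p1 p2 p3 where "0 < p1" "0 < p2" "0 < p3"
    "h (seg K (seg K o' a' s\<^sub>0) (seg K o' b' t\<^sub>0) r) = p1 *\<^sub>R h o' + p2 *\<^sub>R h a' + p3 *\<^sub>R h b'"
proof -
  define u v where "u = seg K o' a' s\<^sub>0" and "v = seg K o' b' t\<^sub>0"
  have uv: "u \<in> \<Delta>" "v \<in> \<Delta>"
    using s0 t0 by (auto simp: u_def v_def intro!: seg_in_\<Delta> vertices_\<Delta> ne)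
  have M': "u \<in> msp K" "v \<in> msp K" using uv \<Delta>_model by auto
  have ne': "u \<noteq> v" using r M' by (auto simp: u_def [symmetric] v_def [symmetric])
  obtain s t where st: "0 < s" "0 < t" "h u = s *\<^sub>R h o' + t *\<^sub>R h a'"
    unfolding u_def by (rule seg_weights [OF M(1,2) ne(1) sides_short(1) s0])
  obtain s' t' where st': "0 < s'" "0 < t'" "h v = s' *\<^sub>R h o' + t' *\<^sub>R h b'"
    unfolding v_def by (rule seg_weights [OF M(1,3) ne(2) sides_short'(3) t0])
  obtain q q' where q: "0 < q" "0 < q'" "h (seg K u v r) = q *\<^sub>R h u + q' *\<^sub>R h v"
    by (rule seg_weights [OF M' ne' narrow_short [OF narrow_\<Delta> uv] r [folded u_def v_def]])
  have "h (seg K u v r) = (q * s + q' * s') *\<^sub>R h o' + (q * t) *\<^sub>R h a' + (q' * t') *\<^sub>R h b'"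
    unfolding q(3) st(3) st'(3) by (simp add: algebra_simps)
  moreover have "0 < q * s + q' * s'" "0 < q * t" "0 < q' * t'" using q st st' by (auto intro: add_pos_pos)
  ultimately show ?thesis using that by (simp add: u_def v_def)
qed

section \<open>Existence of the filling and conclusion\<close>

lemma filling_exists:
  fixes F :: "((real^3) \<times> 'a::metric_space) set"
  assumes alex: "alexandrov_space K TYPE('a)" and F: "partial_iso K \<Delta> F"
    and side_a: "between_set (msp K) (mdist K) o' a' \<subseteq> fst ` F"
    and side_b: "between_set (msp K) (mdist K) o' b' \<subseteq> fst ` F"
    and p: "p' \<in> fst ` F" "0 < p1" "0 < p2" "0 < p3" "h p' = p1 *\<^sub>R h o' + p2 *\<^sub>R h a' + p3 *\<^sub>R h b'"
  obtains f where "iso_on K \<Delta> f" "\<forall>(x, u) \<in> F. f x = u"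
proof -
  obtain G where G: "F \<subseteq> G" "partial_iso K \<Delta> G" "\<forall>x u. partial_iso K \<Delta> (insert (x, u) G) \<longrightarrow> (x, u) \<in> G"
    by (rule partial_iso_maximal [OF F])
  have FG: "fst ` F \<subseteq> fst ` G" using G(1) by (rule image_mono)
  have max: "\<And>x u. partial_iso K \<Delta> (insert (x, u) G) \<Longrightarrow> (x, u) \<in> G" using G(3) by simp
  have pG: "p' \<in> fst ` G" using p(1) FG by (rule subsetD [rotated])
  interpret filled_triangle K o' a' b' G p' p1 p2 p3
    by unfold_locales
      (fact alex narrow_\<Delta> G(2) max subset_trans [OF side_a FG] subset_trans [OF side_b FG] pG p(2-5))+
  define f where "f = (\<lambda>x. SOME u. (x, u) \<in> G)"
  have f: "(x, f x) \<in> G" if "x \<in> \<Delta>" for x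
    unfolding f_def by (rule someI_ex) (use that full_domain in force)
  have "iso_on K \<Delta> f" unfolding iso_on_def using F_dist f by blast
  moreover have "f x = u" if "(x, u) \<in> F" for x u
    using F_unique [of x "f x" u] f [of x] F_D [of x u] that G(1) by blast
  ultimately show ?thesis using that by blast
qed

lemma closed_iso_image:
  assumes f: "iso_on K \<Delta> f" shows "closed (f ` \<Delta>)"
proof -
  have "continuous_on \<Delta> f"
    unfolding continuous_on_def
  proof
    fix x assume x: "x \<in> \<Delta>"
    then have xM: "x \<in> msp K" using \<Delta>_model by auto
    have "continuous_on \<Delta> (mdist K x)"
      using continuous_on_subset [OF continuous_on_mdist [OF xM] \<Delta>_model] .
    then have "(mdist K x \<longlongrightarrow> 0) (at x within \<Delta>)"
      using x xM by (auto simp: continuous_on_def)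
    moreover have "eventually (\<lambda>y. mdist K x y = dist (f y) (f x)) (at x within \<Delta>)"
      using f x
      by (auto simp: eventually_at_filter iso_on_def mdist_commute [of K x] intro!: always_eventually)
    ultimately have "((\<lambda>y. dist (f y) (f x)) \<longlongrightarrow> 0) (at x within \<Delta>)"
      by (rule Lim_transform_eventually)
    then show "(f \<longlongrightarrow> f x) (at x within \<Delta>)" by (rule tendsto_dist_iff [THEN iffD2])
  qed
  then show ?thesis using compact_continuous_image [OF _ compact_\<Delta>] compact_imp_closed by blast
qed

end

theorem corollary5:
  fixes \<kappa> l\<^sub>1 l\<^sub>2 l\<^sub>1' l\<^sub>2' :: real
    and \<gamma> \<eta> :: "real \<Rightarrow> 'a::metric_space"
    and x\<^sub>0 p :: 'a
    and x\<^sub>0' a' b' :: "real^3"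
  assumes "alexandrov_space \<kappa> TYPE('a)"
    and "geodesic l\<^sub>1 \<gamma>" and "geodesic l\<^sub>2 \<eta>"
    and "\<gamma> 0 = x\<^sub>0" and "\<eta> 0 = x\<^sub>0"
    and "\<gamma> l\<^sub>1 \<noteq> x\<^sub>0" and "\<eta> l\<^sub>2 \<noteq> x\<^sub>0"
    and "\<kappa> > 0 \<longrightarrow> peri x\<^sub>0 (\<gamma> l\<^sub>1) (\<eta> l\<^sub>2) < 2 * pi / sqrt \<kappa>"
    and "angle \<kappa> \<gamma> \<eta> = comp_angle \<kappa> x\<^sub>0 (\<gamma> l\<^sub>1) (\<eta> l\<^sub>2)"
    and "l\<^sub>1' \<in> {0<..<l\<^sub>1}" and "l\<^sub>2' \<in> {0<..<l\<^sub>2}"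
    and "p \<in> open_between_set UNIV dist (\<gamma> l\<^sub>1') (\<eta> l\<^sub>2')"
    and "comp_triangle \<kappa> x\<^sub>0 (\<gamma> l\<^sub>1) (\<eta> l\<^sub>2) x\<^sub>0' a' b'"
  shows "\<exists>!D. closed D \<and> p \<in> D \<and>
           triangular_region \<kappa> x\<^sub>0' a' b' x\<^sub>0 (\<gamma> l\<^sub>1) (\<eta> l\<^sub>2) D"
proof -
  note alex = assms(1)
  have curv: "curvature_ge \<kappa> TYPE('a)" using alex by (simp add: alexandrov_space_def)
  have M: "x\<^sub>0' \<in> msp \<kappa>" "a' \<in> msp \<kappa>" "b' \<in> msp \<kappa>"
    and model_eq: "mdist \<kappa> x\<^sub>0' a' = dist x\<^sub>0 (\<gamma> l\<^sub>1)" "mdist \<kappa> a' b' = dist (\<gamma> l\<^sub>1) (\<eta> l\<^sub>2)"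
      "mdist \<kappa> b' x\<^sub>0' = dist (\<eta> l\<^sub>2) x\<^sub>0"
    using assms(13) by (auto simp: comp_triangle_def)
  have short_peri: "short \<kappa> (peri x\<^sub>0 (\<gamma> l\<^sub>1) (\<eta> l\<^sub>2) / 2)" using assms(8) by (simp add: short_half_iff)
  interpret model_tri \<kappa> x\<^sub>0' a' b'
  proof
    show "x\<^sub>0' \<in> msp \<kappa>" "a' \<in> msp \<kappa>" "b' \<in> msp \<kappa>" by (fact M)+
    show "x\<^sub>0' \<noteq> a'" using model_eq(1) assms(6) M(1) by auto
    show "x\<^sub>0' \<noteq> b'" using model_eq(3) assms(7) M(1) by auto
    show "short \<kappa> ((mdist \<kappa> x\<^sub>0' a' + mdist \<kappa> a' b' + mdist \<kappa> b' x\<^sub>0') / 2)"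
      using short_peri by (simp add: model_eq peri_def)
  qed
  obtain v where v: "0 < v" "0 < l\<^sub>1" "v * l\<^sub>1 = dist x\<^sub>0 (\<gamma> l\<^sub>1)"
    and \<gamma>: "\<And>s t. 0 \<le> s \<Longrightarrow> s \<le> t \<Longrightarrow> t \<le> l\<^sub>1 \<Longrightarrow> dist (\<gamma> s) (\<gamma> t) = v * (t - s)"
    using geodesic_dist [OF assms(2)] assms(4,6) by metis
  obtain w where w: "0 < w" "0 < l\<^sub>2" "w * l\<^sub>2 = dist x\<^sub>0 (\<eta> l\<^sub>2)"
    and \<eta>: "\<And>s t. 0 \<le> s \<Longrightarrow> s \<le> t \<Longrightarrow> t \<le> l\<^sub>2 \<Longrightarrow> dist (\<eta> s) (\<eta> t) = w * (t - s)"
    using geodesic_dist [OF assms(3)] assms(5,7) by metis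
  define L\<^sub>1 L\<^sub>2 where "L\<^sub>1 = mdist \<kappa> x\<^sub>0' a'" and "L\<^sub>2 = mdist \<kappa> x\<^sub>0' b'"
  have L: "L\<^sub>1 = v * l\<^sub>1" "L\<^sub>2 = w * l\<^sub>2"
    using model_eq v(3) w(3) by (auto simp: L\<^sub>1_def L\<^sub>2_def mdist_commute [of \<kappa> x\<^sub>0' b'] dist_commute)
  \<comment> \<open>Geodesics are only required to have constant speed; these are the
    reparametrisations by arc length.\<close>
  define g k where "g = (\<lambda>s. \<gamma> (s / v))" and "k = (\<lambda>s. \<eta> (s / w))"
  have g: "dist (g s) (g t) = t - s" if "0 \<le> s" "s \<le> t" "t \<le> L\<^sub>1" for s t
  proof -
    have "t / v \<le> l\<^sub>1" "s / v \<le> t / v" "0 \<le> s / v"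
      using that v L by (auto simp: pos_divide_le_eq mult.commute divide_right_mono)
    then show ?thesis using \<gamma> [of "s / v" "t / v"] v(1) by (simp add: g_def right_diff_distrib)
  qed
  have k: "dist (k s) (k t) = t - s" if "0 \<le> s" "s \<le> t" "t \<le> L\<^sub>2" for s t
  proof -
    have "t / w \<le> l\<^sub>2" "s / w \<le> t / w" "0 \<le> s / w"
      using that w L by (auto simp: pos_divide_le_eq mult.commute divide_right_mono)
    then show ?thesis using \<eta> [of "s / w" "t / w"] w(1) by (simp add: k_def right_diff_distrib)
  qed
  have "L\<^sub>1 / v = l\<^sub>1" "L\<^sub>2 / w = l\<^sub>2" using v(1) w(1) L by auto
  then have ends: "g 0 = \<gamma> 0" "k 0 = g 0" "g L\<^sub>1 = \<gamma> l\<^sub>1" "k L\<^sub>2 = \<eta> l\<^sub>2"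
    using assms(4,5) by (simp_all add: g_def k_def)
  have o: "\<eta> 0 = \<gamma> 0" using assms(4,5) by simp
  have per\<gamma>: "short \<kappa> (peri (\<gamma> 0) (\<gamma> l\<^sub>1) (\<eta> l\<^sub>2) / 2)" using short_peri assms(4) by simp
  have ang\<gamma>: "angle \<kappa> \<gamma> \<eta> = comp_angle \<kappa> (\<gamma> 0) (\<gamma> l\<^sub>1) (\<eta> l\<^sub>2)" using assms(4,9) by simp
  have ang: "comp_angle \<kappa> (g 0) (g s) (k t) = comp_angle \<kappa> (g 0) (g L\<^sub>1) (k L\<^sub>2)"
    if st: "0 < s" "s \<le> L\<^sub>1" "0 < t" "t \<le> L\<^sub>2" for s t
  proof -
    have "0 < s / v" "s / v \<le> l\<^sub>1" "0 < t / w" "t / w \<le> l\<^sub>2"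
      using st v(1) w(1) L by (auto simp: pos_divide_le_eq mult.commute)
    from constant_comp_angle [OF curv v(1,2) w(1,2) \<gamma> \<eta> o per\<gamma> ang\<gamma> this] show ?thesis
      unfolding ends by (simp add: g_def k_def)
  qed
  have gk: "dist (g s) (k t) = mdist \<kappa> (seg \<kappa> x\<^sub>0' a' s) (seg \<kappa> x\<^sub>0' b' t)"
    if st: "0 \<le> s" "s \<le> L\<^sub>1" "0 \<le> t" "t \<le> L\<^sub>2" for s t
  proof (rule hinge_dist [OF M L\<^sub>1_def L\<^sub>2_def _ _ _ g k ends(2) _ ang st])
    show "0 < L\<^sub>1" "0 < L\<^sub>2" using v w L by auto
    show "short \<kappa> (peri (g 0) (g L\<^sub>1) (k L\<^sub>2) / 2)" using per\<gamma> by (simp add: ends)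
    show "dist (g L\<^sub>1) (k L\<^sub>2) = mdist \<kappa> a' b'" by (simp add: ends model_eq)
  qed
  define s\<^sub>0 t\<^sub>0 where "s\<^sub>0 = v * l\<^sub>1'" and "t\<^sub>0 = w * l\<^sub>2'"
  have s0: "0 < s\<^sub>0" "s\<^sub>0 < L\<^sub>1" and t0: "0 < t\<^sub>0" "t\<^sub>0 < L\<^sub>2"
    using assms(10,11) v(1) w(1) unfolding L s\<^sub>0_def t\<^sub>0_def by auto
  have gs0: "g s\<^sub>0 = \<gamma> l\<^sub>1'" and kt0: "k t\<^sub>0 = \<eta> l\<^sub>2'" using v w by (auto simp: g_def k_def s\<^sub>0_def t\<^sub>0_def)
  define l where "l = mdist \<kappa> (seg \<kappa> x\<^sub>0' a' s\<^sub>0) (seg \<kappa> x\<^sub>0' b' t\<^sub>0)"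
  have l: "dist (g s\<^sub>0) (k t\<^sub>0) = l" using gk [of s\<^sub>0 t\<^sub>0] s0 t0 by (simp add: l_def)
  define r where "r = dist (g s\<^sub>0) p"
  have pd: "dist (g s\<^sub>0) (k t\<^sub>0) = dist (g s\<^sub>0) p + dist p (k t\<^sub>0)" "p \<noteq> g s\<^sub>0" "p \<noteq> k t\<^sub>0"
    using assms(12) by (auto simp: open_between_set_def between_set_def gs0 kt0)
  then have r: "0 < r" "r < l" "dist p (k t\<^sub>0) = l - r" using l by (auto simp: r_def)
  define p' where "p' = seg \<kappa> (seg \<kappa> x\<^sub>0' a' s\<^sub>0) (seg \<kappa> x\<^sub>0' b' t\<^sub>0) r"
  define F where "F = insert (p', p) ((\<lambda>s. (seg \<kappa> x\<^sub>0' a' s, g s)) ` {0..L\<^sub>1} \<union> (\<lambda>t. (seg \<kappa> x\<^sub>0' b' t, k t)) ` {0..L\<^sub>2})"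
  have F: "partial_iso \<kappa> \<Delta> F"
    unfolding F_def p'_def L\<^sub>1_def L\<^sub>2_def
    by (rule chord_point_partial_iso [OF curv g [unfolded L\<^sub>1_def] k [unfolded L\<^sub>2_def] gk [unfolded L\<^sub>1_def L\<^sub>2_def]])
      (use s0 t0 r in \<open>auto simp: L\<^sub>1_def L\<^sub>2_def l_def r_def\<close>)
  obtain p1 p2 p3 where pw: "0 < p1" "0 < p2" "0 < p3" "h p' = p1 *\<^sub>R h x\<^sub>0' + p2 *\<^sub>R h a' + p3 *\<^sub>R h b'"
    unfolding p'_def by (rule chord_point_weights [of s\<^sub>0 t\<^sub>0 r]) (use s0 t0 r in \<open>auto simp: L\<^sub>1_def L\<^sub>2_def l_def\<close>)
  have side: "between_set (msp \<kappa>) (mdist \<kappa>) x\<^sub>0' e \<subseteq> seg \<kappa> x\<^sub>0' e ` {0..mdist \<kappa> x\<^sub>0' e}"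
    if e: "e \<in> msp \<kappa>" "x\<^sub>0' \<noteq> e" "short \<kappa> (mdist \<kappa> x\<^sub>0' e)" for e
  proof
    fix x assume "x \<in> between_set (msp \<kappa>) (mdist \<kappa>) x\<^sub>0' e"
    then have x: "x \<in> msp \<kappa>" "mdist \<kappa> x\<^sub>0' e = mdist \<kappa> x\<^sub>0' x + mdist \<kappa> x e"
      by (auto simp: between_set_def)
    then have "x = seg \<kappa> x\<^sub>0' e (mdist \<kappa> x\<^sub>0' x)" using model_between(1) [OF M(1) e(1) x(1) e(2,3)] by simp
    then show "x \<in> seg \<kappa> x\<^sub>0' e ` {0..mdist \<kappa> x\<^sub>0' e}"
      using x M(1) e(1) by (intro image_eqI [of _ _ "mdist \<kappa> x\<^sub>0' x"]) auto
  qed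
  have segF: "seg \<kappa> x\<^sub>0' a' ` {0..L\<^sub>1} \<subseteq> fst ` F" "seg \<kappa> x\<^sub>0' b' ` {0..L\<^sub>2} \<subseteq> fst ` F"
    by (auto simp: F_def image_Un image_image)
  have sides: "between_set (msp \<kappa>) (mdist \<kappa>) x\<^sub>0' a' \<subseteq> fst ` F"
      "between_set (msp \<kappa>) (mdist \<kappa>) x\<^sub>0' b' \<subseteq> fst ` F"
    using subset_trans [OF side [OF M(2) ne(1) sides_short(1)] segF(1) [unfolded L\<^sub>1_def]]
      subset_trans [OF side [OF M(3) ne(2) sides_short'(3)] segF(2) [unfolded L\<^sub>2_def]] by this
  have p'F: "p' \<in> fst ` F" by (simp add: F_def)
  obtain f where f: "iso_on \<kappa> \<Delta> f" "\<forall>(x, u) \<in> F. f x = u"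
    by (rule filling_exists [OF alex F sides p'F pw])
  note S = short_S_nonzero [OF M(1,2) ne(1) sides_short(1)] short_S_nonzero [OF M(1,3) ne(2) sides_short'(3)]
  have fe: "f x\<^sub>0' = x\<^sub>0" "f a' = \<gamma> l\<^sub>1" "f b' = \<eta> l\<^sub>2"
  proof -
    have "(seg \<kappa> x\<^sub>0' a' 0, g 0) \<in> F" "(seg \<kappa> x\<^sub>0' a' L\<^sub>1, g L\<^sub>1) \<in> F" "(seg \<kappa> x\<^sub>0' b' L\<^sub>2, k L\<^sub>2) \<in> F"
      using s0 t0 unfolding F_def by auto
    moreover have "seg \<kappa> x\<^sub>0' a' 0 = x\<^sub>0'" "seg \<kappa> x\<^sub>0' a' L\<^sub>1 = a'" "seg \<kappa> x\<^sub>0' b' L\<^sub>2 = b'"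
      unfolding L\<^sub>1_def L\<^sub>2_def by (rule seg_start [OF S(1)] seg_end [OF S(1)] seg_end [OF S(2)])+
    ultimately have "(x\<^sub>0', g 0) \<in> F" "(a', g L\<^sub>1) \<in> F" "(b', k L\<^sub>2) \<in> F" by simp_all
    then show "f x\<^sub>0' = x\<^sub>0" "f a' = \<gamma> l\<^sub>1" "f b' = \<eta> l\<^sub>2" using f(2) ends assms(4) by auto
  qed
  have p'D: "p' \<in> \<Delta>" and fp: "f p' = p" using F f(2) by (auto simp: F_def partial_iso_def)
  show ?thesis
  proof (rule ex1I [of _ "f ` \<Delta>"])
    show "closed (f ` \<Delta>) \<and> p \<in> f ` \<Delta> \<and> triangular_region \<kappa> x\<^sub>0' a' b' x\<^sub>0 (\<gamma> l\<^sub>1) (\<eta> l\<^sub>2) (f ` \<Delta>)"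
      using closed_iso_image [OF f(1)] p'D fp fe f(1)
      unfolding triangular_region_def model_region_eq iso_on_def by blast
  next
    fix E assume E: "closed E \<and> p \<in> E \<and> triangular_region \<kappa> x\<^sub>0' a' b' x\<^sub>0 (\<gamma> l\<^sub>1) (\<eta> l\<^sub>2) E"
    then obtain f' where f': "f' ` \<Delta> = E" "iso_on \<kappa> \<Delta> f'" and fe': "f' x\<^sub>0' = x\<^sub>0" "f' a' = \<gamma> l\<^sub>1" "f' b' = \<eta> l\<^sub>2"
      unfolding triangular_region_def model_region_eq iso_on_def by blast
    \<comment> \<open>The second filling might take the value \<open>p\<close> at another model
      point; its distances to the vertices are those of \<open>p'\<close>, which excludes
      this.\<close>
    obtain q where q: "q \<in> \<Delta>" "f' q = p" using E f'(1) by blast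
    have "q = p'"
    proof (rule determined_by_vertex_distances [OF q(1) p'D])
      fix e assume e: "e \<in> {x\<^sub>0', a', b'}"
      then have "e \<in> \<Delta>" "f e = f' e" using vertices_\<Delta> fe fe' by auto
      then show "mdist \<kappa> q e = mdist \<kappa> p' e"
        using f(1) f'(2) q p'D fp unfolding iso_on_def by metis
    qed
    with q fp have fp': "f p' = f' p'" by simp
    have fe_eq: "f e = f' e" if "e \<in> {x\<^sub>0', a', b'}" for e
      using that fe fe' by auto
    have "f' x = f x" if "x \<in> \<Delta>" for x
      by (rule filling_unique [OF curv f(1) f'(2) fe_eq p'D pw fp' that])
    then show "E = f ` \<Delta>" using f'(1) by force
  qed
qed

end
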